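(* Let $k = \left(\frac{3}{2}\right)^{2/3}$ and $l = \frac{1}{2}\left(\frac{3}{2}\right)^{1/3}$, and for real $r$ let $$\mathcal{B}_r = \Big\{(x,y)\in\mathcal{C}_2 :\ \frac{|x|}{k} + \Big(\frac{|y|}{l}\Big)^{1/2}\leq r^{1/3}\Big\}$$ (real cube root, so $\mathcal{B}_r=\emptyset$ for $r<0$). Let $A_n$ be the internal diffusion limited aggregation (IDLA) cluster of $n$ particles on the comb $\mathcal{C}_2$. Then, for every $\varepsilon>0$, we have with probability $1$ $$\mathcal{B}_{n(1-\varepsilon)}\subset A_n\quad\text{for all sufficiently large } n.$$
   Context: The comb $\mathcal{C}_2$ is the graph with vertex set $\mathbb{Z}^2$ (vertices written $(x,y)$) obtained from the square lattice $\mathbb{Z}^2$ by deleting all horizontal edges except those on the $x$-axis. Thus $(x,y)\sim(x,y\pm1)$ for all $x,y$, and $(x,0)\sim(x\pm1,0)$ for all $x$. The origin is $o=(0,0)$. IDLA: let $(X^i_t)_{t\ge0}$, $i\in\mathbb{N}$, be independent simple random walks on $\mathcal{C}_2$ (at each step moving to a uniformly chosen neighbour), all started at $X^i_0=o$. Define $A_1=\{o\}$ and, for $i\ge2$, $A_i=A_{i-1}\cup\{X^i_{\sigma^i}\}$, where $\sigma^i=\inf\{t\ge0: X^i_t\notin A_{i-1}\}$. The random set $A_n$ is the IDLA cluster of $n$ particles. *)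

theory Defs
  imports "HOL-Probability.Probability"
begin

type_synonym vertex = "int \<times> int"

definition origin :: vertex where
  "origin = (0, 0)"

fun comb_adj :: "vertex \<Rightarrow> vertex \<Rightarrow> bool" where
  "comb_adj (x, y) (x', y') \<longleftrightarrow>
     (x' = x \<and> \<bar>y' - y\<bar> = 1) \<or> (y = 0 \<and> y' = 0 \<and> \<bar>x' - x\<bar> = 1)"

definition neighbours :: "('v \<Rightarrow> 'v \<Rightarrow> bool) \<Rightarrow> 'v \<Rightarrow> 'v set" where
  "neighbours E v = {w. E v w}"

lemma neighbours_comb_axis:
  "neighbours comb_adj (x, 0) = {(x, 1), (x, - 1), (x + 1, 0), (x - 1, 0)}"
  by (auto simp: neighbours_def)

lemma neighbours_comb_off_axis:
  "y \<noteq> 0 \<Longrightarrow> neighbours comb_adj (x, y) = {(x, y + 1), (x, y - 1)}"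
  by (auto simp: neighbours_def)

text \<open>
  The next lemma ensures that \<open>pmf_of_set\<close> below really is the uniform
  distribution: on infinite or empty sets it would be unspecified.
\<close>

lemma neighbours_comb_finite_nonempty:
  "finite (neighbours comb_adj v)" "neighbours comb_adj v \<noteq> {}"
proof -
  obtain x y where "v = (x, y)" by (cases v)
  then show "finite (neighbours comb_adj v)" "neighbours comb_adj v \<noteq> {}"
    by (cases "y = 0"; simp add: neighbours_comb_axis neighbours_comb_off_axis)+
qed

text \<open>
  Conditioned on any history of positive probability, the next
  position is uniform on the neighbours of the current one.
\<close>

definition simple_random_walk ::
    "('v \<Rightarrow> 'v \<Rightarrow> bool) \<Rightarrow> 'v \<Rightarrow> 'a measure \<Rightarrow> (nat \<Rightarrow> 'a \<Rightarrow> 'v) \<Rightarrow> bool" where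
  "simple_random_walk E v M X \<longleftrightarrow>
     (\<forall>t. X t \<in> measurable M (count_space UNIV)) \<and>
     (AE \<omega> in M. X 0 \<omega> = v) \<and>
     (\<forall>t x w. \<P>(\<omega> in M. \<forall>s\<le>t. X s \<omega> = x s) > 0 \<longrightarrow>
        \<P>(\<omega> in M. X (Suc t) \<omega> = w \<bar> \<forall>s\<le>t. X s \<omega> = x s) =
          pmf (pmf_of_set (neighbours E (x t))) w)"

text \<open>
  Independence of whole walks, regarded as random elements of the path space
  with the product sigma-algebra.
\<close>

definition independent_walks :: "'a measure \<Rightarrow> nat set \<Rightarrow> (nat \<Rightarrow> nat \<Rightarrow> 'a \<Rightarrow> 'v) \<Rightarrow> bool" where
  "independent_walks M I X \<longleftrightarrow>
     prob_space.indep_vars M (\<lambda>_. Pi\<^sub>M UNIV (\<lambda>_. count_space UNIV))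
       (\<lambda>i \<omega> t. X i t \<omega>) I"

text \<open>The value is \<open>\<infinity>\<close> if the walk never leaves \<open>A\<close>.\<close>

definition exit_time :: "(nat \<Rightarrow> 'v) \<Rightarrow> 'v set \<Rightarrow> enat" where
  "exit_time Y A = Inf (enat ` {t. Y t \<notin> A})"

text \<open>
  Here \<open>X\<close> is one realisation of all the walks: \<open>X i t\<close> is the position
  of the \<open>i\<close>-th walk at time \<open>t\<close>. Particles are numbered from 1; the
  value at 0 is a dummy. A walk that never leaves the current cluster, which
  happens with probability 0, adds nothing.
\<close>

fun idla_cluster :: "(nat \<Rightarrow> nat \<Rightarrow> vertex) \<Rightarrow> nat \<Rightarrow> vertex set" where
  "idla_cluster X 0 = {}"
| "idla_cluster X (Suc 0) = {origin}"
| "idla_cluster X (Suc (Suc n)) =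
     idla_cluster X (Suc n) \<union>
       {X (Suc (Suc n)) t | t.
          exit_time (X (Suc (Suc n))) (idla_cluster X (Suc n)) = enat t}"

definition comb_k :: real where
  "comb_k = (3 / 2) powr (2 / 3)"

definition comb_l :: real where
  "comb_l = 1 / 2 * (3 / 2) powr (1 / 3)"

text \<open>\<open>root 3\<close> is the odd real cube root, so the set is empty for \<open>r < 0\<close>.\<close>

definition comb_ball :: "real \<Rightarrow> vertex set" where
  "comb_ball r =
     {(x, y). \<bar>real_of_int x\<bar> / comb_k + sqrt (\<bar>real_of_int y\<bar> / comb_l) \<le> root 3 r}"

end

theory Submission
  imports Defs
begin

text \<open>
  The proof watches how much of a weight function the cluster collects. Fix a site \<open>z\<close> and a
  function \<open>h \<ge> 0\<close> of finite support that is subharmonic everywhere except at \<open>z\<close>. While \<open>z\<close> is vacant,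
  the walk of the next particle stays in the region of subharmonicity until it settles, so it settles
  at a site where \<open>h\<close> is on average at least \<open>h origin\<close>. After \<open>n\<close> particles the cluster should
  therefore have collected at least about \<open>n * h origin\<close>. But the settled particles occupy distinct sites other
  than \<open>z\<close>, so they cannot collect more than the sum \<open>S\<close> of \<open>h\<close> over all sites other than \<open>z\<close>. If \<open>S\<close> is
  smaller than \<open>n * h origin\<close> by a constant factor, an exponential moment bound makes it very
  unlikely that \<open>z\<close> is still vacant (\<open>prob_site_avoided\<close>). What makes this work
  is that the path of the next particle is independent of the current cluster.

  The function \<open>h\<close> imitates the Green function of the comb with pole \<open>z\<close> that vanishes on the boundary
  of the ball of radius parameter \<open>\<rho>\<close>. Along a tooth it is linear, so it is determined by its
  values \<open>g x\<close> on the axis. If the tooth at \<open>x\<close> has height \<open>comb_l * v\<^sup>2\<close> with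
  \<open>v = \<rho> - \<bar>x\<bar> / comb_k\<close>, harmonicity on the axis reads \<open>g'' = 2 * g / (comb_l * v\<^sup>2)\<close>, an Euler equation.
  Because \<open>3 * comb_l = comb_k\<^sup>2\<close> its solutions are the powers \<open>v\<^sup>3\<close> and \<open>v\<close> to the power \<open>- 2\<close>. The discrete
  second difference of the cube equals its second derivative, and that of the other power is larger than its second derivative. Hence the
  continuum solution, restricted to the lattice, is subharmonic away from the pole.
  Normalised by \<open>h origin = \<rho> ^ 3\<close>, its sum off the pole is at most \<open>\<rho> ^ 6\<close> plus a multiple of \<open>\<rho> ^ 5\<close> when \<open>z\<close> is at
  the end of its tooth, wherever that tooth is, provided that it stays away from the ends of the axis
  (\<open>comb_potential_exists\<close>): this is the mean value property that
  singles out the shape of the ball. Taking \<open>\<rho> ^ 3 = n * (1 - \<epsilon> / 2)\<close> leaves the required room, because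
  \<open>\<rho> ^ 6\<close> is then the fraction \<open>1 - \<epsilon> / 2\<close> of \<open>n * h origin\<close>.

  Only ends of teeth have to be treated, since the cluster is connected and a tooth is filled from
  its root outwards (\<open>idla_cluster_tooth_closed\<close>). A given end is vacant with probability at most
  \<open>exp (- \<gamma> * n powr (2 / 3))\<close> for large \<open>n\<close>, there are of order \<open>n powr (1 / 3)\<close> of them, and the Borel-Cantelli lemma
  concludes.
\<close>

section \<open>Averages over neighbours and potentials\<close>

definition nbr_mean :: "(vertex \<Rightarrow> real) \<Rightarrow> vertex \<Rightarrow> real" where
  "nbr_mean \<phi> v = (\<Sum>w\<in>neighbours comb_adj v. \<phi> w) / card (neighbours comb_adj v)"

lemma nbr_mean_axis:
  "nbr_mean \<phi> (x, 0) = (\<phi> (x, 1) + \<phi> (x, - 1) + \<phi> (x + 1, 0) + \<phi> (x - 1, 0)) / 4"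
  by (simp add: nbr_mean_def neighbours_comb_axis)

lemma nbr_mean_off_axis:
  "y \<noteq> 0 \<Longrightarrow> nbr_mean \<phi> (x, y) = (\<phi> (x, y + 1) + \<phi> (x, y - 1)) / 2"
  by (simp add: nbr_mean_def neighbours_comb_off_axis)

lemma nbr_mean_eq_expectation:
  "nbr_mean \<phi> v = measure_pmf.expectation (pmf_of_set (neighbours comb_adj v)) \<phi>"
  unfolding nbr_mean_def
  by (simp add: integral_pmf_of_set neighbours_comb_finite_nonempty)

text \<open>
  A weight function as in the introduction: bounded by \<open>B\<close>, subharmonic off its pole \<open>z\<close>, and of total
  weight at most \<open>S\<close> off the pole. The total is bounded over finite sets, which is how clusters meet it.
\<close>

definition pole_potential :: "vertex \<Rightarrow> real \<Rightarrow> real \<Rightarrow> (vertex \<Rightarrow> real) \<Rightarrow> bool" where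
  "pole_potential z B S h \<longleftrightarrow> finite {w. h w \<noteq> 0} \<and> (\<forall>w. 0 \<le> h w \<and> h w \<le> B) \<and>
     (\<forall>w. w \<noteq> z \<longrightarrow> h w \<le> nbr_mean h w) \<and> (\<forall>F. finite F \<longrightarrow> z \<notin> F \<longrightarrow> sum h F \<le> S)"

lemma pole_potentialI:
  assumes "finite {w. h w \<noteq> 0}" "\<And>w. 0 \<le> h w" "\<And>w. h w \<le> B"
    and "\<And>w. w \<noteq> z \<Longrightarrow> h w \<le> nbr_mean h w" "\<And>F. finite F \<Longrightarrow> z \<notin> F \<Longrightarrow> sum h F \<le> S"
  shows "pole_potential z B S h"
  using assms unfolding pole_potential_def by blast

lemma pole_potentialD:
  assumes "pole_potential z B S h"
  shows "finite {w. h w \<noteq> 0}" "0 \<le> h w" "h w \<le> B" "w \<noteq> z \<Longrightarrow> h w \<le> nbr_mean h w"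
    and "finite F \<Longrightarrow> z \<notin> F \<Longrightarrow> sum h F \<le> S"
  using assms unfolding pole_potential_def by blast+

lemma abs_le_sum_support:
  fixes \<phi> :: "'v \<Rightarrow> real"
  assumes "finite {w. \<phi> w \<noteq> 0}"
  shows "\<bar>\<phi> w\<bar> \<le> (\<Sum>w\<in>{w. \<phi> w \<noteq> 0}. \<bar>\<phi> w\<bar>)"
  using assms by (cases "\<phi> w = 0") (auto intro!: sum_nonneg member_le_sum[of w _ "\<lambda>w. \<bar>\<phi> w\<bar>"])

context prob_space
begin

lemma integrable_indicator [simp]: "S \<in> events \<Longrightarrow> integrable M (indicat_real S)"
  by (simp add: less_top[symmetric])

lemma srw_measurable:
  "simple_random_walk E v M X \<Longrightarrow> X t \<in> measurable M (count_space UNIV)"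
  by (simp add: simple_random_walk_def)

lemma srw_prob_step:
  assumes "simple_random_walk E v M X"
  shows "prob {\<omega>\<in>space M. (\<forall>s\<le>t. X s \<omega> = x s) \<and> X (Suc t) \<omega> = w} =
         prob {\<omega>\<in>space M. \<forall>s\<le>t. X s \<omega> = x s} * pmf (pmf_of_set (neighbours E (x t))) w"
proof -
  note [measurable] = srw_measurable[OF assms]
  let ?Q = "{\<omega>\<in>space M. \<forall>s\<le>t. X s \<omega> = x s}"
  let ?R = "{\<omega>\<in>space M. (\<forall>s\<le>t. X s \<omega> = x s) \<and> X (Suc t) \<omega> = w}"
  show ?thesis
  proof (cases "prob ?Q > 0")
    case True
    then have "\<P>(\<omega> in M. X (Suc t) \<omega> = w \<bar> \<forall>s\<le>t. X s \<omega> = x s) =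
        pmf (pmf_of_set (neighbours E (x t))) w"
      using assms by (simp add: simple_random_walk_def)
    then show ?thesis using True by (simp add: cond_prob_def field_simps conj_commute)
  next
    case False
    then have "prob ?Q = 0" by (simp add: zero_less_measure_iff)
    moreover have "prob ?R \<le> prob ?Q" by (rule finite_measure_mono) auto
    ultimately show ?thesis by (simp add: measure_le_0_iff)
  qed
qed

text \<open>
  Finite support of \<open>\<phi>\<close> turns the expectation into a finite sum of one-step probabilities, so the
  definition of the walk can be used directly.
\<close>

lemma srw_expectation_history:
  assumes srw: "simple_random_walk comb_adj v M X" and fin: "finite {w. \<phi> w \<noteq> 0}"
  shows "expectation (\<lambda>\<omega>. indicator {\<omega>\<in>space M. \<forall>s\<le>t. X s \<omega> = x s} \<omega> * \<phi> (X (Suc t) \<omega>)) =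
         prob {\<omega>\<in>space M. \<forall>s\<le>t. X s \<omega> = x s} * nbr_mean \<phi> (x t)"
proof -
  note [measurable] = srw_measurable[OF srw]
  let ?F = "{w. \<phi> w \<noteq> 0}"
  let ?R = "\<lambda>w. {\<omega>\<in>space M. (\<forall>s\<le>t. X s \<omega> = x s) \<and> X (Suc t) \<omega> = w}"
  have eq: "indicator {\<omega>\<in>space M. \<forall>s\<le>t. X s \<omega> = x s} \<omega> * \<phi> (X (Suc t) \<omega>) =
      (\<Sum>w\<in>?F. \<phi> w * indicator (?R w) \<omega>)" if "\<omega> \<in> space M" for \<omega>
  proof -
    have "(\<Sum>w\<in>?F. \<phi> w * indicator (?R w) \<omega>) =
      (\<Sum>w\<in>?F. if w = X (Suc t) \<omega> then \<phi> w * indicator {\<omega>\<in>space M. \<forall>s\<le>t. X s \<omega> = x s} \<omega> else 0)"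
      by (rule sum.cong) (auto simp: indicator_def)
    also have "\<dots> = indicator {\<omega>\<in>space M. \<forall>s\<le>t. X s \<omega> = x s} \<omega> * \<phi> (X (Suc t) \<omega>)"
      by (simp add: sum.delta[OF fin])
    finally show ?thesis by simp
  qed
  have "expectation (\<lambda>\<omega>. indicator {\<omega>\<in>space M. \<forall>s\<le>t. X s \<omega> = x s} \<omega> * \<phi> (X (Suc t) \<omega>)) =
      expectation (\<lambda>\<omega>. \<Sum>w\<in>?F. \<phi> w * indicator (?R w) \<omega>)"
    by (rule Bochner_Integration.integral_cong) (use eq in auto)
  also have "\<dots> = (\<Sum>w\<in>?F. \<phi> w * prob (?R w))"
    by (subst Bochner_Integration.integral_sum) (auto intro!: integrable_mult_left integrable_mult_right integrable_indicator)
  also have "\<dots> = prob {\<omega>\<in>space M. \<forall>s\<le>t. X s \<omega> = x s} *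
      (\<Sum>w\<in>?F. \<phi> w * pmf (pmf_of_set (neighbours comb_adj (x t))) w)"
    by (simp add: srw_prob_step[OF srw] sum_distrib_left sum_distrib_right mult_ac)
  also have "(\<Sum>w\<in>?F. \<phi> w * pmf (pmf_of_set (neighbours comb_adj (x t))) w) = nbr_mean \<phi> (x t)"
    unfolding nbr_mean_eq_expectation
    by (subst integral_measure_pmf_real[of ?F]) (use fin in auto)
  finally show ?thesis .
qed

text \<open>
  The Markov property before the exit from \<open>A\<close>. As \<open>A\<close> is finite, the histories that stay inside \<open>A\<close> up to a
  given time are finite in number, and the event splits into them.
\<close>

lemma srw_expectation_inside:
  assumes srw: "simple_random_walk comb_adj v M X" and fin: "finite {w. \<phi> w \<noteq> 0}"
    and A: "finite A"
  shows "expectation (\<lambda>\<omega>. indicator {\<omega>\<in>space M. \<forall>s\<le>t. X s \<omega> \<in> A} \<omega> * \<phi> (X (Suc t) \<omega>)) =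
         expectation (\<lambda>\<omega>. indicator {\<omega>\<in>space M. \<forall>s\<le>t. X s \<omega> \<in> A} \<omega> * nbr_mean \<phi> (X t \<omega>))"
proof -
  note [measurable] = srw_measurable[OF srw]
  let ?P = "PiE {..t} (\<lambda>_. A)"
  let ?h = "\<lambda>x. {\<omega>\<in>space M. \<forall>s\<le>t. X s \<omega> = x s}"
  have P: "finite ?P" using A by (intro finite_PiE) auto
  note bdd = abs_le_sum_support[OF fin]
  have dec: "indicator {\<omega>\<in>space M. \<forall>s\<le>t. X s \<omega> \<in> A} \<omega> * c = (\<Sum>x\<in>?P. indicator (?h x) \<omega> * c)"
    if "\<omega> \<in> space M" for \<omega> and c :: real
  proof (cases "\<forall>s\<le>t. X s \<omega> \<in> A")
    case True
    let ?x = "restrict (\<lambda>s. X s \<omega>) {..t}"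
    have "?x \<in> ?P" using True by auto
    have "(\<Sum>x\<in>?P. indicator (?h x) \<omega> * c) = (\<Sum>x\<in>?P. if x = ?x then c else 0)"
      using that by (intro sum.cong) (auto simp: indicator_def PiE_def extensional_def fun_eq_iff)
    also have "\<dots> = c" using P \<open>?x \<in> ?P\<close> by (subst sum.delta) auto
    finally show ?thesis using True that by simp
  next
    case False
    then have "(\<Sum>x\<in>?P. indicator (?h x) \<omega> * c) = 0"
      by (intro sum.neutral) (auto simp: indicator_def PiE_iff)
    then show ?thesis using False by simp
  qed
  have "expectation (\<lambda>\<omega>. indicator {\<omega>\<in>space M. \<forall>s\<le>t. X s \<omega> \<in> A} \<omega> * \<phi> (X (Suc t) \<omega>)) =
      expectation (\<lambda>\<omega>. \<Sum>x\<in>?P. indicator (?h x) \<omega> * \<phi> (X (Suc t) \<omega>))"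
    by (rule Bochner_Integration.integral_cong) (use dec in auto)
  also have "\<dots> = (\<Sum>x\<in>?P. expectation (\<lambda>\<omega>. indicator (?h x) \<omega> * \<phi> (X (Suc t) \<omega>)))"
    by (subst Bochner_Integration.integral_sum)
       (auto intro!: integrable_const_bound[of _ "\<Sum>w\<in>{w. \<phi> w \<noteq> 0}. \<bar>\<phi> w\<bar>"] bdd sum_nonneg
         simp: indicator_def)
  also have "\<dots> = (\<Sum>x\<in>?P. expectation (\<lambda>\<omega>. indicator (?h x) \<omega> * nbr_mean \<phi> (x t)))"
    by (simp add: srw_expectation_history[OF srw fin])
  also have "\<dots> = expectation (\<lambda>\<omega>. \<Sum>x\<in>?P. indicator (?h x) \<omega> * nbr_mean \<phi> (x t))"
    by (subst Bochner_Integration.integral_sum) (auto intro!: integrable_mult_left integrable_mult_right integrable_indicator)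
  also have "\<dots> = expectation (\<lambda>\<omega>. \<Sum>x\<in>?P. indicator (?h x) \<omega> * nbr_mean \<phi> (X t \<omega>))"
    by (intro Bochner_Integration.integral_cong sum.cong) (auto simp: indicator_def)
  also have "\<dots> = expectation (\<lambda>\<omega>. indicator {\<omega>\<in>space M. \<forall>s\<le>t. X s \<omega> \<in> A} \<omega> * nbr_mean \<phi> (X t \<omega>))"
    by (rule Bochner_Integration.integral_cong) (use dec in auto)
  finally show ?thesis .
qed

end

section \<open>Stopped walks\<close>

text \<open>
  The walk frozen at its first site outside \<open>A\<close>.
\<close>

fun stopped :: "'v set \<Rightarrow> (nat \<Rightarrow> 'v) \<Rightarrow> nat \<Rightarrow> 'v" where
  "stopped A p 0 = p 0"
| "stopped A p (Suc t) = (if stopped A p t \<in> A then p (Suc t) else stopped A p t)"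

lemma stopped_inside: "(\<forall>s\<le>t. p s \<in> A) \<Longrightarrow> stopped A p t = p t"
  by (induction t) auto

lemma stopped_in_iff: "stopped A p t \<in> A \<longleftrightarrow> (\<forall>s\<le>t. p s \<in> A)"
proof (induction t)
  case (Suc t)
  show ?case
  proof (cases "stopped A p t \<in> A")
    case True
    then show ?thesis using Suc by (auto simp: le_Suc_eq)
  next
    case False
    then show ?thesis using Suc by (auto simp: le_Suc_eq)
  qed
qed auto

definition exit_site :: "'v set \<Rightarrow> (nat \<Rightarrow> 'v) \<Rightarrow> 'v" where
  "exit_site A p = p (LEAST t. p t \<notin> A)"

lemma exit_site_first:
  assumes "\<exists>t. p t \<notin> A"
  obtains T where "exit_site A p = p T" "p T \<notin> A" "\<And>s. s < T \<Longrightarrow> p s \<in> A"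
proof -
  show thesis
    by (rule that[of "LEAST t. p t \<notin> A"])
       (use LeastI_ex[OF assms] in \<open>auto simp: exit_site_def dest: not_less_Least\<close>)
qed

lemma stopped_outside:
  assumes "stopped A p t \<notin> A"
  shows "stopped A p t = exit_site A p"
proof -
  have "\<exists>s. p s \<notin> A" using assms by (auto simp: stopped_in_iff)
  then obtain T where T: "exit_site A p = p T" "p T \<notin> A" "\<And>s. s < T \<Longrightarrow> p s \<in> A"
    by (rule exit_site_first) blast
  have "T \<le> t" using assms T(3) unfolding stopped_in_iff by (meson dual_order.trans not_le)
  then show ?thesis
  proof (induction t rule: dec_induct)
    case base
    show ?case
    proof (cases T)
      case 0 then show ?thesis by (simp add: T)
    next
      case (Suc m)
      then have "stopped A p m \<in> A" using T(3) by (auto simp: stopped_in_iff)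
      then show ?thesis by (simp add: T Suc)
    qed
  next
    case (step m)
    then have "stopped A p m \<notin> A" using T by simp
    then show ?case using step by simp
  qed
qed

lemma exit_site_measurable:
  assumes [measurable]: "\<And>t. X t \<in> measurable N (count_space (UNIV :: vertex set))"
  shows "(\<lambda>\<omega>. exit_site A (\<lambda>t. X t \<omega>)) \<in> measurable N (count_space UNIV)"
  unfolding exit_site_def
  by (rule measurable_compose_countable[where f = X, OF assms]) measurable

context prob_space
begin

lemma stopped_measurable [measurable (raw)]:
  assumes [measurable]: "\<And>t. X t \<in> measurable M (count_space (UNIV :: vertex set))"
  shows "(\<lambda>\<omega>. stopped A (\<lambda>t. X t \<omega>) t) \<in> measurable M (count_space UNIV)"
  by (induction t) auto

text \<open>
  One step of the optional stopping argument: the expectation changes only on paths that are still inside \<open>A\<close>,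
  and there by the defect of harmonicity.
\<close>

lemma srw_dynkin:
  assumes srw: "simple_random_walk comb_adj v M X" and fin: "finite {w. \<phi> w \<noteq> 0}"
    and A: "finite A"
  shows "expectation (\<lambda>\<omega>. \<phi> (stopped A (\<lambda>t. X t \<omega>) (Suc t))) =
    expectation (\<lambda>\<omega>. \<phi> (stopped A (\<lambda>t. X t \<omega>) t)) +
    expectation (\<lambda>\<omega>. indicator {\<omega>\<in>space M. \<forall>s\<le>t. X s \<omega> \<in> A} \<omega> * (nbr_mean \<phi> (X t \<omega>) - \<phi> (X t \<omega>)))"
proof -
  note [measurable] = srw_measurable[OF srw]
  let ?S = "\<lambda>t \<omega>. stopped A (\<lambda>t. X t \<omega>) t"
  let ?I = "\<lambda>\<omega>. indicator {\<omega>\<in>space M. \<forall>s\<le>t. X s \<omega> \<in> A} \<omega> :: real"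
  define B where "B = (\<Sum>w\<in>{w. \<phi> w \<noteq> 0}. \<bar>\<phi> w\<bar>)"
  have bdd: "\<bar>\<phi> w\<bar> \<le> B" for w
    unfolding B_def by (rule abs_le_sum_support[OF fin])
  have B0: "0 \<le> B" unfolding B_def by (intro sum_nonneg) auto
  have bdd_mean: "\<bar>nbr_mean \<phi> w\<bar> \<le> B" for w
  proof -
    have "\<bar>nbr_mean \<phi> w\<bar> \<le> (\<Sum>u\<in>neighbours comb_adj w. \<bar>\<phi> u\<bar>) / card (neighbours comb_adj w)"
      unfolding nbr_mean_def by (simp add: abs_divide divide_right_mono)
    also have "\<dots> \<le> (\<Sum>u\<in>neighbours comb_adj w. B) / card (neighbours comb_adj w)"
      by (intro divide_right_mono sum_mono bdd) auto
    also have "\<dots> = B" using neighbours_comb_finite_nonempty[of w] by (simp add: card_eq_0_iff)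
    finally show ?thesis .
  qed
  have i1: "integrable M (\<lambda>\<omega>. \<phi> (?S t \<omega>))"
    by (rule integrable_const_bound[of _ B]) (use bdd in auto)
  have i2: "integrable M (\<lambda>\<omega>. ?I \<omega> * \<phi> (X (Suc t) \<omega>))"
    by (rule integrable_const_bound[of _ B]) (use bdd B0 in \<open>auto simp: indicator_def\<close>)
  have i3: "integrable M (\<lambda>\<omega>. ?I \<omega> * \<phi> (X t \<omega>))"
    by (rule integrable_const_bound[of _ B]) (use bdd B0 in \<open>auto simp: indicator_def\<close>)
  have i4: "integrable M (\<lambda>\<omega>. ?I \<omega> * nbr_mean \<phi> (X t \<omega>))"
    by (rule integrable_const_bound[of _ B]) (use bdd_mean B0 in \<open>auto simp: indicator_def\<close>)
  have "expectation (\<lambda>\<omega>. \<phi> (?S (Suc t) \<omega>)) =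
      expectation (\<lambda>\<omega>. \<phi> (?S t \<omega>) + (?I \<omega> * \<phi> (X (Suc t) \<omega>) - ?I \<omega> * \<phi> (X t \<omega>)))"
  proof (rule Bochner_Integration.integral_cong)
    fix \<omega> assume \<omega>: "\<omega> \<in> space M"
    show "\<phi> (?S (Suc t) \<omega>) = \<phi> (?S t \<omega>) + (?I \<omega> * \<phi> (X (Suc t) \<omega>) - ?I \<omega> * \<phi> (X t \<omega>))"
    proof (cases "\<forall>s\<le>t. X s \<omega> \<in> A")
      case True
      then show ?thesis using \<omega> stopped_inside[of t "\<lambda>t. X t \<omega>" A] by (simp add: stopped_in_iff)
    next
      case False
      then have "?S t \<omega> \<notin> A" by (simp add: stopped_in_iff)
      then show ?thesis using \<omega> False by simp
    qed
  qed simp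
  also have "\<dots> = expectation (\<lambda>\<omega>. \<phi> (?S t \<omega>)) +
      (expectation (\<lambda>\<omega>. ?I \<omega> * \<phi> (X (Suc t) \<omega>)) - expectation (\<lambda>\<omega>. ?I \<omega> * \<phi> (X t \<omega>)))"
    using i1 i2 i3 by simp
  also have "\<dots> = expectation (\<lambda>\<omega>. \<phi> (?S t \<omega>)) +
      (expectation (\<lambda>\<omega>. ?I \<omega> * nbr_mean \<phi> (X t \<omega>)) - expectation (\<lambda>\<omega>. ?I \<omega> * \<phi> (X t \<omega>)))"
    by (simp add: srw_expectation_inside[OF srw fin A])
  also have "\<dots> = expectation (\<lambda>\<omega>. \<phi> (?S t \<omega>)) +
      expectation (\<lambda>\<omega>. ?I \<omega> * (nbr_mean \<phi> (X t \<omega>) - \<phi> (X t \<omega>)))"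
    using i3 i4 by (simp add: right_diff_distrib)
  finally show ?thesis .
qed

lemma srw_expectation_start:
  assumes srw: "simple_random_walk comb_adj v M X"
  shows "expectation (\<lambda>\<omega>. (\<phi> :: vertex \<Rightarrow> real) (X 0 \<omega>)) = \<phi> v"
proof -
  note [measurable] = srw_measurable[OF srw]
  have "expectation (\<lambda>\<omega>. \<phi> (X 0 \<omega>)) = expectation (\<lambda>\<omega>. \<phi> v)"
    using srw by (intro integral_cong_AE) (auto simp: simple_random_walk_def)
  then show ?thesis by (simp add: prob_space)
qed

text \<open>
  On the comb, \<open>x\<^sup>2 + y\<^sup>2\<close> grows by exactly one in every step on average, on the axis as well as off it.
  Until the exit from \<open>A\<close> it is bounded, so the expected time inside \<open>A\<close> is bounded, and the probability of staying
  for \<open>N\<close> steps is \<open>O(1 / N)\<close>.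
\<close>

lemma srw_stay_prob_bound:
  assumes srw: "simple_random_walk comb_adj v M X" and A: "finite A"
  shows "\<exists>C. \<forall>N. real N * prob {\<omega>\<in>space M. \<forall>s\<le>N. X s \<omega> \<in> A} \<le> C"
proof -
  note [measurable] = srw_measurable[OF srw]
  let ?D = "A \<union> (\<Union>a\<in>A. neighbours comb_adj a)"
  \<comment> \<open>Cut off outside the neighbours of \<open>A\<close>, so that the support is finite; averages at sites of \<open>A\<close> do not change.\<close>
  define \<phi> where "\<phi> = (\<lambda>w :: vertex. if w \<in> ?D then (real_of_int (fst w))\<^sup>2 + (real_of_int (snd w))\<^sup>2 else 0)"
  let ?S = "\<lambda>t \<omega>. stopped A (\<lambda>t. X t \<omega>) t"
  let ?E = "\<lambda>t. {\<omega>\<in>space M. \<forall>s\<le>t. X s \<omega> \<in> A}"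
  have D: "finite ?D" using A by (auto simp: neighbours_comb_finite_nonempty)
  have fin: "finite {w. \<phi> w \<noteq> 0}" by (rule finite_subset[OF _ D]) (auto simp: \<phi>_def)
  define B where "B = (\<Sum>w\<in>{w. \<phi> w \<noteq> 0}. \<bar>\<phi> w\<bar>)"
  have bdd: "\<bar>\<phi> w\<bar> \<le> B" for w
    unfolding B_def by (rule abs_le_sum_support[OF fin])
  have pos: "0 \<le> \<phi> w" for w by (simp add: \<phi>_def)
  have mean: "nbr_mean \<phi> w = \<phi> w + 1" if "w \<in> A" for w
  proof -
    obtain x y where w: "w = (x, y)" by (cases w)
    have nb: "\<phi> u = (real_of_int (fst u))\<^sup>2 + (real_of_int (snd u))\<^sup>2" if "u \<in> neighbours comb_adj w" for u
      using that \<open>w \<in> A\<close> by (auto simp: \<phi>_def)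
    have "\<phi> w = (real_of_int x)\<^sup>2 + (real_of_int y)\<^sup>2" using that by (simp add: \<phi>_def w)
    moreover have "nbr_mean \<phi> w = nbr_mean (\<lambda>u. (real_of_int (fst u))\<^sup>2 + (real_of_int (snd u))\<^sup>2) w"
      unfolding nbr_mean_def using nb by simp
    moreover have "\<dots> = (real_of_int x)\<^sup>2 + (real_of_int y)\<^sup>2 + 1"
      by (cases "y = 0") (simp_all add: w nbr_mean_axis nbr_mean_off_axis power2_eq_square algebra_simps)
    ultimately show ?thesis by simp
  qed
  have E: "expectation (\<lambda>\<omega>. \<phi> (?S N \<omega>)) = \<phi> v + (\<Sum>t<N. prob (?E t))" for N
  proof (induction N)
    case 0
    show ?case using srw_expectation_start[OF srw, of \<phi>] by simp
  next
    case (Suc N)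
    have "expectation (\<lambda>\<omega>. indicator (?E N) \<omega> * (nbr_mean \<phi> (X N \<omega>) - \<phi> (X N \<omega>))) =
        expectation (\<lambda>\<omega>. indicator (?E N) \<omega>)"
      by (rule Bochner_Integration.integral_cong) (auto simp: indicator_def mean)
    also have "\<dots> = prob (?E N)" by (simp add: Int_absorb1 subset_eq)
    finally show ?case using Suc by (simp add: srw_dynkin[OF srw fin A] del: stopped.simps)
  qed
  have "real N * prob (?E N) \<le> B" for N
  proof -
    have "real N * prob (?E N) = (\<Sum>t<N. prob (?E N))" by simp
    also have "\<dots> \<le> (\<Sum>t<N. prob (?E t))"
      by (intro sum_mono finite_measure_mono) auto
    also have "\<dots> \<le> expectation (\<lambda>\<omega>. \<phi> (?S N \<omega>))" using E[of N] pos[of v] by simp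
    also have "\<dots> \<le> expectation (\<lambda>\<omega>. B)"
      by (intro integral_mono integrable_const_bound[of _ B]) (auto simp del: split_paired_All intro: bdd abs_le_D1[OF bdd] order_trans[OF abs_ge_zero bdd])
    finally show ?thesis by (simp add: prob_space)
  qed
  then show ?thesis by blast
qed

lemma srw_stay_prob_tendsto:
  assumes srw: "simple_random_walk comb_adj v M X" and A: "finite A"
  shows "(\<lambda>N. prob {\<omega>\<in>space M. \<forall>s\<le>N. X s \<omega> \<in> A}) \<longlonglongrightarrow> 0"
proof -
  obtain C where C: "\<And>N. real N * prob {\<omega>\<in>space M. \<forall>s\<le>N. X s \<omega> \<in> A} \<le> C"
    using srw_stay_prob_bound[OF assms] by blast
  show ?thesis
  proof (rule tendsto_sandwich[of "\<lambda>_. 0" _ _ "\<lambda>N. C / real N"])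
    show "\<forall>\<^sub>F N in sequentially. prob {\<omega> \<in> space M. \<forall>s\<le>N. X s \<omega> \<in> A} \<le> C / real N"
      using eventually_gt_at_top[of 0] by eventually_elim (use C in \<open>simp add: field_simps\<close>)
    show "(\<lambda>N. C / real N) \<longlonglongrightarrow> 0" by (rule lim_const_over_n)
  qed auto
qed

lemma srw_exits:
  assumes srw: "simple_random_walk comb_adj v M X" and A: "finite A"
  shows "AE \<omega> in M. \<exists>t. X t \<omega> \<notin> A"
proof -
  note [measurable] = srw_measurable[OF srw]
  have "prob {\<omega>\<in>space M. \<forall>t. X t \<omega> \<in> A} \<le> prob {\<omega>\<in>space M. \<forall>s\<le>N. X s \<omega> \<in> A}" for N
    by (rule finite_measure_mono) auto
  then have "prob {\<omega>\<in>space M. \<forall>t. X t \<omega> \<in> A} \<le> 0"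
    by (intro LIMSEQ_le_const[OF srw_stay_prob_tendsto[OF assms]]) auto
  then have "prob {\<omega>\<in>space M. \<forall>t. X t \<omega> \<in> A} = 0" by (simp add: measure_le_0_iff)
  then show ?thesis
    by (subst (asm) prob_eq_0) (auto elim!: eventually_mono)
qed

text \<open>
  Optional stopping. Paths that have not left \<open>A\<close> by time \<open>N\<close> contribute at most their
  probability, which vanishes in the limit.
\<close>

lemma srw_subharmonic_exit:
  assumes srw: "simple_random_walk comb_adj v M X" and A: "finite A"
    and fin: "finite {w. h w \<noteq> 0}" and h01: "\<And>w. 0 \<le> h w" "\<And>w. h w \<le> 1"
    and sub: "\<And>w. w \<in> A \<Longrightarrow> h w \<le> nbr_mean h w"
  shows "h v \<le> expectation (\<lambda>\<omega>. h (exit_site A (\<lambda>t. X t \<omega>)))"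
proof -
  note [measurable] = srw_measurable[OF srw]
  note [measurable] = exit_site_measurable[of X M A, OF srw_measurable[OF srw]]
  let ?S = "\<lambda>t \<omega>. stopped A (\<lambda>t. X t \<omega>) t"
  let ?E = "\<lambda>t. {\<omega>\<in>space M. \<forall>s\<le>t. X s \<omega> \<in> A}"
  let ?Y = "\<lambda>\<omega>. exit_site A (\<lambda>t. X t \<omega>)"
  have hb: "\<bar>h w\<bar> \<le> 1" for w using h01[of w] by simp
  have mono: "h v \<le> expectation (\<lambda>\<omega>. h (?S N \<omega>))" for N
  proof (induction N)
    case 0
    show ?case using srw_expectation_start[OF srw, of h] by simp
  next
    case (Suc N)
    have "0 \<le> expectation (\<lambda>\<omega>. indicator (?E N) \<omega> * (nbr_mean h (X N \<omega>) - h (X N \<omega>)))"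
      by (rule integral_nonneg_AE) (auto simp: indicator_def sub)
    then show ?case using Suc by (simp add: srw_dynkin[OF srw fin A] del: stopped.simps)
  qed
  have iY: "integrable M (\<lambda>\<omega>. h (?Y \<omega>))" by (rule integrable_const_bound[of _ 1]) (use hb in auto)
  have "h v \<le> expectation (\<lambda>\<omega>. h (?Y \<omega>)) + prob (?E N)" for N
  proof -
    have "expectation (\<lambda>\<omega>. h (?S N \<omega>)) \<le> expectation (\<lambda>\<omega>. h (?Y \<omega>) + indicator (?E N) \<omega>)"
    proof (rule integral_mono)
      show "integrable M (\<lambda>\<omega>. h (?S N \<omega>))" by (rule integrable_const_bound[of _ 1]) (use hb in auto)
      show "integrable M (\<lambda>\<omega>. h (?Y \<omega>) + indicator (?E N) \<omega>)"
        using iY by (intro Bochner_Integration.integrable_add integrable_indicator) auto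
      fix \<omega> assume "\<omega> \<in> space M"
      then show "h (?S N \<omega>) \<le> h (?Y \<omega>) + indicator (?E N) \<omega>"
        using stopped_outside[of A "\<lambda>t. X t \<omega>" N] h01[of "?S N \<omega>"] h01[of "?Y \<omega>"]
        by (cases "?S N \<omega> \<in> A") (auto simp: stopped_in_iff indicator_def)
    qed
    also have "\<dots> = expectation (\<lambda>\<omega>. h (?Y \<omega>)) + prob (?E N)"
      using iY by (subst Bochner_Integration.integral_add) (auto intro!: integrable_indicator simp: Int_absorb1 subset_eq)
    finally show ?thesis using mono[of N] by simp
  qed
  then have "h v \<le> expectation (\<lambda>\<omega>. h (?Y \<omega>)) + 0"
    by (intro LIMSEQ_le_const[OF tendsto_add[OF tendsto_const srw_stay_prob_tendsto[OF srw A]]]) auto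
  then show ?thesis by simp
qed

end

section \<open>The probability that a site stays vacant\<close>

text \<open>
  The same growth rule as in the definition of the cluster, free of extended natural numbers.
\<close>

definition cluster_step :: "vertex set \<Rightarrow> (nat \<Rightarrow> vertex) \<Rightarrow> vertex set" where
  "cluster_step A p = (if \<exists>t. p t \<notin> A then insert (exit_site A p) A else A)"

lemma exit_time_first:
  assumes "p T \<notin> A" "\<And>s. s < T \<Longrightarrow> p s \<in> A"
  shows "exit_time p A = enat T"
  unfolding exit_time_def
proof (rule Inf_eqI)
  fix u assume "u \<in> enat ` {t. p t \<notin> A}"
  then show "enat T \<le> u" using assms(2) by (auto intro: leI)
qed (use assms(1) in auto)

lemma cluster_step_eq:
  "cluster_step A p = A \<union> {p t | t. exit_time p A = enat t}"
proof (cases "\<exists>t. p t \<notin> A")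
  case True
  then obtain T where T: "exit_site A p = p T" "p T \<notin> A" "\<And>s. s < T \<Longrightarrow> p s \<in> A"
    by (rule exit_site_first) blast
  have "exit_time p A = enat T" by (rule exit_time_first) (use T in auto)
  then have "{p t | t. exit_time p A = enat t} = {p T}" by auto
  then show ?thesis using True T by (simp add: cluster_step_def)
next
  case False
  then show ?thesis by (auto simp: cluster_step_def exit_time_def top_enat_def)
qed

lemma idla_cluster_Suc_Suc:
  "idla_cluster p (Suc (Suc n)) = cluster_step (idla_cluster p (Suc n)) (p (Suc (Suc n)))"
  by (simp add: cluster_step_eq)

lemma idla_cluster_finite: "finite (idla_cluster p n)"
  by (induction p n rule: idla_cluster.induct)
     (simp_all add: idla_cluster_Suc_Suc cluster_step_def del: idla_cluster.simps(3))

lemma idla_cluster_cong: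
  "(\<And>i. i \<in> {1..n} \<Longrightarrow> p i = p' i) \<Longrightarrow> idla_cluster p n = idla_cluster p' n"
  by (induction p n rule: idla_cluster.induct) auto

abbreviation path_space :: "(nat \<Rightarrow> vertex) measure" where
  "path_space \<equiv> Pi\<^sub>M UNIV (\<lambda>_. count_space UNIV)"

lemma cluster_step_measurable:
  assumes "finite A"
  shows "cluster_step A \<in> measurable path_space (count_space {A. finite A})"
proof -
  have [measurable]: "(\<lambda>p. p t) \<in> measurable path_space (count_space UNIV)" for t
    by (rule measurable_component_singleton) simp
  note [measurable] = exit_site_measurable[of "\<lambda>t p. p t" path_space A, simplified]
  have "(\<lambda>p. if \<exists>t. p t \<notin> A then insert (exit_site A p) A else A)
      \<in> measurable path_space (count_space {A. finite A})"
  proof (rule measurable_If)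
    show "(\<lambda>p. insert (exit_site A p) A) \<in> measurable path_space (count_space {A. finite A})"
      by (rule measurable_compose[of "exit_site A" _ "count_space UNIV"])
         (use assms in \<open>auto simp: measurable_count_space_eq1 exit_site_measurable\<close>)
  qed (use assms in auto)
  then show ?thesis by (simp add: cluster_step_def[abs_def])
qed

lemma countable_finite_sets: "countable {A :: vertex set. finite A}"
  by (rule countable_Collect_finite)

lemma idla_cluster_measurable:
  assumes "\<And>i. i \<in> {1..n} \<Longrightarrow> P i \<in> measurable N path_space"
  shows "(\<lambda>\<omega>. idla_cluster (\<lambda>i. P i \<omega>) n) \<in> measurable N (count_space {A. finite A})"
  using assms
proof (induction n rule: nat_induct)
  case (Suc n)
  show ?case
  proof (cases n)
    case (Suc m)
    have "(\<lambda>\<omega>. cluster_step (idla_cluster (\<lambda>i. P i \<omega>) n) (P (Suc n) \<omega>))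
        \<in> measurable N (count_space {A. finite A})"
    proof (rule measurable_compose_countable'[where f = "\<lambda>A \<omega>. cluster_step A (P (Suc n) \<omega>)"])
      fix A :: "vertex set" assume "A \<in> {A. finite A}"
      then show "(\<lambda>\<omega>. cluster_step A (P (Suc n) \<omega>)) \<in> measurable N (count_space {A. finite A})"
        using Suc.prems by (intro measurable_compose[OF _ cluster_step_measurable]) auto
    qed (use Suc.IH Suc.prems countable_finite_sets in auto)
    then show ?thesis by (simp add: Suc idla_cluster_Suc_Suc del: idla_cluster.simps(3))
  qed simp
qed simp

text \<open>
  The exponential weight of a cluster, set to zero once the site \<open>z\<close> is occupied. With this
  cut-off the next lemma needs subharmonicity only away from \<open>z\<close>.
\<close>

definition avoid_weight :: "(vertex \<Rightarrow> real) \<Rightarrow> vertex \<Rightarrow> real \<Rightarrow> vertex set \<Rightarrow> real" where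
  "avoid_weight h z \<theta> A = (if z \<in> A then 0 else exp (- \<theta> * sum h A))"

text \<open>
  Convexity: on the unit interval the exponential lies below its chord.
\<close>

lemma exp_chord:
  fixes t \<theta> :: real
  assumes "0 \<le> t" "t \<le> 1"
  shows "exp (- \<theta> * t) \<le> 1 - (1 - exp (- \<theta>)) * t"
proof -
  have "exp ((1 - t) *\<^sub>R 0 + t *\<^sub>R (- \<theta>)) \<le> (1 - t) * exp 0 + t * exp (- \<theta>)"
    by (rule convex_onD[OF exp_convex]) (use assms in auto)
  then show ?thesis by (simp add: algebra_simps)
qed

context prob_space
begin

text \<open>
  Conditionally on the current cluster, one particle reduces the weight by a constant factor. The chord
  bound replaces the exponential of \<open>h\<close> at the exit site by an affine function of \<open>h\<close>, whose expectation optional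
  stopping controls.
\<close>

lemma avoid_weight_step:
  assumes srw: "simple_random_walk comb_adj v M X" and A: "finite A" and "\<theta> \<ge> 0"
    and fin: "finite {w :: vertex. h w \<noteq> 0}" and h01: "\<And>w. 0 \<le> h w" "\<And>w. h w \<le> 1"
    and sub: "\<And>w. w \<noteq> z \<Longrightarrow> h w \<le> nbr_mean h w"
  shows "(\<integral>\<^sup>+\<omega>. ennreal (avoid_weight h z \<theta> (cluster_step A (\<lambda>t. X t \<omega>))) \<partial>M)
    \<le> ennreal (avoid_weight h z \<theta> A) * ennreal (1 - (1 - exp (- \<theta>)) * h v)"
proof (cases "z \<in> A")
  case True
  then have "z \<in> cluster_step A (\<lambda>t. X t \<omega>)" for \<omega> by (simp add: cluster_step_def)
  then show ?thesis by (simp add: avoid_weight_def)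
next
  case False
  note [measurable] = srw_measurable[OF srw]
  note [measurable] = exit_site_measurable[of X M A, OF srw_measurable[OF srw]]
  let ?Y = "\<lambda>\<omega>. exit_site A (\<lambda>t. X t \<omega>)"
  let ?c = "1 - exp (- \<theta>)"
  let ?w = "avoid_weight h z \<theta> A"
  have c: "0 \<le> ?c" "?c \<le> 1" using \<open>\<theta> \<ge> 0\<close> by auto
  have w: "0 \<le> ?w" by (simp add: avoid_weight_def)
  have iY: "integrable M (\<lambda>\<omega>. h (?Y \<omega>))"
    by (rule integrable_const_bound[of _ 1]) (use h01 in auto)
  have "(\<integral>\<^sup>+\<omega>. ennreal (avoid_weight h z \<theta> (cluster_step A (\<lambda>t. X t \<omega>))) \<partial>M)
      \<le> (\<integral>\<^sup>+\<omega>. ennreal (?w * (1 - ?c * h (?Y \<omega>))) \<partial>M)"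
  proof (rule nn_integral_mono_AE)
    show "AE \<omega> in M. ennreal (avoid_weight h z \<theta> (cluster_step A (\<lambda>t. X t \<omega>)))
        \<le> ennreal (?w * (1 - ?c * h (?Y \<omega>)))"
      using srw_exits[OF srw A]
    proof eventually_elim
      case (elim \<omega>)
      then have Y: "?Y \<omega> \<notin> A" by (metis exit_site_first)
      have "avoid_weight h z \<theta> (cluster_step A (\<lambda>t. X t \<omega>)) \<le> ?w * exp (- \<theta> * h (?Y \<omega>))"
        using elim False Y A
        by (auto simp: avoid_weight_def cluster_step_def algebra_simps simp flip: exp_add)
      also have "\<dots> \<le> ?w * (1 - ?c * h (?Y \<omega>))"
        by (intro mult_left_mono exp_chord h01 w)
      finally show ?case by (rule ennreal_leI)
    qed
  qed
  also have "\<dots> = ennreal (expectation (\<lambda>\<omega>. ?w * (1 - ?c * h (?Y \<omega>))))"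
  proof (rule nn_integral_eq_integral)
    show "integrable M (\<lambda>\<omega>. ?w * (1 - ?c * h (?Y \<omega>)))" using iY by auto
    have "?c * h u \<le> 1 * 1" for u by (rule mult_mono) (use c h01 in auto)
    then show "AE \<omega> in M. 0 \<le> ?w * (1 - ?c * h (?Y \<omega>))" using w by auto
  qed
  also have "expectation (\<lambda>\<omega>. ?w * (1 - ?c * h (?Y \<omega>))) = ?w * (1 - ?c * expectation (\<lambda>\<omega>. h (?Y \<omega>)))"
    using iY by (simp add: prob_space)
  also have "\<dots> \<le> ?w * (1 - ?c * h v)"
  proof -
    have "h w \<le> nbr_mean h w" if "w \<in> A" for w using sub[of w] that False by blast
    then have "h v \<le> expectation (\<lambda>\<omega>. h (?Y \<omega>))"
      by (intro srw_subharmonic_exit[OF srw A fin h01])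
    then show ?thesis using c w by (intro mult_left_mono diff_mono) auto
  qed
  finally show ?thesis using w by (simp add: ennreal_mult' ennreal_leI)
qed

text \<open>
  The cluster of the first particles is independent of the path of the next one, so the conditional bound
  can be integrated with Fubini. The two families of paths are glued to a single one in order
  that the measurability of the next cluster follows from that of clusters in general.
\<close>

lemma avoid_weight_decay:
  assumes walks: "\<And>i. i \<ge> 1 \<Longrightarrow> simple_random_walk comb_adj origin M (X i)"
    and indep: "independent_walks M {1..} X" and "\<theta> \<ge> 0"
    and fin: "finite {w :: vertex. h w \<noteq> 0}" and h01: "\<And>w. 0 \<le> h w" "\<And>w. h w \<le> 1"
    and sub: "\<And>w. w \<noteq> z \<Longrightarrow> h w \<le> nbr_mean h w"
  shows "(\<integral>\<^sup>+\<omega>. ennreal (avoid_weight h z \<theta> (idla_cluster (\<lambda>i t. X i t \<omega>) (Suc n))) \<partial>M)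
    \<le> ennreal (1 - (1 - exp (- \<theta>)) * h origin) ^ n"
proof (induction n)
  case 0
  have "(\<integral>\<^sup>+\<omega>. ennreal (avoid_weight h z \<theta> {origin}) \<partial>M) \<le> (\<integral>\<^sup>+\<omega>. 1 \<partial>M)"
    using h01(1)[of origin] \<open>\<theta> \<ge> 0\<close> by (intro nn_integral_mono) (auto simp: avoid_weight_def)
  then show ?case by (simp add: emeasure_space_1)
next
  case (Suc n)
  let ?PS = "path_space"
  let ?q = "ennreal (1 - (1 - exp (- \<theta>)) * h origin)"
  let ?W = "\<lambda>A. ennreal (avoid_weight h z \<theta> A)"
  let ?C = "\<lambda>\<omega>. idla_cluster (\<lambda>i t. X i t \<omega>) (Suc n)"
  let ?Y = "\<lambda>\<omega> t. X (Suc (Suc n)) t \<omega>"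
  have iv: "indep_vars (\<lambda>_. ?PS) (\<lambda>i \<omega> t. X i t \<omega>) {1..}"
    using indep by (simp add: independent_walks_def)
  let ?P1 = "PiM {1..Suc n} (\<lambda>_. ?PS)" and ?P2 = "PiM {Suc (Suc n)} (\<lambda>_. ?PS)"
  let ?R1 = "\<lambda>\<omega>. restrict (\<lambda>i t. X i t \<omega>) {1..Suc n}"
    and ?R2 = "\<lambda>\<omega>. restrict (\<lambda>i t. X i t \<omega>) {Suc (Suc n)}"
  \<comment> \<open>One family of paths that takes the last path from the second component and all others from the first.\<close>
  let ?glue = "\<lambda>x i. if i = Suc (Suc n) then snd x i else fst x i"
  let ?f = "\<lambda>x. ?W (idla_cluster (?glue x) (Suc (Suc n)))"
  have "indep_var ?P1 ?R1 ?P2 ?R2"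
    by (rule indep_var_restrict[OF iv]) auto
  then have R1: "?R1 \<in> measurable M ?P1" and R2: "?R2 \<in> measurable M ?P2"
    and eq: "distr M ?P1 ?R1 \<Otimes>\<^sub>M distr M ?P2 ?R2 = distr M (?P1 \<Otimes>\<^sub>M ?P2) (\<lambda>\<omega>. (?R1 \<omega>, ?R2 \<omega>))"
    by (simp_all add: indep_var_distribution_eq)
  interpret R2: prob_space "distr M ?P2 ?R2" by (rule prob_space_distr[OF R2])
  have coord: "(\<lambda>x. ?glue x i) \<in> measurable (?P1 \<Otimes>\<^sub>M ?P2) ?PS" if "i \<in> {1..Suc (Suc n)}" for i
  proof (cases "i = Suc (Suc n)")
    case True
    have "(\<lambda>x. snd x i) \<in> measurable (?P1 \<Otimes>\<^sub>M ?P2) ?PS"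
      by (rule measurable_compose[OF measurable_snd measurable_component_singleton]) (use True in auto)
    then show ?thesis using True by simp
  next
    case False
    have "(\<lambda>x. fst x i) \<in> measurable (?P1 \<Otimes>\<^sub>M ?P2) ?PS"
      by (rule measurable_compose[OF measurable_fst measurable_component_singleton]) (use False that in auto)
    then show ?thesis using False by simp
  qed
  have meas: "?f \<in> borel_measurable (?P1 \<Otimes>\<^sub>M ?P2)"
    by (rule measurable_compose[OF idla_cluster_measurable[where P = "\<lambda>i x. ?glue x i"]])
       (use coord in auto)
  have glue: "idla_cluster (?glue (?R1 \<omega>, ?R2 \<omega>')) (Suc (Suc n)) = cluster_step (?C \<omega>) (?Y \<omega>')" for \<omega> \<omega>'
  proof -
    have "idla_cluster (?glue (?R1 \<omega>, ?R2 \<omega>')) (Suc n) = ?C \<omega>"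
      by (rule idla_cluster_cong) auto
    then show ?thesis by (simp add: idla_cluster_Suc_Suc del: idla_cluster.simps(3))
  qed
  have C: "?C \<in> measurable M (count_space {A. finite A})"
    using idla_cluster_measurable[of "Suc n" "\<lambda>i \<omega> t. X i t \<omega>" M] iv
    by (auto simp: indep_vars_def)
  have "(\<integral>\<^sup>+\<omega>. ?W (idla_cluster (\<lambda>i t. X i t \<omega>) (Suc (Suc n))) \<partial>M) =
      (\<integral>\<^sup>+\<omega>. ?f (?R1 \<omega>, ?R2 \<omega>) \<partial>M)"
    by (simp only: glue) (simp only: idla_cluster_Suc_Suc)
  also have "\<dots> = (\<integral>\<^sup>+x. ?f x \<partial>(distr M ?P1 ?R1 \<Otimes>\<^sub>M distr M ?P2 ?R2))"
    unfolding eq by (rule nn_integral_distr[symmetric]) (use R1 R2 meas in auto)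
  also have "\<dots> = (\<integral>\<^sup>+p. \<integral>\<^sup>+p'. ?f (p, p') \<partial>distr M ?P2 ?R2 \<partial>distr M ?P1 ?R1)"
    by (rule R2.nn_integral_fst[symmetric]) (use meas in \<open>simp cong: measurable_cong_sets\<close>)
  also have "\<dots> = (\<integral>\<^sup>+\<omega>. \<integral>\<^sup>+p'. ?f (?R1 \<omega>, p') \<partial>distr M ?P2 ?R2 \<partial>M)"
    by (rule nn_integral_distr[OF R1]) (rule R2.borel_measurable_nn_integral_fst, use meas in \<open>simp cong: measurable_cong_sets\<close>)
  also have "\<dots> = (\<integral>\<^sup>+\<omega>. \<integral>\<^sup>+\<omega>'. ?f (?R1 \<omega>, ?R2 \<omega>') \<partial>M \<partial>M)"
  proof (rule nn_integral_cong)
    fix \<omega> assume "\<omega> \<in> space M"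
    then have "(\<lambda>p'. ?f (?R1 \<omega>, p')) \<in> borel_measurable ?P2"
      using measurable_Pair2[OF meas measurable_space[OF R1]] by blast
    then show "(\<integral>\<^sup>+p'. ?f (?R1 \<omega>, p') \<partial>distr M ?P2 ?R2) = (\<integral>\<^sup>+\<omega>'. ?f (?R1 \<omega>, ?R2 \<omega>') \<partial>M)"
      by (intro nn_integral_distr[OF R2]) (simp_all cong: measurable_cong_sets)
  qed
  also have "\<dots> = (\<integral>\<^sup>+\<omega>. \<integral>\<^sup>+\<omega>'. ?W (cluster_step (?C \<omega>) (?Y \<omega>')) \<partial>M \<partial>M)"
    by (simp only: glue)
  also have "\<dots> \<le> (\<integral>\<^sup>+\<omega>. ?W (?C \<omega>) * ?q \<partial>M)"
    by (intro nn_integral_mono avoid_weight_step[OF walks _ \<open>\<theta> \<ge> 0\<close> fin h01 sub] idla_cluster_finite) auto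
  also have "\<dots> = (\<integral>\<^sup>+\<omega>. ?W (?C \<omega>) \<partial>M) * ?q"
    by (rule nn_integral_multc) (rule measurable_compose[OF C], simp)
  also have "\<dots> \<le> ?q ^ n * ?q" by (intro mult_right_mono Suc.IH) simp
  finally show ?case by (simp only: power_Suc2)
qed

lemma site_missing_event:
  assumes walks: "\<And>i. i \<ge> 1 \<Longrightarrow> simple_random_walk comb_adj origin M (X i)"
  shows "{\<omega>\<in>space M. z \<notin> idla_cluster (\<lambda>i t. X i t \<omega>) n} \<in> events"
proof -
  let ?C = "\<lambda>\<omega>. idla_cluster (\<lambda>i t. X i t \<omega>) n"
  have "(\<lambda>\<omega> t. X i t \<omega>) \<in> measurable M path_space" if "i \<in> {1..n}" for i
    using that by (intro measurable_PiM_single') (auto simp: srw_measurable[OF walks])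
  then have "(\<lambda>\<omega>. idla_cluster (\<lambda>i. (\<lambda>i \<omega> t. X i t \<omega>) i \<omega>) n) \<in> measurable M (count_space {A. finite A})"
    by (intro idla_cluster_measurable) auto
  then have C: "?C \<in> measurable M (count_space {A. finite A})" by simp
  have "?C -` {A. finite A \<and> z \<notin> A} \<inter> space M \<in> events"
    using measurable_sets[OF C, of "{A. finite A \<and> z \<notin> A}"] by auto
  moreover have "?C -` {A. finite A \<and> z \<notin> A} \<inter> space M = {\<omega>\<in>space M. z \<notin> ?C \<omega>}"
    by (auto simp: idla_cluster_finite)
  ultimately show ?thesis by simp
qed

text \<open>
  On the event that \<open>z\<close> is vacant the weight is at least \<open>exp (- \<theta> * S)\<close>, so Markov's inequality applies. The first
  particle settles at the origin without a walk, which accounts for \<open>n - 1\<close>.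
\<close>

lemma prob_site_avoided:
  assumes walks: "\<And>i. i \<ge> 1 \<Longrightarrow> simple_random_walk comb_adj origin M (X i)"
    and indep: "independent_walks M {1..} X" and "\<theta> \<ge> 0" and "n \<ge> 1"
    and pot: "pole_potential z 1 S h"
  shows "prob {\<omega>\<in>space M. z \<notin> idla_cluster (\<lambda>i t. X i t \<omega>) n}
      \<le> exp (\<theta> * S - (1 - exp (- \<theta>)) * h origin * (real n - 1))"
proof -
  note fin = pole_potentialD(1)[OF pot] and h01 = pole_potentialD(2,3)[OF pot]
    and sub = pole_potentialD(4)[OF pot] and S = pole_potentialD(5)[OF pot]
  let ?C = "\<lambda>\<omega>. idla_cluster (\<lambda>i t. X i t \<omega>) n"
  let ?B = "{\<omega>\<in>space M. z \<notin> ?C \<omega>}"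
  let ?c = "1 - exp (- \<theta>)"
  have B: "?B \<in> events" by (rule site_missing_event[OF walks])
  have c: "0 \<le> ?c" "?c \<le> 1" using \<open>\<theta> \<ge> 0\<close> by auto
  have "?c * h origin \<le> 1 * 1" by (rule mult_mono) (use c h01 in auto)
  then have q: "0 \<le> 1 - ?c * h origin" by simp
  have "ennreal (exp (- \<theta> * S)) * emeasure M ?B = (\<integral>\<^sup>+\<omega>. ennreal (exp (- \<theta> * S)) * indicator ?B \<omega> \<partial>M)"
    using B by (simp add: nn_integral_cmult_indicator)
  also have "\<dots> \<le> (\<integral>\<^sup>+\<omega>. ennreal (avoid_weight h z \<theta> (?C \<omega>)) \<partial>M)"
  proof (rule nn_integral_mono)
    fix \<omega> assume "\<omega> \<in> space M"
    show "ennreal (exp (- \<theta> * S)) * indicator ?B \<omega> \<le> ennreal (avoid_weight h z \<theta> (?C \<omega>))"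
    proof (cases "z \<in> ?C \<omega>")
      case False
      then have "\<theta> * sum h (?C \<omega>) \<le> \<theta> * S"
        using S[OF idla_cluster_finite] \<open>\<theta> \<ge> 0\<close> by (intro mult_left_mono) auto
      then show ?thesis using False by (auto simp: avoid_weight_def indicator_def intro!: ennreal_leI)
    qed auto
  qed
  also have "\<dots> \<le> ennreal (1 - ?c * h origin) ^ (n - 1)"
    using avoid_weight_decay[OF walks indep \<open>\<theta> \<ge> 0\<close> fin h01 sub, where n = "n - 1"] \<open>n \<ge> 1\<close> by simp
  also have "\<dots> = ennreal ((1 - ?c * h origin) ^ (n - 1))" using q by (simp add: ennreal_power)
  finally have "exp (- \<theta> * S) * prob ?B \<le> (1 - ?c * h origin) ^ (n - 1)"
    using q by (simp add: emeasure_eq_measure flip: ennreal_mult')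
  also have "\<dots> \<le> exp (- (?c * h origin)) ^ (n - 1)"
    using q exp_ge_add_one_self[of "- (?c * h origin)"] by (intro power_mono) auto
  also have "\<dots> = exp (- (?c * h origin * (real n - 1)))"
    using \<open>n \<ge> 1\<close> by (simp add: of_nat_diff mult_ac flip: exp_of_nat_mult)
  finally have "exp (\<theta> * S) * (exp (- \<theta> * S) * prob ?B) \<le> exp (\<theta> * S) * exp (- (?c * h origin * (real n - 1)))"
    by (intro mult_left_mono) auto
  then show "prob ?B \<le> exp (\<theta> * S - ?c * h origin * (real n - 1))"
    by (simp add: mult.assoc[symmetric] flip: exp_add)
qed

end

section \<open>Potentials that are linear along teeth\<close>

text \<open>
  The shape along a tooth of height \<open>H\<close> of a function that is one at the root and vanishes at both ends.
\<close>

definition tent :: "nat \<Rightarrow> int \<Rightarrow> real" where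
  "tent H y = max 0 (1 - \<bar>real_of_int y\<bar> / real H)"

lemma tent_nonneg: "0 \<le> tent H y"
  by (simp add: tent_def)

lemma tent_le_1: "tent H y \<le> 1"
  by (simp add: tent_def)

lemma tent_0 [simp]: "tent H 0 = 1"
  by (simp add: tent_def)

lemma tent_convex:
  assumes "y \<noteq> 0" shows "2 * tent H y \<le> tent H (y + 1) + tent H (y - 1)"
proof -
  have "\<bar>real_of_int (y + 1)\<bar> + \<bar>real_of_int (y - 1)\<bar> = 2 * \<bar>real_of_int y\<bar>"
    using assms by (cases "y > 0") auto
  then have "\<bar>real_of_int (y + 1)\<bar> / H + \<bar>real_of_int (y - 1)\<bar> / H = 2 * (\<bar>real_of_int y\<bar> / H)"
    by (metis add_divide_distrib times_divide_eq_right)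
  then show ?thesis unfolding tent_def max_def by (simp split: if_split)
qed

lemma sum_distance_to_height:
  "(\<Sum>y\<in>{- int H..int H}. real H - \<bar>real_of_int y\<bar>) = (real H)\<^sup>2"
proof (induction H)
  case (Suc H)
  have eq: "{- int (Suc H)..int (Suc H)} = insert (- int (Suc H)) (insert (int (Suc H)) {- int H..int H})"
    by auto
  have "(\<Sum>y\<in>{- int (Suc H)..int (Suc H)}. real (Suc H) - \<bar>real_of_int y\<bar>) =
      (\<Sum>y\<in>{- int H..int H}. (real H - \<bar>real_of_int y\<bar>) + 1)"
    unfolding eq by (subst sum.insert; simp add: algebra_simps)+
  also have "\<dots> = (real H)\<^sup>2 + (2 * real H + 1)"
    by (simp add: sum.distrib Suc)
  finally show ?case by (simp add: power2_eq_square algebra_simps)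
qed simp

text \<open>
  The sum over the whole tooth, both arms and the root, is exactly \<open>H\<close>; this is why heights are taken to be integers.
\<close>

lemma sum_tent_le:
  assumes "H \<ge> 1" "finite Y" shows "(\<Sum>y\<in>Y. tent H y) \<le> real H"
proof -
  have "(\<Sum>y\<in>Y. tent H y) \<le> (\<Sum>y\<in>Y \<union> {- int H..int H}. tent H y)"
    using assms by (intro sum_mono2) (auto simp: tent_nonneg)
  also have "\<dots> = (\<Sum>y\<in>{- int H..int H}. tent H y)"
    using assms by (intro sum.mono_neutral_right) (auto simp: tent_def field_simps abs_if split: if_splits)
  also have "\<dots> = (\<Sum>y\<in>{- int H..int H}. (real H - \<bar>real_of_int y\<bar>) / real H)"
    using assms by (intro sum.cong) (auto simp: tent_def field_simps abs_if split: if_splits)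
  also have "\<dots> = real H"
    using assms by (simp add: sum_distance_to_height power2_eq_square flip: sum_divide_distrib)
  finally show ?thesis .
qed

text \<open>
  The extension of a profile \<open>g\<close> on the axis to the comb, with a pole at height \<open>b\<close> on the upper arm
  of the tooth \<open>a\<close>. On that arm the function climbs with slope \<open>s\<close> up to the pole. It vanishes beyond the pole:
  a jump down to zero does no harm to subharmonicity of a nonnegative function except at the pole itself.
\<close>

definition pole_profile :: "(int \<Rightarrow> real) \<Rightarrow> (int \<Rightarrow> nat) \<Rightarrow> int \<Rightarrow> nat \<Rightarrow> real \<Rightarrow> vertex \<Rightarrow> real" where
  "pole_profile g H a b s w = (case w of (x, y) \<Rightarrow>
     if x = a \<and> 0 < y then (if y \<le> int b then g a + s * real_of_int y else 0)
     else g x * tent (H x) y)"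

text \<open>
  On the axis, the two arms of a tooth of height \<open>H x\<close> cost \<open>2 * g x / H x\<close>, which the second difference of \<open>g\<close> must
  pay for. At the root of the distinguished tooth one arm costs \<open>g a / H a\<close> and the other one pays \<open>s\<close>.
\<close>

lemma pole_profile_subharmonic:
  assumes g: "\<And>x. 0 \<le> g x" and s: "0 \<le> s" and H: "\<And>x. 1 \<le> H x" and b: "1 \<le> b"
    and axis: "\<And>x. x \<noteq> a \<Longrightarrow> 2 * g x + 2 * g x / real (H x) \<le> g (x + 1) + g (x - 1)"
    and root: "2 * g a + g a / real (H a) \<le> g (a + 1) + g (a - 1) + s"
    and w: "w \<noteq> (a, int b)"
  shows "pole_profile g H a b s w \<le> nbr_mean (pole_profile g H a b s) w"
proof -
  let ?h = "pole_profile g H a b s"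
  obtain x y where xy: "w = (x, y)" by (cases w)
  have one: "g x - g x / real (H x) \<le> g x * tent (H x) i" if "i = 1 \<or> i = - 1" for i
  proof -
    have "g x * (1 - 1 / real (H x)) \<le> g x * tent (H x) i"
      using that g[of x] by (intro mult_left_mono) (auto simp: tent_def)
    then show ?thesis by (simp add: algebra_simps)
  qed
  have h0: "?h (x', 0) = g x'" for x' by (simp add: pole_profile_def)
  show ?thesis
  proof (cases "y = 0")
    case True
    show ?thesis
    proof (cases "x = a")
      case False
      then show ?thesis
        using one[of 1] one[of "- 1"] axis[of x]
        by (simp add: xy True nbr_mean_axis h0) (simp add: pole_profile_def)
    next
      case x: True
      then show ?thesis
        using one[of "- 1"] root b
        by (simp add: xy True nbr_mean_axis h0) (simp add: pole_profile_def)
    qed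
  next
    case False
    have conv: "2 * (g x * tent (H x) y) \<le> g x * tent (H x) (y + 1) + g x * tent (H x) (y - 1)"
      using mult_left_mono[OF tent_convex[OF False] g[of x], of "H x"] by (simp add: algebra_simps)
    show ?thesis
    proof (cases "x = a \<and> 0 < y")
      case no: False
      have "?h (x, y + 1) = g x * tent (H x) (y + 1)"
        using no False by (cases "y = - 1") (auto simp: pole_profile_def)
      moreover have "?h (x, y - 1) = g x * tent (H x) (y - 1)" "?h (x, y) = g x * tent (H x) y"
        using no by (auto simp: pole_profile_def)
      ultimately show ?thesis
        using conv by (simp add: xy nbr_mean_off_axis[OF False])
    next
      case yes: True
      have nonneg: "0 \<le> ?h u" for u
        using g s by (auto simp: pole_profile_def tent_nonneg split: prod.splits)
      show ?thesis
      proof (cases "y < int b")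
        case True
        have "?h (x, y - 1) = g a + s * real_of_int (y - 1)"
          using yes True by (cases "y = 1") (auto simp: pole_profile_def)
        moreover have "?h (x, y) = g a + s * real_of_int y" "?h (x, y + 1) = g a + s * real_of_int (y + 1)"
          using yes True by (auto simp: pole_profile_def)
        ultimately show ?thesis by (simp add: xy nbr_mean_off_axis[OF False] algebra_simps)
      next
        case above: False
        then have "?h (x, y) = 0" using yes w xy by (auto simp: pole_profile_def)
        then show ?thesis
          using nonneg[of "(x, y + 1)"] nonneg[of "(x, y - 1)"] by (simp add: xy nbr_mean_off_axis[OF False])
      qed
    qed
  qed
qed

text \<open>
  The tooth of the pole is counted as an ordinary tooth plus its climbing arm. The double count of its upper arm
  is of lower order in the application.
\<close>

lemma pole_profile_sum_le:
  assumes g: "\<And>x. 0 \<le> g x" and s: "0 \<le> s" and H: "\<And>x. 1 \<le> H x"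
    and T: "\<And>G. finite G \<Longrightarrow> (\<Sum>x\<in>G. g x * real (H x)) \<le> T"
    and F: "finite F" "(a, int b) \<notin> F"
  shows "sum (pole_profile g H a b s) F \<le> T + g a * real b + s * (real b)\<^sup>2 / 2"
proof -
  let ?h = "pole_profile g H a b s"
  let ?I = "{a} \<times> {1..<int b}"
  have pt: "?h w \<le> g (fst w) * tent (H (fst w)) (snd w) + (if w \<in> ?I then g a + s * real_of_int (snd w) else 0)"
    if "w \<in> F" for w
  proof -
    have "0 \<le> g (fst w) * tent (H (fst w)) (snd w)" using g tent_nonneg by simp
    moreover have "w \<noteq> (a, int b)" using that F by auto
    ultimately show ?thesis by (cases w) (auto simp: pole_profile_def)
  qed
  have "sum ?h F \<le> (\<Sum>w\<in>F. g (fst w) * tent (H (fst w)) (snd w))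
      + (\<Sum>w\<in>F. if w \<in> ?I then g a + s * real_of_int (snd w) else 0)"
    using pt by (simp add: sum_mono flip: sum.distrib)
  also have "(\<Sum>w\<in>F. g (fst w) * tent (H (fst w)) (snd w)) \<le>
      (\<Sum>w\<in>fst ` F \<times> snd ` F. g (fst w) * tent (H (fst w)) (snd w))"
    using F g by (intro sum_mono2) (auto simp: tent_nonneg rev_image_eqI)
  also have "\<dots> = (\<Sum>x\<in>fst ` F. g x * (\<Sum>y\<in>snd ` F. tent (H x) y))"
    by (simp add: sum.cartesian_product' sum_distrib_left)
  also have "\<dots> \<le> (\<Sum>x\<in>fst ` F. g x * real (H x))"
    using F g by (intro sum_mono mult_left_mono sum_tent_le H) auto
  also have "\<dots> \<le> T" using F by (intro T) auto
  also have "(\<Sum>w\<in>F. if w \<in> ?I then g a + s * real_of_int (snd w) else 0) =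
      (\<Sum>w\<in>F \<inter> ?I. g a + s * real_of_int (snd w))"
    using F by (simp add: sum.inter_restrict)
  also have "\<dots> \<le> (\<Sum>w\<in>?I. g a + s * real_of_int (snd w))"
    using g s by (intro sum_mono2) auto
  also have "\<dots> = (\<Sum>y\<in>{1..<int b}. g a + s * real_of_int y)"
    by (simp add: sum.cartesian_product')
  also have "\<dots> = (\<Sum>y\<in>{1..<b}. g a + s * real y)"
    by (rule sum.reindex_bij_witness[of _ int nat]) auto
  also have "\<dots> \<le> g a * real b + s * (real b)\<^sup>2 / 2"
  proof (induction b)
    case (Suc b)
    show ?case
    proof (cases "b = 0")
      case True
      then show ?thesis using g[of a] s by simp
    next
      case False
      then have "{1..<Suc b} = insert b {1..<b}" by auto
      then have "(\<Sum>y\<in>{1..<Suc b}. g a + s * real y) = g a + s * real b + (\<Sum>y\<in>{1..<b}. g a + s * real y)"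
        by simp
      moreover have "s * (real (Suc b))\<^sup>2 / 2 = s * (real b)\<^sup>2 / 2 + s * real b + s / 2"
        by (simp add: power2_eq_square field_simps)
      moreover have "g a * real (Suc b) = g a * real b + g a" by (simp add: algebra_simps)
      ultimately show ?thesis using Suc s by linarith
    qed
  qed simp
  finally show ?thesis by simp
qed

lemma pole_profile_finite_support:
  assumes g: "finite {x. g x \<noteq> 0}" and H: "\<And>x. 1 \<le> H x"
  shows "finite {w. pole_profile g H a b s w \<noteq> 0}"
proof (rule finite_subset)
  let ?G = "{x. g x \<noteq> 0}"
  show "{w. pole_profile g H a b s w \<noteq> 0} \<subseteq> (SIGMA x:?G. {- int (H x)..int (H x)}) \<union> {a} \<times> {0..int b}"
  proof
    fix w assume w: "w \<in> {w. pole_profile g H a b s w \<noteq> 0}"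
    obtain x y where xy: "w = (x, y)" by (cases w)
    show "w \<in> (SIGMA x:?G. {- int (H x)..int (H x)}) \<union> {a} \<times> {0..int b}"
    proof (cases "x = a \<and> 0 < y")
      case True
      then show ?thesis using w by (auto simp: pole_profile_def xy split: if_splits)
    next
      case False
      then have "g x \<noteq> 0" and "tent (H x) y \<noteq> 0" using w by (auto simp: pole_profile_def xy)
      then have "\<bar>real_of_int y\<bar> / real (H x) < 1"
        by (metis tent_def diff_le_0_iff_le linorder_not_le max_absorb1)
      then have "\<bar>real_of_int y\<bar> < real (H x)" using H[of x] by (simp add: field_simps)
      then have "\<bar>y\<bar> < int (H x)" by linarith
      then show ?thesis using \<open>g x \<noteq> 0\<close> xy by auto
    qed
  qed
  show "finite ((SIGMA x:?G. {- int (H x)..int (H x)}) \<union> {a} \<times> {0..int b})"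
    using g by auto
qed

lemma pole_profile_nonneg: "(\<And>x. 0 \<le> g x) \<Longrightarrow> 0 \<le> s \<Longrightarrow> 0 \<le> pole_profile g H a b s w"
  by (auto simp: pole_profile_def tent_nonneg split: prod.splits)

lemma pole_profile_le:
  assumes g: "\<And>x. 0 \<le> g x" "\<And>x. g x \<le> B" and s: "0 \<le> s"
  shows "pole_profile g H a b s w \<le> B + s * real b"
proof -
  obtain x y where xy: "w = (x, y)" by (cases w)
  have B: "0 \<le> B" using g[of 0] by simp
  have "g x * tent (H x) y \<le> B * 1"
    by (rule mult_mono) (use g B tent_le_1 tent_nonneg in auto)
  moreover have "s * real_of_int y \<le> s * real b" if "y \<le> int b"
    by (rule mult_left_mono) (use that s in auto)
  moreover have "0 \<le> s * real b" using s by simp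
  ultimately show ?thesis using g(2)[of a] B by (auto simp: pole_profile_def xy)
qed

section \<open>The profile on the axis\<close>

lemma comb_k_pos: "comb_k > 0" and comb_l_pos: "comb_l > 0"
  by (simp_all add: comb_k_def comb_l_def)

lemma comb_k_times_l: "comb_k * comb_l = 3 / 4"
proof -
  have "comb_k * comb_l = 1 / 2 * ((3 / 2) powr (2 / 3) * (3 / 2) powr (1 / 3) :: real)"
    by (simp add: comb_k_def comb_l_def)
  also have "\<dots> = 3 / 4" by (simp flip: powr_add)
  finally show ?thesis .
qed

lemma comb_k_square: "comb_k\<^sup>2 = 3 * comb_l"
proof -
  have "comb_k\<^sup>2 = ((3 / 2) powr (2 / 3) * (3 / 2) powr (2 / 3) :: real)"
    by (simp add: comb_k_def power2_eq_square)
  also have "\<dots> = (3 / 2) powr (1 + 1 / 3)" by (simp flip: powr_add)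
  also have "\<dots> = 3 * comb_l" unfolding powr_add by (simp add: comb_l_def)
  finally show ?thesis .
qed

text \<open>
  The solution of the Euler equation between the origin and the pole. It is the combination
  of \<open>v\<^sup>3\<close> and \<open>v\<close> to the power \<open>- 2\<close> that continues the left branch \<open>(\<rho> - \<bar>x\<bar> / comb_k) ^ 3\<close> smoothly across the origin:
  the coefficients \<open>6 / 5\<close> and \<open>- 1 / 5\<close> match value and derivative at \<open>v = \<rho>\<close>.
\<close>

definition rise :: "real \<Rightarrow> real \<Rightarrow> real" where
  "rise \<rho> v = (6 * \<rho> ^ 5 / v ^ 2 - v ^ 3) / 5"

lemma cube_second_difference:
  fixes v e :: real
  shows "2 * v ^ 3 + 6 * v * e\<^sup>2 \<le> (v + e) ^ 3 + (max 0 (v - e)) ^ 3"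
proof -
  have "(v - e) ^ 3 \<le> (max 0 (v - e)) ^ 3" by (intro power_mono_odd) auto
  moreover have "(v + e) ^ 3 + (v - e) ^ 3 = 2 * v ^ 3 + 6 * v * e\<^sup>2"
    by (simp add: power3_eq_cube power2_eq_square algebra_simps)
  ultimately show ?thesis by linarith
qed

lemma inverse_square_second_difference:
  fixes v e :: real
  assumes "0 \<le> e" "e < v"
  shows "2 / v\<^sup>2 + 6 * e\<^sup>2 / v ^ 4 \<le> 1 / (v + e)\<^sup>2 + 1 / (v - e)\<^sup>2"
proof -
  have v: "0 < v" "0 < v - e" "0 < v + e" using assms by auto
  have "e\<^sup>2 \<le> v\<^sup>2" using assms by (intro power_mono) auto
  then have A: "(v\<^sup>2 + 3 * e\<^sup>2) * (v\<^sup>2 - e\<^sup>2)\<^sup>2 \<le> (v\<^sup>2 + e\<^sup>2) * (v\<^sup>2)\<^sup>2"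
  proof -
    let ?A = "v\<^sup>2" and ?B = "e\<^sup>2"
    have "(?A + ?B) * ?A\<^sup>2 - (?A + 3 * ?B) * (?A - ?B)\<^sup>2 = ?B\<^sup>2 * (5 * ?A - 3 * ?B)"
      by algebra
    moreover have "0 \<le> 5 * ?A - 3 * ?B"
      using \<open>?B \<le> ?A\<close> zero_le_power2[of e] by linarith
    then have "0 \<le> ?B\<^sup>2 * (5 * ?A - 3 * ?B)" by (intro mult_nonneg_nonneg) auto
    ultimately show ?thesis by linarith
  qed
  have "2 / v\<^sup>2 + 6 * e\<^sup>2 / v ^ 4 = 2 * ((v\<^sup>2 + 3 * e\<^sup>2) / (v\<^sup>2)\<^sup>2)"
    using v by (simp add: field_simps power2_eq_square power4_eq_xxxx)
  also have "\<dots> \<le> 2 * ((v\<^sup>2 + e\<^sup>2) / (v\<^sup>2 - e\<^sup>2)\<^sup>2)"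
  proof -
    have "v\<^sup>2 - e\<^sup>2 = (v - e) * (v + e)" by (simp add: power2_eq_square algebra_simps)
    then have pos: "0 < (v\<^sup>2 - e\<^sup>2)\<^sup>2" using v by simp
    have "(v\<^sup>2 + 3 * e\<^sup>2) \<le> (v\<^sup>2 + e\<^sup>2) * (v\<^sup>2)\<^sup>2 / (v\<^sup>2 - e\<^sup>2)\<^sup>2"
      by (rule mult_imp_le_div_pos[OF pos A])
    then have "(v\<^sup>2 + 3 * e\<^sup>2) / (v\<^sup>2)\<^sup>2 \<le> (v\<^sup>2 + e\<^sup>2) / (v\<^sup>2 - e\<^sup>2)\<^sup>2"
      using v by (intro mult_imp_div_pos_le) auto
    then show ?thesis by (rule mult_left_mono) simp
  qed
  also have "\<dots> = ((v - e)\<^sup>2 + (v + e)\<^sup>2) / ((v + e)\<^sup>2 * (v - e)\<^sup>2)"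
    by (simp add: power2_eq_square algebra_simps)
  also have "\<dots> = 1 / (v + e)\<^sup>2 + 1 / (v - e)\<^sup>2"
    using v by (simp add: field_simps)
  finally show ?thesis .
qed

text \<open>
  The cubic term has exactly the second difference of the equation and the other one at least
  that, so the discrete inequality needs no correction.
\<close>

lemma rise_second_difference:
  assumes "0 \<le> e" "e < v" "0 \<le> \<rho>"
  shows "2 * rise \<rho> v + 6 * e\<^sup>2 * rise \<rho> v / v\<^sup>2 \<le> rise \<rho> (v + e) + rise \<rho> (v - e)"
proof -
  have v: "v > 0" using assms by simp
  have le: "6 * \<rho> ^ 5 * (2 / v\<^sup>2 + 6 * e\<^sup>2 / v ^ 4) \<le> 6 * \<rho> ^ 5 * (1 / (v + e)\<^sup>2 + 1 / (v - e)\<^sup>2)"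
    using assms by (intro mult_left_mono inverse_square_second_difference) auto
  have eq1: "5 * (2 * rise \<rho> v + 6 * e\<^sup>2 * rise \<rho> v / v\<^sup>2) =
      6 * \<rho> ^ 5 * (2 / v\<^sup>2 + 6 * e\<^sup>2 / v ^ 4) - (2 * v ^ 3 + 6 * v * e\<^sup>2)"
    using v by (simp add: rise_def field_simps power2_eq_square power3_eq_cube power4_eq_xxxx)
  have eq2: "5 * (rise \<rho> (v + e) + rise \<rho> (v - e)) =
      6 * \<rho> ^ 5 * (1 / (v + e)\<^sup>2 + 1 / (v - e)\<^sup>2) - ((v + e) ^ 3 + (v - e) ^ 3)"
    unfolding rise_def by (simp add: distrib_left diff_divide_distrib)
  have eq3: "(v + e) ^ 3 + (v - e) ^ 3 = 2 * v ^ 3 + 6 * v * e\<^sup>2"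
    by (simp add: power3_eq_cube power2_eq_square algebra_simps)
  have "5 * (2 * rise \<rho> v + 6 * e\<^sup>2 * rise \<rho> v / v\<^sup>2) \<le> 5 * (rise \<rho> (v + e) + rise \<rho> (v - e))"
    unfolding eq1 eq2 eq3 using le by (rule diff_right_mono)
  then show ?thesis by (simp only: mult_le_cancel_left_pos zero_less_numeral)
qed

lemma rise_same: "\<rho> > 0 \<Longrightarrow> rise \<rho> \<rho> = \<rho> ^ 3"
  by (simp add: rise_def field_simps eval_nat_numeral)

text \<open>
  Across the origin \<open>rise\<close> and the reflected cube agree to second order. This lemma and the next one compare
  them one step away, so that the origin needs no separate estimate.
\<close>

lemma rise_ge_cube:
  assumes "0 \<le> e" "e < \<rho>" shows "(\<rho> + e) ^ 3 \<le> rise \<rho> (\<rho> - e)"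
proof -
  have "6 * \<rho> ^ 5 - (\<rho> - e) ^ 5 - 5 * (\<rho> + e) ^ 3 * (\<rho> - e)\<^sup>2 =
      e ^ 3 * (20 * \<rho>\<^sup>2 - 10 * \<rho> * e - 4 * e\<^sup>2)"
    by algebra
  moreover have "0 \<le> e ^ 3 * (20 * \<rho>\<^sup>2 - 10 * \<rho> * e - 4 * e\<^sup>2)"
  proof -
    have "e * e \<le> \<rho> * \<rho>" "\<rho> * e \<le> \<rho> * \<rho>" using assms by (auto intro: mult_mono)
    then have "0 \<le> 20 * \<rho>\<^sup>2 - 10 * \<rho> * e - 4 * e\<^sup>2"
      unfolding power2_eq_square using zero_le_square[of \<rho>] by linarith
    then show ?thesis using assms by simp
  qed
  ultimately have "5 * (\<rho> + e) ^ 3 * (\<rho> - e)\<^sup>2 \<le> 6 * \<rho> ^ 5 - (\<rho> - e) ^ 5" by linarith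
  moreover have "(\<rho> - e) ^ 5 = (\<rho> - e) ^ 3 * (\<rho> - e)\<^sup>2" by (simp flip: power_add)
  ultimately have "(5 * (\<rho> + e) ^ 3 + (\<rho> - e) ^ 3) * (\<rho> - e)\<^sup>2 \<le> 6 * \<rho> ^ 5"
    unfolding distrib_right by linarith
  then have "5 * (\<rho> + e) ^ 3 + (\<rho> - e) ^ 3 \<le> 6 * \<rho> ^ 5 / (\<rho> - e)\<^sup>2"
    using assms by (simp add: le_divide_eq)
  then show ?thesis by (simp add: rise_def)
qed

lemma rise_le_cube:
  assumes "0 \<le> e" "e \<le> \<rho>" "0 < \<rho>" shows "rise \<rho> (\<rho> + e) \<le> (\<rho> - e) ^ 3"
proof -
  have "(\<rho> + e) ^ 5 + 5 * (\<rho> - e) ^ 3 * (\<rho> + e)\<^sup>2 - 6 * \<rho> ^ 5 =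
      e ^ 3 * (20 * \<rho>\<^sup>2 + 10 * \<rho> * e - 4 * e\<^sup>2)"
    by algebra
  moreover have "0 \<le> e ^ 3 * (20 * \<rho>\<^sup>2 + 10 * \<rho> * e - 4 * e\<^sup>2)"
  proof -
    have "e * e \<le> \<rho> * \<rho>" "0 \<le> \<rho> * e" using assms by (auto intro: mult_mono)
    then have "0 \<le> 20 * \<rho>\<^sup>2 + 10 * \<rho> * e - 4 * e\<^sup>2"
      unfolding power2_eq_square using zero_le_square[of \<rho>] by linarith
    then show ?thesis using assms by simp
  qed
  ultimately have "6 * \<rho> ^ 5 \<le> (\<rho> + e) ^ 5 + 5 * (\<rho> - e) ^ 3 * (\<rho> + e)\<^sup>2" by linarith
  moreover have "(\<rho> + e) ^ 5 = (\<rho> + e) ^ 3 * (\<rho> + e)\<^sup>2" by (simp flip: power_add)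
  ultimately have "6 * \<rho> ^ 5 \<le> (5 * (\<rho> - e) ^ 3 + (\<rho> + e) ^ 3) * (\<rho> + e)\<^sup>2"
    unfolding distrib_right by linarith
  then have "6 * \<rho> ^ 5 / (\<rho> + e)\<^sup>2 \<le> 5 * (\<rho> - e) ^ 3 + (\<rho> + e) ^ 3"
    using assms by (simp add: divide_le_eq)
  then show ?thesis by (simp add: rise_def)
qed

lemma rise_nonneg:
  assumes "0 < v" "v \<le> \<rho>" shows "0 \<le> rise \<rho> v"
proof -
  have "v ^ 3 * v\<^sup>2 \<le> \<rho> ^ 5" using assms by (simp flip: power_add add: power_mono)
  also have "\<dots> \<le> 6 * \<rho> ^ 5" using assms by simp
  finally show ?thesis using assms by (simp add: rise_def le_divide_eq)
qed

lemma rise_upper: "0 < v \<Longrightarrow> rise \<rho> v \<le> 6 / 5 * \<rho> ^ 5 / v\<^sup>2"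
  by (simp add: rise_def)

lemma rise_le_at:
  assumes "0 < V" "V \<le> v" "0 \<le> \<rho>" shows "rise \<rho> v \<le> 6 / 5 * \<rho> ^ 5 / V\<^sup>2"
proof -
  have "6 / 5 * \<rho> ^ 5 / v\<^sup>2 \<le> 6 / 5 * \<rho> ^ 5 / V\<^sup>2"
    using assms by (intro divide_left_mono power_mono mult_pos_pos) auto
  then show ?thesis using rise_upper[of v \<rho>] assms by simp
qed

text \<open>
  The slope on the arm of the pole. The leading term \<open>6 * \<rho> ^ 5 / (comb_k * V ^ 3)\<close> is the jump of the
  derivative of the continuum profile at the pole; the others bound the discretisation error of this jump and
  the loss through the opposite arm.
\<close>

definition pole_slope :: "real \<Rightarrow> real \<Rightarrow> real" where
  "pole_slope \<rho> V = 6 * \<rho> ^ 5 / (comb_k * V ^ 3) + (3 * V / comb_k\<^sup>2 + 1 / comb_k ^ 3) / 5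
     + 6 / 5 * \<rho> ^ 5 / (comb_l * V ^ 4)"

lemma pole_slope_nonneg: "0 < V \<Longrightarrow> 0 \<le> \<rho> \<Longrightarrow> 0 \<le> pole_slope \<rho> V"
  using comb_k_pos comb_l_pos by (simp add: pole_slope_def)

text \<open>
  Tangent bounds for the two branches at the pole: what the second difference of the profile loses there is at
  most the jump of its derivative and the error terms of \<open>pole_slope\<close>.
\<close>

lemma kink_le_pole_slope:
  assumes V: "1 / comb_k \<le> V" "V \<le> \<rho>" and H: "comb_l * V\<^sup>2 \<le> H"
    and left: "rise \<rho> (V + 1 / comb_k) \<le> L"
    and right: "rise \<rho> V / V ^ 3 * (max 0 (V - 1 / comb_k)) ^ 3 \<le> R"
  shows "2 * rise \<rho> V + rise \<rho> V / H \<le> R + L + pole_slope \<rho> V"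
proof -
  define e where "e = 1 / comb_k"
  have e: "0 < e" "e \<le> V" using V comb_k_pos by (auto simp: e_def)
  have V0: "0 < V" using e by simp
  have c: "0 \<le> rise \<rho> V / V ^ 3" using rise_nonneg[OF V0 V(2)] V0 by simp
  have "(V - e) ^ 3 = V ^ 3 - 3 * V\<^sup>2 * e + e\<^sup>2 * (3 * V - e)"
    by algebra
  moreover have "0 \<le> e\<^sup>2 * (3 * V - e)" using e by simp
  ultimately have "V ^ 3 - 3 * V\<^sup>2 * e \<le> (max 0 (V - e)) ^ 3" using e by (simp add: max_def)
  then have "rise \<rho> V / V ^ 3 * (V ^ 3 - 3 * V\<^sup>2 * e) \<le> R"
    using mult_left_mono[OF _ c] right unfolding e_def by fastforce
  moreover have "rise \<rho> V / V ^ 3 * (V ^ 3 - 3 * V\<^sup>2 * e) = rise \<rho> V - e * (18 / 5 * \<rho> ^ 5 / V ^ 3 - 3 / 5 * V\<^sup>2)"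
    using V0 by (simp add: rise_def field_simps power2_eq_square power3_eq_cube)
  ultimately have R: "rise \<rho> V - e * (18 / 5 * \<rho> ^ 5 / V ^ 3 - 3 / 5 * V\<^sup>2) \<le> R" by simp
  have "(V - 2 * e) * (V + e)\<^sup>2 = V ^ 3 - e\<^sup>2 * (3 * V + 2 * e)" by algebra
  moreover have "0 \<le> e\<^sup>2 * (3 * V + 2 * e)" using e by simp
  ultimately have "(V - 2 * e) * (V + e)\<^sup>2 \<le> V ^ 3" by linarith
  then have "(V - 2 * e) / V ^ 3 \<le> 1 / (V + e)\<^sup>2" using V0 e by (simp add: field_simps)
  then have "1 / V\<^sup>2 - 2 * e / V ^ 3 \<le> 1 / (V + e)\<^sup>2"
    using V0 by (simp add: diff_divide_distrib power2_eq_square power3_eq_cube)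
  then have "6 / 5 * \<rho> ^ 5 * (1 / V\<^sup>2 - 2 * e / V ^ 3) \<le> 6 / 5 * \<rho> ^ 5 * (1 / (V + e)\<^sup>2)"
    using V V0 by (intro mult_left_mono) auto
  moreover have "(V + e) ^ 3 = V ^ 3 + 3 * V\<^sup>2 * e + 3 * V * e\<^sup>2 + e ^ 3" by algebra
  ultimately have L: "rise \<rho> V - e * (12 / 5 * \<rho> ^ 5 / V ^ 3) - (3 * V\<^sup>2 * e + 3 * V * e\<^sup>2 + e ^ 3) / 5 \<le> L"
    using left unfolding e_def[symmetric] rise_def by (simp add: algebra_simps diff_divide_distrib add_divide_distrib)
  have "rise \<rho> V / H \<le> rise \<rho> V / (comb_l * V\<^sup>2)"
    using rise_nonneg[OF V0 V(2)] V0 comb_l_pos H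
    by (intro divide_left_mono mult_pos_pos) (auto intro: less_le_trans[OF _ H])
  also have "\<dots> \<le> 6 / 5 * \<rho> ^ 5 / V\<^sup>2 / (comb_l * V\<^sup>2)"
    using rise_upper[OF V0] V0 comb_l_pos by (intro divide_right_mono) auto
  also have "\<dots> = 6 / 5 * \<rho> ^ 5 / (comb_l * V ^ 4)" by (simp add: power2_eq_square power4_eq_xxxx)
  finally have Hb: "rise \<rho> V / H \<le> 6 / 5 * \<rho> ^ 5 / (comb_l * V ^ 4)" .
  have combine: "2 * r + q \<le> R + L + P"
    if "r - t1 \<le> R" "r - t2 - t3 \<le> L" "q \<le> t4" "t1 + t2 + t3 = u" "P = u + t4"
    for r q t1 t2 t3 t4 u P :: real
    using that by linarith
  have slope: "pole_slope \<rho> V = e * (6 * \<rho> ^ 5 / V ^ 3) + (3 * V * e\<^sup>2 + e ^ 3) / 5 + 6 / 5 * \<rho> ^ 5 / (comb_l * V ^ 4)"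
    unfolding pole_slope_def e_def by (simp add: power_divide)
  have split: "e * (18 / 5 * \<rho> ^ 5 / V ^ 3 - 3 / 5 * V\<^sup>2) + e * (12 / 5 * \<rho> ^ 5 / V ^ 3) + (3 * V\<^sup>2 * e + 3 * V * e\<^sup>2 + e ^ 3) / 5
     = e * (6 * \<rho> ^ 5 / V ^ 3) + (3 * V * e\<^sup>2 + e ^ 3) / 5"
    using V0 by (simp add: field_simps)
  show ?thesis by (rule combine[OF R L Hb split slope])
qed

lemma comb_k_ge_1: "1 \<le> comb_k"
  by (simp add: comb_k_def ge_one_powr_ge_zero)

text \<open>
  The coordinate \<open>v\<close> in which the profile satisfies the Euler equation, cut off at zero outside the ball.
\<close>

definition radius :: "real \<Rightarrow> int \<Rightarrow> real" where
  "radius \<rho> x = max 0 (\<rho> - \<bar>real_of_int x\<bar> / comb_k)"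

text \<open>
  Rounding up keeps the loss along the tooth below that of the continuum equation. The lower bound \<open>1\<close> only
  matters outside the ball, where the profile vanishes.
\<close>

definition tooth_height :: "real \<Rightarrow> int \<Rightarrow> nat" where
  "tooth_height \<rho> x = max 1 (nat \<lceil>comb_l * (radius \<rho> x)\<^sup>2\<rceil>)"

text \<open>
  The solution on the axis with a kink at \<open>a \<ge> 0\<close>: the decaying cube on both outer sides, \<open>rise\<close> in between,
  scaled beyond \<open>a\<close> to be continuous there.
\<close>

definition axis_profile :: "real \<Rightarrow> int \<Rightarrow> int \<Rightarrow> real" where
  "axis_profile \<rho> a x =
     (if x < 0 then radius \<rho> x ^ 3
      else if x \<le> a then rise \<rho> (radius \<rho> x)
      else rise \<rho> (radius \<rho> a) / radius \<rho> a ^ 3 * radius \<rho> x ^ 3)"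

lemma radius_nonneg: "0 \<le> radius \<rho> x"
  by (simp add: radius_def)

lemma height_ge_1: "1 \<le> tooth_height \<rho> x"
  by (simp add: tooth_height_def)

lemma height_ge: "comb_l * (radius \<rho> x)\<^sup>2 \<le> real (tooth_height \<rho> x)"
  by (simp add: tooth_height_def) linarith

lemma height_le: "real (tooth_height \<rho> x) \<le> comb_l * (radius \<rho> x)\<^sup>2 + 1"
proof -
  have "0 \<le> comb_l * (radius \<rho> x)\<^sup>2" using comb_l_pos by simp
  then show ?thesis by (simp add: tooth_height_def) linarith
qed

text \<open>
  The arithmetic of the two constants: \<open>3 * comb_l = comb_k\<^sup>2\<close> is what makes the exponents integers.
\<close>

lemma loss_along_tooth:
  assumes "0 < radius \<rho> x" "0 \<le> g"
  shows "2 * g / real (tooth_height \<rho> x) \<le> 6 * (1 / comb_k)\<^sup>2 * g / (radius \<rho> x)\<^sup>2"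
proof -
  have "2 * g / real (tooth_height \<rho> x) \<le> 2 * g / (comb_l * (radius \<rho> x)\<^sup>2)"
    using assms comb_l_pos height_ge[of \<rho> x] height_ge_1[of \<rho> x]
    by (intro divide_left_mono mult_pos_pos) auto
  also have "\<dots> = 6 * (1 / comb_k)\<^sup>2 * g / (radius \<rho> x)\<^sup>2"
    using comb_l_pos by (simp add: power_divide comb_k_square)
  finally show ?thesis .
qed

context
  fixes \<rho> :: real and a :: int
  assumes a: "0 \<le> a" and margin: "1 / comb_k \<le> \<rho> - real_of_int a / comb_k"
begin

lemma radius_pos_between: "0 \<le> x \<Longrightarrow> x \<le> a \<Longrightarrow> radius \<rho> x = \<rho> - real_of_int x / comb_k"
  and radius_ge_pole: "0 \<le> x \<Longrightarrow> x \<le> a \<Longrightarrow> radius \<rho> a \<le> radius \<rho> x"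
proof -
  have *: "real_of_int x / comb_k \<le> real_of_int a / comb_k" if "x \<le> a"
    using that comb_k_pos by (intro divide_right_mono) auto
  have **: "0 \<le> 1 / comb_k" using comb_k_pos by simp
  show "radius \<rho> x = \<rho> - real_of_int x / comb_k" if "0 \<le> x" "x \<le> a"
  proof -
    have "0 \<le> \<rho> - real_of_int x / comb_k" using margin *[OF that(2)] ** by linarith
    then show ?thesis using that by (simp add: radius_def max_absorb2)
  qed
  show "radius \<rho> a \<le> radius \<rho> x" if "0 \<le> x" "x \<le> a"
    using *[OF that(2)] a that unfolding radius_def by (intro max.mono) auto
qed

lemma radius_pole: "1 / comb_k \<le> radius \<rho> a" "0 < radius \<rho> a" "radius \<rho> a \<le> \<rho>" "0 < \<rho>"
proof -
  have e: "0 < 1 / comb_k" and a': "0 \<le> real_of_int a / comb_k" using comb_k_pos a by auto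
  have V: "radius \<rho> a = \<rho> - real_of_int a / comb_k" using a radius_pos_between[of a] by simp
  show "1 / comb_k \<le> radius \<rho> a" "0 < radius \<rho> a" "radius \<rho> a \<le> \<rho>" "0 < \<rho>"
    unfolding V using margin e a' by linarith+
qed

lemma radius_le: "radius \<rho> x \<le> \<rho>"
  using radius_pole comb_k_pos by (simp add: radius_def)

lemma radius_zero: "radius \<rho> 0 = \<rho>"
  using radius_pole by (simp add: radius_def)

lemma radius_beyond_pole: "a \<le> x \<Longrightarrow> radius \<rho> x \<le> radius \<rho> a"
  using a comb_k_pos unfolding radius_def by (intro max.mono diff_left_mono divide_right_mono) auto

lemma radius_shift_out:
  "0 \<le> x \<Longrightarrow> radius \<rho> (x + 1) = max 0 (radius \<rho> x - 1 / comb_k)"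
  "x \<le> 0 \<Longrightarrow> radius \<rho> (x - 1) = max 0 (radius \<rho> x - 1 / comb_k)"
proof -
  have e: "0 < 1 / comb_k" using comb_k_pos by simp
  have step: "max 0 (\<rho> - d') = max 0 (max 0 (\<rho> - d) - 1 / comb_k)" if "d' = d + 1 / comb_k" for d d'
    using that e by linarith
  show "0 \<le> x \<Longrightarrow> radius \<rho> (x + 1) = max 0 (radius \<rho> x - 1 / comb_k)"
    unfolding radius_def by (rule step) (simp add: abs_of_nonneg add_divide_distrib)
  show "x \<le> 0 \<Longrightarrow> radius \<rho> (x - 1) = max 0 (radius \<rho> x - 1 / comb_k)"
    unfolding radius_def by (rule step) (simp add: abs_of_nonpos diff_divide_distrib)
qed

lemma radius_shift_in:
  "0 < radius \<rho> x \<Longrightarrow> 0 < x \<Longrightarrow> radius \<rho> (x - 1) = radius \<rho> x + 1 / comb_k"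
  "0 < radius \<rho> x \<Longrightarrow> x < 0 \<Longrightarrow> radius \<rho> (x + 1) = radius \<rho> x + 1 / comb_k"
proof -
  have e: "0 < 1 / comb_k" using comb_k_pos by simp
  have step: "max 0 (\<rho> - d') = max 0 (\<rho> - d) + 1 / comb_k"
    if "0 < max 0 (\<rho> - d)" "d' = d - 1 / comb_k" for d d'
    using that e by linarith
  show "0 < radius \<rho> x \<Longrightarrow> 0 < x \<Longrightarrow> radius \<rho> (x - 1) = radius \<rho> x + 1 / comb_k"
    unfolding radius_def by (rule step) (auto simp: abs_of_nonneg diff_divide_distrib)
  show "0 < radius \<rho> x \<Longrightarrow> x < 0 \<Longrightarrow> radius \<rho> (x + 1) = radius \<rho> x + 1 / comb_k"
    unfolding radius_def by (rule step) (auto simp: abs_of_nonpos add_divide_distrib diff_divide_distrib)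
qed

lemma axis_profile_nonneg: "0 \<le> axis_profile \<rho> a x"
  using radius_pole radius_nonneg[of \<rho> x] radius_ge_pole[of x] radius_le[of x]
  by (auto simp: axis_profile_def intro!: rise_nonneg mult_nonneg_nonneg divide_nonneg_nonneg)

lemma axis_profile_le: "axis_profile \<rho> a x \<le> 6 / 5 * \<rho> ^ 5 / (radius \<rho> a)\<^sup>2"
proof -
  let ?V = "radius \<rho> a"
  have V: "0 < ?V" "?V \<le> \<rho>" "0 < \<rho>" using radius_pole by auto
  consider "x < 0" | "0 \<le> x" "x \<le> a" | "a < x" by linarith
  then show ?thesis
  proof cases
    case 1
    have "radius \<rho> x ^ 3 * ?V\<^sup>2 \<le> \<rho> ^ 3 * \<rho>\<^sup>2"
      using V radius_le radius_nonneg by (intro mult_mono power_mono) auto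
    also have "\<dots> = \<rho> ^ 5" by (simp flip: power_add)
    also have "\<dots> \<le> 6 / 5 * \<rho> ^ 5" using V by simp
    finally show ?thesis using 1 V by (simp add: axis_profile_def le_divide_eq)
  next
    case 2
    then show ?thesis using rise_le_at[of ?V "radius \<rho> x" \<rho>] radius_ge_pole[of x] V
      by (simp add: axis_profile_def)
  next
    case 3
    have "rise \<rho> ?V / ?V ^ 3 * radius \<rho> x ^ 3 \<le> rise \<rho> ?V / ?V ^ 3 * ?V ^ 3"
      using V 3 radius_beyond_pole[of x] radius_nonneg rise_nonneg[of ?V \<rho>]
      by (intro mult_left_mono power_mono) auto
    also have "\<dots> = rise \<rho> ?V" using V by simp
    also have "\<dots> \<le> 6 / 5 * \<rho> ^ 5 / ?V\<^sup>2" using V by (intro rise_upper) auto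
    finally show ?thesis using 3 a by (simp add: axis_profile_def)
  qed
qed

lemma axis_profile_origin: "axis_profile \<rho> a 0 = \<rho> ^ 3"
  using a radius_pole by (simp add: axis_profile_def radius_zero rise_same)

lemma axis_profile_support: "finite {x. axis_profile \<rho> a x \<noteq> 0}"
proof (rule finite_subset)
  show "{x. axis_profile \<rho> a x \<noteq> 0} \<subseteq> {- \<lceil>\<rho> * comb_k\<rceil>..\<lceil>\<rho> * comb_k\<rceil> + a}"
  proof
    fix x assume x: "x \<in> {x. axis_profile \<rho> a x \<noteq> 0}"
    show "x \<in> {- \<lceil>\<rho> * comb_k\<rceil>..\<lceil>\<rho> * comb_k\<rceil> + a}"
    proof (cases "0 \<le> x \<and> x \<le> a")
      case True
      have "0 \<le> \<rho> * comb_k" using radius_pole comb_k_pos by simp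
      then have "0 \<le> \<lceil>\<rho> * comb_k\<rceil>" by linarith
      then show ?thesis using True unfolding atLeastAtMost_iff by linarith
    next
      case False
      then have "radius \<rho> x \<noteq> 0" using x a by (auto simp: axis_profile_def)
      then have "\<bar>real_of_int x\<bar> / comb_k < \<rho>" by (auto simp: radius_def max_def split: if_splits)
      then have "\<bar>real_of_int x\<bar> < \<rho> * comb_k" using comb_k_pos by (simp add: field_simps)
      then have "\<bar>x\<bar> \<le> \<lceil>\<rho> * comb_k\<rceil>" by linarith
      then show ?thesis using a by auto
    qed
  qed
qed simp

text \<open>
  Each of the four ranges reduces to the second difference of one branch. Where a neighbour belongs to
  another branch, at the origin and next to the pole, that branch takes at least the value required.
\<close>

lemma axis_profile_convex:
  assumes "x \<noteq> a"
  shows "2 * axis_profile \<rho> a x + 2 * axis_profile \<rho> a x / real (tooth_height \<rho> x)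
    \<le> axis_profile \<rho> a (x + 1) + axis_profile \<rho> a (x - 1)"
proof (cases "radius \<rho> x = 0")
  case True
  have "\<not> (0 \<le> x \<and> x \<le> a)" using True radius_ge_pole[of x] radius_pole by auto
  then have "axis_profile \<rho> a x = 0" using True by (auto simp: axis_profile_def)
  then show ?thesis using axis_profile_nonneg[of "x + 1"] axis_profile_nonneg[of "x - 1"] by simp
next
  case False
  let ?g = "axis_profile \<rho> a" and ?e = "1 / comb_k" and ?v = "radius \<rho> x" and ?V = "radius \<rho> a"
  have v: "0 < ?v" using False radius_nonneg[of \<rho> x] by simp
  have V: "0 < ?V" "?V \<le> \<rho>" "0 < \<rho>" "?e \<le> ?V" using radius_pole by auto
  have e: "0 < ?e" using comb_k_pos by simp
  have loss: "2 * ?g x / real (tooth_height \<rho> x) \<le> 6 * ?e\<^sup>2 * ?g x / ?v\<^sup>2"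
    by (rule loss_along_tooth[OF v axis_profile_nonneg])
  have cube: "2 * ?v ^ 3 + 6 * ?e\<^sup>2 * ?v ^ 3 / ?v\<^sup>2 \<le> (?v + ?e) ^ 3 + (max 0 (?v - ?e)) ^ 3"
  proof -
    have "6 * ?e\<^sup>2 * ?v ^ 3 / ?v\<^sup>2 = 6 * ?v * ?e\<^sup>2" using v by (simp add: power2_eq_square power3_eq_cube)
    then show ?thesis using cube_second_difference[of ?v ?e] by linarith
  qed
  have "2 * ?g x + 6 * ?e\<^sup>2 * ?g x / ?v\<^sup>2 \<le> ?g (x + 1) + ?g (x - 1)"
  proof -
    consider "x < 0" | "x = 0" "0 < a" | "0 < x" "x < a" | "a < x" using assms a by linarith
    then show ?thesis
    proof cases
      case 1
      have "?g (x + 1) = (?v + ?e) ^ 3"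
      proof (cases "x = - 1")
        case True
        then have "?v + ?e = \<rho>" using radius_shift_in(2)[OF v 1] radius_zero by simp
        then show ?thesis using True axis_profile_origin by simp
      next
        case False
        then show ?thesis using 1 radius_shift_in(2)[OF v 1] by (simp add: axis_profile_def)
      qed
      moreover have "?g (x - 1) = (max 0 (?v - ?e)) ^ 3"
        using 1 radius_shift_out(2)[of x] by (simp add: axis_profile_def)
      moreover have "?g x = ?v ^ 3" using 1 by (simp add: axis_profile_def)
      ultimately show ?thesis using cube by simp
    next
      case 2
      have r1: "radius \<rho> 1 = \<rho> - ?e" using 2 radius_pos_between[of 1] by simp
      have less: "?e < \<rho>" using 2 r1 radius_ge_pole[of 1] V by auto
      have "?g (x + 1) = rise \<rho> (\<rho> - ?e)" using 2 r1 by (simp add: axis_profile_def)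
      then have "(\<rho> + ?e) ^ 3 \<le> ?g (x + 1)" using rise_ge_cube[of ?e \<rho>] less e by simp
      moreover have "?g (x - 1) = (max 0 (\<rho> - ?e)) ^ 3"
        using 2 radius_shift_out(2)[of 0] radius_zero by (simp add: axis_profile_def)
      moreover have "?g x = ?v ^ 3" using 2 axis_profile_origin radius_zero by simp
      moreover have "?v = \<rho>" using 2 radius_zero by simp
      ultimately show ?thesis using cube by simp
    next
      case 3
      have "?V \<le> radius \<rho> (x + 1)" using 3 by (intro radius_ge_pole) auto
      moreover have "radius \<rho> (x + 1) = ?v - ?e"
        using 3 radius_pos_between[of x] radius_pos_between[of "x + 1"] by (simp add: add_divide_distrib)
      ultimately have *: "?g (x + 1) = rise \<rho> (?v - ?e)" "?e < ?v"
        using 3 V(1) by (simp add: axis_profile_def, linarith)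
      have "?g (x - 1) = rise \<rho> (?v + ?e)" "?g x = rise \<rho> ?v"
        using 3 radius_shift_in(1)[OF v] by (simp_all add: axis_profile_def)
      then show ?thesis using rise_second_difference[of ?e ?v \<rho>] * e V by simp
    next
      case 4
      let ?c = "rise \<rho> ?V / ?V ^ 3"
      have c: "0 \<le> ?c" using V rise_nonneg[of ?V \<rho>] by simp
      have "?g (x - 1) = ?c * (?v + ?e) ^ 3"
      proof (cases "x = a + 1")
        case True
        then have "?v + ?e = ?V" using radius_shift_in(1)[OF v] a by simp
        then show ?thesis using True a V by (simp add: axis_profile_def)
      next
        case False
        then show ?thesis using 4 a radius_shift_in(1)[OF v] by (simp add: axis_profile_def)
      qed
      moreover have "?g (x + 1) = ?c * (max 0 (?v - ?e)) ^ 3"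
        using 4 a radius_shift_out(1)[of x] by (simp add: axis_profile_def)
      ultimately have out: "?g (x + 1) + ?g (x - 1) = ?c * ((?v + ?e) ^ 3 + (max 0 (?v - ?e)) ^ 3)"
        by (simp only: distrib_left add.commute)
      have "?g x = ?c * ?v ^ 3" using 4 a by (simp add: axis_profile_def)
      then have mid: "2 * ?g x + 6 * ?e\<^sup>2 * ?g x / ?v\<^sup>2 = ?c * (2 * ?v ^ 3 + 6 * ?e\<^sup>2 * ?v ^ 3 / ?v\<^sup>2)"
        by (simp add: distrib_left mult_ac)
      show ?thesis unfolding out mid by (rule mult_left_mono[OF cube c])
    qed
  qed
  then show ?thesis using loss by linarith
qed

lemma axis_profile_kink:
  "2 * axis_profile \<rho> a a + axis_profile \<rho> a a / real (tooth_height \<rho> a)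
    \<le> axis_profile \<rho> a (a + 1) + axis_profile \<rho> a (a - 1) + pole_slope \<rho> (radius \<rho> a)"
proof -
  let ?V = "radius \<rho> a" and ?e = "1 / comb_k"
  have e: "0 < ?e" using comb_k_pos by simp
  have g: "axis_profile \<rho> a a = rise \<rho> ?V" using a by (simp add: axis_profile_def)
  have right: "axis_profile \<rho> a (a + 1) = rise \<rho> ?V / ?V ^ 3 * (max 0 (?V - ?e)) ^ 3"
    using a radius_shift_out(1)[of a] by (simp add: axis_profile_def)
  have left: "rise \<rho> (?V + ?e) \<le> axis_profile \<rho> a (a - 1)"
  proof (cases "a = 0")
    case True
    then have V: "?V = \<rho>" using radius_zero by simp
    have "rise \<rho> (\<rho> + ?e) \<le> (\<rho> - ?e) ^ 3"
      using radius_pole e V by (intro rise_le_cube) linarith+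
    also have "\<dots> \<le> (max 0 (\<rho> - ?e)) ^ 3" by (intro power_mono_odd) auto
    also have "\<dots> = axis_profile \<rho> a (a - 1)"
      using True radius_shift_out(2)[of 0] radius_zero by (simp add: axis_profile_def)
    finally show ?thesis using V by simp
  next
    case False
    then show ?thesis using a radius_shift_in(1)[OF radius_pole(2)] by (simp add: axis_profile_def)
  qed
  show ?thesis
    unfolding g
    by (rule kink_le_pole_slope[OF radius_pole(1) radius_pole(3) height_ge left]) (simp add: right)
qed

end

section \<open>The total weight of the potential\<close>

text \<open>
  A power lies above its tangents. In place of integrals, these inequalities let sums of powers telescope.
\<close>

lemma power_tangent:
  fixes x y :: real
  assumes "0 \<le> x" "0 \<le> y"
  shows "6 * x ^ 5 * (y - x) \<le> y ^ 6 - x ^ 6" "4 * x ^ 3 * (y - x) \<le> y ^ 4 - x ^ 4"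
proof -
  have "y ^ 6 - x ^ 6 - 6 * x ^ 5 * (y - x) =
      (y - x)\<^sup>2 * (y ^ 4 + 2 * y ^ 3 * x + 3 * y\<^sup>2 * x\<^sup>2 + 4 * y * x ^ 3 + 5 * x ^ 4)"
    by algebra
  moreover have "0 \<le> \<dots>" using assms by simp
  ultimately show "6 * x ^ 5 * (y - x) \<le> y ^ 6 - x ^ 6" by linarith
  have "y ^ 4 - x ^ 4 - 4 * x ^ 3 * (y - x) = (y - x)\<^sup>2 * (y\<^sup>2 + 2 * y * x + 3 * x\<^sup>2)"
    by algebra
  moreover have "0 \<le> \<dots>" using assms by simp
  ultimately show "4 * x ^ 3 * (y - x) \<le> y ^ 4 - x ^ 4" by linarith
qed

text \<open>
  Each summand is at most the decrement of \<open>w ^ 6 / 8 + comb_k * w ^ 4 / 4\<close>, the antiderivative of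
  \<open>comb_k * (comb_l * w ^ 5 + w ^ 3)\<close>; the cubic term is the price of rounding heights up.
\<close>

lemma power_sum_tail_le:
  assumes W: "0 \<le> W"
  shows "(\<Sum>j=1..N. comb_l * max 0 (W - real j / comb_k) ^ 5 + max 0 (W - real j / comb_k) ^ 3)
    \<le> W ^ 6 / 8 + comb_k * W ^ 4 / 4"
proof -
  let ?w = "\<lambda>j::nat. max 0 (W - real j / comb_k)"
  let ?P = "\<lambda>u. u ^ 6 / 8 + comb_k * u ^ 4 / 4"
  have step: "comb_l * ?w (Suc j) ^ 5 + ?w (Suc j) ^ 3 \<le> ?P (?w j) - ?P (?w (Suc j))" for j
  proof -
    let ?x = "?w (Suc j)" and ?y = "?w j"
    have x: "0 \<le> ?x" "0 \<le> ?y" by auto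
    have d: "?x ^ n * (1 / comb_k) \<le> ?x ^ n * (?y - ?x)" if "0 < n" for n
    proof (cases "?x = 0")
      case True
      then show ?thesis unfolding True using that by (simp add: zero_power)
    next
      case False
      have "real (Suc j) / comb_k = real j / comb_k + 1 / comb_k" by (simp add: add_divide_distrib)
      then have "1 / comb_k \<le> ?y - ?x" using False by linarith
      then show ?thesis using x by (intro mult_left_mono) auto
    qed
    have six: "6 * (?x ^ 5 * (1 / comb_k)) \<le> ?y ^ 6 - ?x ^ 6"
      using power_tangent(1)[OF x] d[of 5] by linarith
    have five: "comb_l * ?x ^ 5 = 6 * (?x ^ 5 * (1 / comb_k)) / 8"
    proof -
      have "comb_l = 3 / 4 * (1 / comb_k)" using comb_k_times_l comb_k_pos by (simp add: field_simps)
      then show ?thesis by (rule ssubst) simp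
    qed
    have A: "comb_l * ?x ^ 5 \<le> ?y ^ 6 / 8 - ?x ^ 6 / 8"
      unfolding five diff_divide_distrib[symmetric] by (rule divide_right_mono[OF six]) simp
    have "4 * (?x ^ 3 * (1 / comb_k)) \<le> ?y ^ 4 - ?x ^ 4"
      using power_tangent(2)[OF x] d[of 3] by linarith
    then have "comb_k / 4 * (4 * (?x ^ 3 * (1 / comb_k))) \<le> comb_k / 4 * (?y ^ 4 - ?x ^ 4)"
      using comb_k_pos by (intro mult_left_mono) auto
    then have B: "?x ^ 3 \<le> comb_k * ?y ^ 4 / 4 - comb_k * ?x ^ 4 / 4"
      using comb_k_pos by (simp add: right_diff_distrib diff_divide_distrib)
    show ?thesis using A B by linarith
  qed
  have "(\<Sum>j=1..N. comb_l * ?w j ^ 5 + ?w j ^ 3) \<le> ?P (?w 0) - ?P (?w N)"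
  proof (induction N)
    case (Suc N)
    have "(\<Sum>j=1..Suc N. comb_l * ?w j ^ 5 + ?w j ^ 3) =
        (\<Sum>j=1..N. comb_l * ?w j ^ 5 + ?w j ^ 3) + (comb_l * ?w (Suc N) ^ 5 + ?w (Suc N) ^ 3)"
      by simp
    then show ?case using Suc step[of N] by linarith
  qed simp
  moreover have "0 \<le> ?P (?w N)" using comb_k_pos by simp
  moreover have "?w 0 = W" using W by simp
  ultimately show ?thesis by simp
qed

context
  fixes \<rho> :: real and a :: int
  assumes a: "0 \<le> a" and margin: "1 / comb_k \<le> \<rho> - real_of_int a / comb_k"
begin

lemma left_half_sum_le:
  "(\<Sum>j=1..N. axis_profile \<rho> a (- int j) * real (tooth_height \<rho> (- int j))) \<le> \<rho> ^ 6 / 8 + comb_k * \<rho> ^ 4 / 4"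
proof -
  have "axis_profile \<rho> a (- int j) * real (tooth_height \<rho> (- int j)) \<le>
      comb_l * max 0 (\<rho> - real j / comb_k) ^ 5 + max 0 (\<rho> - real j / comb_k) ^ 3" if "j \<in> {1..N}" for j
  proof -
    let ?u = "radius \<rho> (- int j)"
    have "?u ^ 3 * real (tooth_height \<rho> (- int j)) \<le> ?u ^ 3 * (comb_l * ?u\<^sup>2 + 1)"
      by (intro mult_left_mono height_le) (simp add: radius_nonneg)
    moreover have "?u ^ 5 = ?u ^ 3 * ?u\<^sup>2" by (simp flip: power_add)
    moreover have "?u = max 0 (\<rho> - real j / comb_k)" by (simp add: radius_def)
    moreover have "axis_profile \<rho> a (- int j) = ?u ^ 3" using that by (simp add: axis_profile_def)
    ultimately show ?thesis by (simp add: algebra_simps)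
  qed
  then have "(\<Sum>j=1..N. axis_profile \<rho> a (- int j) * real (tooth_height \<rho> (- int j))) \<le>
      (\<Sum>j=1..N. comb_l * max 0 (\<rho> - real j / comb_k) ^ 5 + max 0 (\<rho> - real j / comb_k) ^ 3)"
    by (rule sum_mono)
  also have "\<dots> \<le> \<rho> ^ 6 / 8 + comb_k * \<rho> ^ 4 / 4"
    using radius_pole[OF a margin] by (intro power_sum_tail_le) simp
  finally show ?thesis .
qed

lemma beyond_pole_sum_le:
  "(\<Sum>j=1..N. axis_profile \<rho> a (a + int j) * real (tooth_height \<rho> (a + int j))) \<le>
    rise \<rho> (radius \<rho> a) / radius \<rho> a ^ 3 * (radius \<rho> a ^ 6 / 8 + comb_k * radius \<rho> a ^ 4 / 4)"
proof -
  let ?V = "radius \<rho> a"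
  let ?c = "rise \<rho> ?V / ?V ^ 3"
  have V: "0 < ?V" "?V \<le> \<rho>" using radius_pole[OF a margin] by auto
  have c: "0 \<le> ?c" using V rise_nonneg[of ?V \<rho>] by simp
  have Veq: "?V = \<rho> - real_of_int a / comb_k" using radius_pos_between[OF a margin, of a] a by simp
  have "axis_profile \<rho> a (a + int j) * real (tooth_height \<rho> (a + int j)) \<le>
      ?c * (comb_l * max 0 (?V - real j / comb_k) ^ 5 + max 0 (?V - real j / comb_k) ^ 3)" if "j \<in> {1..N}" for j
  proof -
    let ?u = "radius \<rho> (a + int j)"
    have u5: "?u ^ 5 = ?u ^ 3 * ?u\<^sup>2" by (simp flip: power_add)
    have u: "max 0 (?V - real j / comb_k) = ?u"
      unfolding Veq using a by (simp add: radius_def add_divide_distrib algebra_simps)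
    have g: "axis_profile \<rho> a (a + int j) = ?c * ?u ^ 3" using that a by (simp add: axis_profile_def)
    have "?c * ?u ^ 3 * real (tooth_height \<rho> (a + int j)) \<le> ?c * ?u ^ 3 * (comb_l * ?u\<^sup>2 + 1)"
      using c by (intro mult_left_mono height_le mult_nonneg_nonneg) (simp_all add: radius_nonneg)
    also have "\<dots> = ?c * (comb_l * ?u ^ 5 + ?u ^ 3)"
      unfolding u5 by (simp only: distrib_left distrib_right mult_ac mult_1_right mult_1_left)
    finally show ?thesis unfolding g u .
  qed
  then have "(\<Sum>j=1..N. axis_profile \<rho> a (a + int j) * real (tooth_height \<rho> (a + int j))) \<le>
      (\<Sum>j=1..N. ?c * (comb_l * max 0 (?V - real j / comb_k) ^ 5 + max 0 (?V - real j / comb_k) ^ 3))"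
    by (rule sum_mono)
  also have "\<dots> = ?c * (\<Sum>j=1..N. comb_l * max 0 (?V - real j / comb_k) ^ 5 + max 0 (?V - real j / comb_k) ^ 3)"
    by (simp add: sum_distrib_left)
  also have "\<dots> \<le> ?c * (?V ^ 6 / 8 + comb_k * ?V ^ 4 / 4)"
    using V by (intro mult_left_mono power_sum_tail_le c) simp
  finally show ?thesis .
qed

text \<open>
  A lower bound is needed here because \<open>v ^ 5\<close> enters the weight between origin and pole with a negative sign.
\<close>

lemma sum_fifth_powers_ge:
  "comb_k * (\<rho> ^ 6 - radius \<rho> (int m) ^ 6) / 6 \<le> (\<Sum>j<m. radius \<rho> (int j) ^ 5)"
  if "int m \<le> a"
  using that
proof (induction m)
  case 0
  then show ?case using radius_zero[OF a margin] by simp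
next
  case (Suc m)
  let ?v = "radius \<rho> (int m)" and ?w = "radius \<rho> (int (Suc m))"
  have "?w - ?v = - (1 / comb_k)"
    using Suc.prems radius_pos_between[OF a margin, of "int m"] radius_pos_between[OF a margin, of "int (Suc m)"]
    by (simp add: add_divide_distrib)
  then have "6 * ?v ^ 5 * (- (1 / comb_k)) \<le> ?w ^ 6 - ?v ^ 6"
    using power_tangent(1)[OF radius_nonneg radius_nonneg, of \<rho> "int m" \<rho> "int (Suc m)"] by simp
  then have "comb_k / 6 * (?v ^ 6 - ?w ^ 6) \<le> comb_k / 6 * (6 * ?v ^ 5 * (1 / comb_k))"
    using comb_k_pos by (intro mult_left_mono) auto
  then have "comb_k * (?v ^ 6 - ?w ^ 6) / 6 \<le> ?v ^ 5" using comb_k_pos by simp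
  moreover have "comb_k * (\<rho> ^ 6 - ?w ^ 6) / 6 = comb_k * (\<rho> ^ 6 - ?v ^ 6) / 6 + comb_k * (?v ^ 6 - ?w ^ 6) / 6"
    by (simp add: algebra_simps diff_divide_distrib)
  ultimately show ?case using Suc by simp
qed

lemma between_sum_le:
  "(\<Sum>j<nat a. axis_profile \<rho> a (int j) * real (tooth_height \<rho> (int j))) \<le>
    9 / 10 * \<rho> ^ 5 * (\<rho> - radius \<rho> a) - (\<rho> ^ 6 - radius \<rho> a ^ 6) / 40
    + 6 / 5 * comb_k * \<rho> ^ 6 / (radius \<rho> a)\<^sup>2"
proof -
  let ?V = "radius \<rho> a"
  have V: "0 < ?V" "?V \<le> \<rho>" "0 < \<rho>" using radius_pole[OF a margin] by auto
  have Veq: "real_of_int a = comb_k * (\<rho> - ?V)"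
    using radius_pos_between[OF a margin, of a] a comb_k_pos by simp
  have site: "axis_profile \<rho> a (int j) * real (tooth_height \<rho> (int j)) \<le>
      (6 / 5 * comb_l * \<rho> ^ 5 + 6 / 5 * \<rho> ^ 5 / ?V\<^sup>2) - comb_l / 5 * radius \<rho> (int j) ^ 5"
    if "j \<in> {..<nat a}" for j
  proof -
    let ?v = "radius \<rho> (int j)"
    have v: "?V \<le> ?v" "?v \<le> \<rho>" using that radius_ge_pole[OF a margin, of "int j"] radius_le[OF a margin] by auto
    then have v0: "0 < ?v" using V by simp
    have "rise \<rho> ?v * real (tooth_height \<rho> (int j)) \<le> rise \<rho> ?v * (comb_l * ?v\<^sup>2 + 1)"
      using v0 v by (intro mult_left_mono height_le rise_nonneg) auto
    also have "\<dots> = comb_l * (rise \<rho> ?v * ?v\<^sup>2) + rise \<rho> ?v" by (simp add: algebra_simps)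
    also have "rise \<rho> ?v * ?v\<^sup>2 = 6 / 5 * \<rho> ^ 5 - ?v ^ 5 / 5"
      using v0 by (simp add: rise_def field_simps flip: power_add)
    also have "comb_l * (6 / 5 * \<rho> ^ 5 - ?v ^ 5 / 5) = 6 / 5 * comb_l * \<rho> ^ 5 - comb_l / 5 * ?v ^ 5"
      by (simp add: right_diff_distrib)
    also have "rise \<rho> ?v \<le> 6 / 5 * \<rho> ^ 5 / ?V\<^sup>2" using V v by (intro rise_le_at) auto
    finally have "rise \<rho> ?v * real (tooth_height \<rho> (int j)) \<le>
        (6 / 5 * comb_l * \<rho> ^ 5 + 6 / 5 * \<rho> ^ 5 / ?V\<^sup>2) - comb_l / 5 * ?v ^ 5" by linarith
    moreover have "int j \<le> a" using that by auto
    ultimately show ?thesis by (simp only: axis_profile_def if_True if_False of_nat_less_0_iff)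
  qed
  have "(\<Sum>j<nat a. axis_profile \<rho> a (int j) * real (tooth_height \<rho> (int j))) \<le>
      (\<Sum>j<nat a. (6 / 5 * comb_l * \<rho> ^ 5 + 6 / 5 * \<rho> ^ 5 / ?V\<^sup>2) - comb_l / 5 * radius \<rho> (int j) ^ 5)"
    by (rule sum_mono[OF site])
  also have "\<dots> = real_of_int a * (6 / 5 * comb_l * \<rho> ^ 5 + 6 / 5 * \<rho> ^ 5 / ?V\<^sup>2)
      - comb_l / 5 * (\<Sum>j<nat a. radius \<rho> (int j) ^ 5)"
    using a by (simp add: sum_subtractf sum_distrib_left)
  also have "\<dots> \<le> real_of_int a * (6 / 5 * comb_l * \<rho> ^ 5 + 6 / 5 * \<rho> ^ 5 / ?V\<^sup>2)
      - comb_l / 5 * (comb_k * (\<rho> ^ 6 - ?V ^ 6) / 6)"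
    using sum_fifth_powers_ge[of "nat a"] a comb_l_pos by (intro diff_left_mono mult_left_mono) auto
  also have "comb_l / 5 * (comb_k * (\<rho> ^ 6 - ?V ^ 6) / 6) = comb_k * comb_l * (\<rho> ^ 6 - ?V ^ 6) / 30" by simp
  also have "\<dots> = (\<rho> ^ 6 - ?V ^ 6) / 40" unfolding comb_k_times_l by simp
  also have "real_of_int a * (6 / 5 * comb_l * \<rho> ^ 5 + 6 / 5 * \<rho> ^ 5 / ?V\<^sup>2) =
      6 / 5 * (comb_k * comb_l) * \<rho> ^ 5 * (\<rho> - ?V) + 6 / 5 * comb_k * (\<rho> - ?V) * \<rho> ^ 5 / ?V\<^sup>2"
    unfolding Veq by (simp only: distrib_left times_divide_eq_right times_divide_eq_left mult_ac)
  also have "6 / 5 * (comb_k * comb_l) * \<rho> ^ 5 * (\<rho> - ?V) = 9 / 10 * \<rho> ^ 5 * (\<rho> - ?V)"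
    unfolding comb_k_times_l by simp
  also have "6 / 5 * comb_k * (\<rho> - ?V) * \<rho> ^ 5 / ?V\<^sup>2 \<le> 6 / 5 * comb_k * \<rho> ^ 6 / ?V\<^sup>2"
  proof -
    have "6 / 5 * comb_k * (\<rho> - ?V) * \<rho> ^ 5 \<le> 6 / 5 * comb_k * \<rho> * \<rho> ^ 5"
      using V comb_k_pos by (intro mult_right_mono mult_left_mono) auto
    also have "\<dots> = 6 / 5 * comb_k * \<rho> ^ 6" by (simp add: eval_nat_numeral)
    finally show ?thesis using V by (intro divide_right_mono) auto
  qed
  finally show ?thesis by simp
qed

lemma pole_tooth_le:
  "axis_profile \<rho> a a * real (tooth_height \<rho> a) \<le> 6 / 5 * \<rho> ^ 5 / (radius \<rho> a)\<^sup>2 * (comb_l * (radius \<rho> a)\<^sup>2 + 1)"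
  using comb_l_pos radius_pole[OF a margin]
  by (intro mult_mono axis_profile_le[OF a margin] height_le add_nonneg_nonneg mult_nonneg_nonneg divide_nonneg_nonneg) auto

lemma axis_profile_sum_le:
  assumes "finite G"
  shows "(\<Sum>x\<in>G. axis_profile \<rho> a x * real (tooth_height \<rho> x)) \<le>
    (\<rho> ^ 6 / 8 + comb_k * \<rho> ^ 4 / 4)
    + (9 / 10 * \<rho> ^ 5 * (\<rho> - radius \<rho> a) - (\<rho> ^ 6 - radius \<rho> a ^ 6) / 40 + 6 / 5 * comb_k * \<rho> ^ 6 / (radius \<rho> a)\<^sup>2)
    + 6 / 5 * \<rho> ^ 5 / (radius \<rho> a)\<^sup>2 * (comb_l * (radius \<rho> a)\<^sup>2 + 1)
    + rise \<rho> (radius \<rho> a) / radius \<rho> a ^ 3 * (radius \<rho> a ^ 6 / 8 + comb_k * radius \<rho> a ^ 4 / 4)"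
proof -
  let ?F = "\<lambda>x. axis_profile \<rho> a x * real (tooth_height \<rho> x)"
  obtain N where N: "\<And>x. x \<in> G \<Longrightarrow> nat \<bar>x\<bar> \<le> N"
    using finite_nat_set_iff_bounded_le[of "(\<lambda>x. nat \<bar>x\<bar>) ` G"] assms by auto
  let ?L = "{- int N..- 1}" and ?M = "{0..<a}" and ?R = "{a + 1..a + int N}"
  have "(\<Sum>x\<in>G. ?F x) \<le> (\<Sum>x\<in>?L \<union> ?M \<union> {a} \<union> ?R. ?F x)"
  proof (rule sum_mono2)
    show "G \<subseteq> ?L \<union> ?M \<union> {a} \<union> ?R" using N a by fastforce
    show "0 \<le> ?F x" for x using axis_profile_nonneg[OF a margin] by simp
  qed auto
  also have "\<dots> = (\<Sum>x\<in>?L. ?F x) + (\<Sum>x\<in>?M. ?F x) + ?F a + (\<Sum>x\<in>?R. ?F x)"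
  proof -
    have "sum ?F (?L \<union> ?M \<union> {a} \<union> ?R) = sum ?F (?L \<union> ?M \<union> {a}) + sum ?F ?R"
      by (rule sum.union_disjoint) (use a in auto)
    also have "sum ?F (?L \<union> ?M \<union> {a}) = sum ?F (?L \<union> ?M) + sum ?F {a}"
      by (rule sum.union_disjoint) (use a in auto)
    also have "sum ?F (?L \<union> ?M) = sum ?F ?L + sum ?F ?M"
      by (rule sum.union_disjoint) auto
    finally show ?thesis by simp
  qed
  also have "(\<Sum>x\<in>?L. ?F x) = (\<Sum>j=1..N. ?F (- int j))"
    by (rule sum.reindex_bij_witness[of _ "\<lambda>j. - int j" "\<lambda>x. nat (- x)"]) auto
  also have "(\<Sum>x\<in>?M. ?F x) = (\<Sum>j<nat a. ?F (int j))"
    by (rule sum.reindex_bij_witness[of _ int nat]) auto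
  also have "(\<Sum>x\<in>?R. ?F x) = (\<Sum>j=1..N. ?F (a + int j))"
    by (rule sum.reindex_bij_witness[of _ "\<lambda>j. a + int j" "\<lambda>x. nat (x - a)"]) auto
  finally show ?thesis
    using left_half_sum_le[of N] between_sum_le pole_tooth_le beyond_pole_sum_le[of N] by linarith
qed

end

text \<open>
  This makes the arm of the pole contribute \<open>3 / 4 * \<rho> ^ 5 * V\<close>, which
  the cancellation in the next lemma requires.
\<close>

lemma comb_l_square: "comb_l\<^sup>2 = comb_k / 4"
proof -
  have "comb_k * comb_l\<^sup>2 = comb_k * comb_l * comb_l" by (simp add: power2_eq_square)
  also have "\<dots> = comb_k * (comb_k / 4)"
    unfolding comb_k_times_l using comb_k_square by (simp add: power2_eq_square)
  finally show ?thesis using comb_k_pos by simp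
qed

text \<open>
  The mean value property. The five main contributions are \<open>\<rho> ^ 6 / 8\<close> from the left half, the terms
  \<open>9 / 10 * \<rho> ^ 5 * (\<rho> - V)\<close> and \<open>- (\<rho> ^ 6 - V ^ 6) / 40\<close> from the teeth between origin and pole,
  \<open>(6 * \<rho> ^ 5 * V - V ^ 6) / 40\<close> from beyond the pole and \<open>3 / 4 * \<rho> ^ 5 * V\<close> from the arm of the pole. All
  occurrences of \<open>V\<close> cancel and \<open>\<rho> ^ 6\<close> remains. Everything else is bounded by a constant times \<open>\<rho> ^ 5\<close>,
  provided that \<open>\<rho> / V\<close> is bounded by a constant \<open>D\<close>.
\<close>

lemma pole_profile_total_le:
  assumes V: "1 \<le> V" "V \<le> \<rho>" and D: "\<rho> \<le> D * V" "0 \<le> D" and b: "0 \<le> b" "b \<le> comb_l * V\<^sup>2"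
    and g: "0 \<le> ga" "ga \<le> 6 / 5 * \<rho> ^ 5 / V\<^sup>2"
  shows "(\<rho> ^ 6 / 8 + comb_k * \<rho> ^ 4 / 4)
    + (9 / 10 * \<rho> ^ 5 * (\<rho> - V) - (\<rho> ^ 6 - V ^ 6) / 40 + 6 / 5 * comb_k * \<rho> ^ 6 / V\<^sup>2)
    + 6 / 5 * \<rho> ^ 5 / V\<^sup>2 * (comb_l * V\<^sup>2 + 1)
    + rise \<rho> V / V ^ 3 * (V ^ 6 / 8 + comb_k * V ^ 4 / 4)
    + ga * b + pole_slope \<rho> V * b\<^sup>2 / 2
    \<le> \<rho> ^ 6 + (comb_k / 4 + 6 / 5 * comb_k * D\<^sup>2 + 6 / 5 * (comb_l + 1) + 3 / 10 * comb_k
        + 6 / 5 * comb_l + comb_l\<^sup>2 / 10 * (3 / comb_k\<^sup>2 + 1 / comb_k ^ 3) + 3 / 5 * comb_l) * \<rho> ^ 5"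
proof -
  note k = comb_k_pos and l = comb_l_pos
  have V0: "0 < V" and \<rho>: "1 \<le> \<rho>" "0 < \<rho>" using V by auto
  have p45: "\<rho> ^ 4 \<le> \<rho> ^ 5" using \<rho> by (intro power_increasing) auto
  have V1: "1 \<le> V\<^sup>2" using V by simp
  have t1: "comb_k * \<rho> ^ 4 / 4 \<le> comb_k / 4 * \<rho> ^ 5" using p45 k by simp
  have t2: "6 / 5 * comb_k * \<rho> ^ 6 / V\<^sup>2 \<le> 6 / 5 * comb_k * D\<^sup>2 * \<rho> ^ 5"
  proof -
    have "\<rho>\<^sup>2 \<le> (D * V)\<^sup>2" using D \<rho> by (intro power_mono) auto
    then have "\<rho> ^ 4 * \<rho>\<^sup>2 \<le> \<rho> ^ 5 * (D * V)\<^sup>2"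
      using p45 \<rho> by (intro mult_mono) auto
    moreover have "\<rho> ^ 6 = \<rho> ^ 4 * \<rho>\<^sup>2" by (simp flip: power_add)
    moreover have "\<rho> ^ 5 * (D * V)\<^sup>2 = D\<^sup>2 * \<rho> ^ 5 * V\<^sup>2" by (simp add: power_mult_distrib)
    ultimately have "\<rho> ^ 6 \<le> D\<^sup>2 * \<rho> ^ 5 * V\<^sup>2" by linarith
    then have "\<rho> ^ 6 / V\<^sup>2 \<le> D\<^sup>2 * \<rho> ^ 5"
      using V0 by (intro mult_imp_div_pos_le) auto
    then have "6 / 5 * comb_k * (\<rho> ^ 6 / V\<^sup>2) \<le> 6 / 5 * comb_k * (D\<^sup>2 * \<rho> ^ 5)"
      using k by (intro mult_left_mono) auto
    then show ?thesis by (simp add: mult.assoc)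
  qed
  have t3: "6 / 5 * \<rho> ^ 5 / V\<^sup>2 * (comb_l * V\<^sup>2 + 1) \<le> 6 / 5 * (comb_l + 1) * \<rho> ^ 5"
  proof -
    have "6 / 5 * \<rho> ^ 5 / V\<^sup>2 * (comb_l * V\<^sup>2 + 1) = 6 / 5 * \<rho> ^ 5 * comb_l + 6 / 5 * \<rho> ^ 5 / V\<^sup>2"
      using V0 by (simp add: field_simps)
    also have "6 / 5 * \<rho> ^ 5 / V\<^sup>2 \<le> 6 / 5 * \<rho> ^ 5"
      using V1 \<rho> V0 by (simp add: pos_divide_le_eq mult_le_cancel_left1)
    also have "6 / 5 * \<rho> ^ 5 * comb_l + 6 / 5 * \<rho> ^ 5 = 6 / 5 * (comb_l + 1) * \<rho> ^ 5" by (simp add: algebra_simps)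
    finally show ?thesis by simp
  qed
  have t4: "rise \<rho> V / V ^ 3 * (V ^ 6 / 8 + comb_k * V ^ 4 / 4) \<le>
      (6 * \<rho> ^ 5 * V - V ^ 6) / 40 + 3 / 10 * comb_k * \<rho> ^ 5"
  proof -
    have "rise \<rho> V / V ^ 3 * (V ^ 6 / 8) = (6 * \<rho> ^ 5 * V - V ^ 6) / 40"
      using V0 by (simp add: rise_def field_simps flip: power_add) (simp add: eval_nat_numeral)
    moreover have "rise \<rho> V / V ^ 3 * (comb_k * V ^ 4 / 4) \<le> 3 / 10 * comb_k * \<rho> ^ 5"
    proof -
      have "rise \<rho> V / V ^ 3 * (comb_k * V ^ 4 / 4) = comb_k / 4 * (rise \<rho> V * V)"
        using V0 by (simp add: field_simps eval_nat_numeral)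
      also have "\<dots> \<le> comb_k / 4 * (6 / 5 * \<rho> ^ 5 / V\<^sup>2 * V)"
        using V0 k by (intro mult_left_mono mult_right_mono rise_upper) auto
      also have "\<dots> = 3 / 10 * comb_k * \<rho> ^ 5 / V" using V0 by (simp add: power2_eq_square)
      also have "\<dots> \<le> 3 / 10 * comb_k * \<rho> ^ 5"
        using V V0 k \<rho> by (simp add: pos_divide_le_eq mult_le_cancel_left1)
      finally show ?thesis .
    qed
    ultimately show ?thesis by (simp only: distrib_left)
  qed
  have t5: "ga * b \<le> 6 / 5 * comb_l * \<rho> ^ 5"
  proof -
    have "ga * b \<le> 6 / 5 * \<rho> ^ 5 / V\<^sup>2 * (comb_l * V\<^sup>2)" using g b by (intro mult_mono) auto
    also have "\<dots> = 6 / 5 * comb_l * \<rho> ^ 5" using V0 by simp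
    finally show ?thesis .
  qed
  have t6: "pole_slope \<rho> V * b\<^sup>2 / 2 \<le> 3 / 4 * \<rho> ^ 5 * V
      + comb_l\<^sup>2 / 10 * (3 / comb_k\<^sup>2 + 1 / comb_k ^ 3) * \<rho> ^ 5 + 3 / 5 * comb_l * \<rho> ^ 5"
  proof -
    have "b\<^sup>2 \<le> (comb_l * V\<^sup>2)\<^sup>2" using b by (intro power_mono) auto
    then have "pole_slope \<rho> V * b\<^sup>2 / 2 \<le> pole_slope \<rho> V * (comb_l * V\<^sup>2)\<^sup>2 / 2"
      using pole_slope_nonneg[OF V0] \<rho> by (intro divide_right_mono mult_left_mono) auto
    also have "(comb_l * V\<^sup>2)\<^sup>2 = comb_l\<^sup>2 * V ^ 4" by (simp add: power_mult_distrib)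
    also have "pole_slope \<rho> V * (comb_l\<^sup>2 * V ^ 4) / 2 =
        3 * (comb_l\<^sup>2 / comb_k) * \<rho> ^ 5 * V
        + comb_l\<^sup>2 / 10 * (3 / comb_k\<^sup>2 * (V * V ^ 4) + 1 / comb_k ^ 3 * V ^ 4) + 3 / 5 * comb_l * \<rho> ^ 5"
    proof -
      have "6 * \<rho> ^ 5 / (comb_k * V ^ 3) * (comb_l\<^sup>2 * V ^ 4) / 2 = 3 * (comb_l\<^sup>2 / comb_k) * \<rho> ^ 5 * V"
        using V0 k by (simp add: field_simps eval_nat_numeral)
      moreover have "(3 * V / comb_k\<^sup>2 + 1 / comb_k ^ 3) / 5 * (comb_l\<^sup>2 * V ^ 4) / 2 =
          comb_l\<^sup>2 / 10 * (3 / comb_k\<^sup>2 * (V * V ^ 4) + 1 / comb_k ^ 3 * V ^ 4)"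
        by (simp add: algebra_simps add_divide_distrib)
      moreover have "6 / 5 * \<rho> ^ 5 / (comb_l * V ^ 4) * (comb_l\<^sup>2 * V ^ 4) / 2 = 3 / 5 * comb_l * \<rho> ^ 5"
        using V0 l by (simp add: field_simps power2_eq_square)
      moreover have "(p + q + r) * t / 2 = p * t / 2 + q * t / 2 + r * t / 2" for p q r t :: real
        by (simp add: distrib_right add_divide_distrib)
      ultimately show ?thesis unfolding pole_slope_def by (simp only:)
    qed
    also have "3 * (comb_l\<^sup>2 / comb_k) * \<rho> ^ 5 * V = 3 / 4 * \<rho> ^ 5 * V"
      using k by (simp add: comb_l_square)
    also have "comb_l\<^sup>2 / 10 * (3 / comb_k\<^sup>2 * (V * V ^ 4) + 1 / comb_k ^ 3 * V ^ 4) \<le>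
        comb_l\<^sup>2 / 10 * (3 / comb_k\<^sup>2 * \<rho> ^ 5 + 1 / comb_k ^ 3 * \<rho> ^ 5)"
    proof -
      have "V ^ 5 \<le> \<rho> ^ 5" "V ^ 4 \<le> \<rho> ^ 4" using V by (auto intro: power_mono)
      then have "V * V ^ 4 \<le> \<rho> ^ 5" "V ^ 4 \<le> \<rho> ^ 5" using p45 by (auto simp flip: power_Suc)
      then show ?thesis using k by (intro mult_left_mono add_mono) auto
    qed
    also have "comb_l\<^sup>2 / 10 * (3 / comb_k\<^sup>2 * \<rho> ^ 5 + 1 / comb_k ^ 3 * \<rho> ^ 5) =
        comb_l\<^sup>2 / 10 * (3 / comb_k\<^sup>2 + 1 / comb_k ^ 3) * \<rho> ^ 5"
      by (simp only: distrib_right mult.assoc)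
    finally show ?thesis by simp
  qed
  have combine: "(r6 / 8 + a1) + (9 / 10 * r5 * (\<rho> - V) - (r6 - v6) / 40 + a2) + a3 + a4 + a5 + a6
      \<le> r6 + (c1 + c2 + c3 + c4 + c5 + c6 + c7) * r5"
    if "a1 \<le> c1 * r5" "a2 \<le> c2 * r5" "a3 \<le> c3 * r5" "a4 \<le> (6 * r5 * V - v6) / 40 + c4 * r5"
      "a5 \<le> c5 * r5" "a6 \<le> 3 / 4 * r5 * V + c6 * r5 + c7 * r5" "r6 = r5 * \<rho>"
    for r6 r5 v6 a1 a2 a3 a4 a5 a6 c1 c2 c3 c4 c5 c6 c7
  proof -
    define p where "p = r5 * V"
    have e1: "9 / 10 * r5 * (\<rho> - V) = 9 / 10 * r6 - 9 / 10 * p"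
      by (simp add: p_def \<open>r6 = r5 * \<rho>\<close> right_diff_distrib)
    have e2: "6 * r5 * V = 6 * p" "3 / 4 * r5 * V = 3 / 4 * p" by (simp_all add: p_def)
    have e3: "(c1 + c2 + c3 + c4 + c5 + c6 + c7) * r5 =
        c1 * r5 + c2 * r5 + c3 * r5 + c4 * r5 + c5 * r5 + c6 * r5 + c7 * r5"
      by (simp only: distrib_right)
    show ?thesis using that(1-6) unfolding e1 e2 e3 by argo
  qed
  show ?thesis
    by (rule combine[OF t1 t2 t3 t4 t5 t6]) (simp add: eval_nat_numeral)
qed

text \<open>
  The climb to the pole raises the potential to order \<open>\<rho> ^ 4\<close>, which exceeds the value \<open>\<rho> ^ 3\<close> at the origin by a
  factor \<open>\<rho>\<close> only. Once the potential is scaled to be at most one, this leaves an exponent of order \<open>n / \<rho>\<close>.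
\<close>

lemma pole_height_le:
  assumes V: "1 \<le> V" "V \<le> \<rho>" and D: "\<rho> \<le> D * V" "0 \<le> D" and b: "0 \<le> b" "b \<le> comb_l * V\<^sup>2"
  shows "6 / 5 * \<rho> ^ 5 / V\<^sup>2 + pole_slope \<rho> V * b \<le>
    (12 / 5 * D\<^sup>2 + 6 * comb_l / comb_k * D + comb_l / 5 * (3 / comb_k\<^sup>2 + 1 / comb_k ^ 3)) * \<rho> ^ 4"
proof -
  note k = comb_k_pos and l = comb_l_pos
  have V0: "0 < V" and \<rho>: "1 \<le> \<rho>" "0 < \<rho>" using V by auto
  have p34: "\<rho> ^ 3 \<le> \<rho> ^ 4" "\<rho>\<^sup>2 \<le> \<rho> ^ 4" using \<rho> by (auto intro: power_increasing)
  have u1: "6 / 5 * \<rho> ^ 5 / V\<^sup>2 \<le> 6 / 5 * D\<^sup>2 * \<rho> ^ 4"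
  proof -
    have "\<rho>\<^sup>2 \<le> (D * V)\<^sup>2" using D \<rho> by (intro power_mono) auto
    then have "\<rho> ^ 3 * \<rho>\<^sup>2 \<le> \<rho> ^ 4 * (D * V)\<^sup>2"
      using p34 \<rho> by (intro mult_mono) auto
    moreover have "\<rho> ^ 5 = \<rho> ^ 3 * \<rho>\<^sup>2" by (simp flip: power_add)
    moreover have "\<rho> ^ 4 * (D * V)\<^sup>2 = D\<^sup>2 * \<rho> ^ 4 * V\<^sup>2" by (simp add: power_mult_distrib)
    ultimately have "\<rho> ^ 5 \<le> D\<^sup>2 * \<rho> ^ 4 * V\<^sup>2" by linarith
    then have "\<rho> ^ 5 / V\<^sup>2 \<le> D\<^sup>2 * \<rho> ^ 4"
      using V0 by (intro mult_imp_div_pos_le) auto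
    then show ?thesis by simp
  qed
  have "pole_slope \<rho> V * b \<le> pole_slope \<rho> V * (comb_l * V\<^sup>2)"
    using pole_slope_nonneg[OF V0] \<rho> b by (intro mult_left_mono) auto
  also have "\<dots> = 6 * comb_l / comb_k * (\<rho> ^ 5 / V)
      + comb_l / 5 * (3 / comb_k\<^sup>2 * (V * V\<^sup>2) + 1 / comb_k ^ 3 * V\<^sup>2) + 6 / 5 * \<rho> ^ 5 / V\<^sup>2"
  proof -
    have "6 * \<rho> ^ 5 / (comb_k * V ^ 3) * (comb_l * V\<^sup>2) = 6 * comb_l / comb_k * (\<rho> ^ 5 / V)"
      using V0 k by (simp add: field_simps eval_nat_numeral)
    moreover have "(3 * V / comb_k\<^sup>2 + 1 / comb_k ^ 3) / 5 * (comb_l * V\<^sup>2) =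
        comb_l / 5 * (3 / comb_k\<^sup>2 * (V * V\<^sup>2) + 1 / comb_k ^ 3 * V\<^sup>2)"
      by (simp add: algebra_simps add_divide_distrib)
    moreover have "6 / 5 * \<rho> ^ 5 / (comb_l * V ^ 4) * (comb_l * V\<^sup>2) = 6 / 5 * \<rho> ^ 5 / V\<^sup>2"
      using V0 l by (simp add: field_simps eval_nat_numeral)
    ultimately show ?thesis
      unfolding pole_slope_def distrib_right by simp
  qed
  also have "6 * comb_l / comb_k * (\<rho> ^ 5 / V) \<le> 6 * comb_l / comb_k * (D * \<rho> ^ 4)"
  proof -
    have "\<rho> ^ 4 * \<rho> \<le> \<rho> ^ 4 * (D * V)" using D \<rho> by (intro mult_left_mono) auto
    then have "\<rho> ^ 5 / V \<le> D * \<rho> ^ 4"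
      using V0 by (simp add: pos_divide_le_eq mult_ac eval_nat_numeral)
    then show ?thesis using k l by (intro mult_left_mono) auto
  qed
  also have "comb_l / 5 * (3 / comb_k\<^sup>2 * (V * V\<^sup>2) + 1 / comb_k ^ 3 * V\<^sup>2) \<le>
      comb_l / 5 * (3 / comb_k\<^sup>2 * \<rho> ^ 4 + 1 / comb_k ^ 3 * \<rho> ^ 4)"
  proof -
    have "V ^ 3 \<le> \<rho> ^ 3" "V\<^sup>2 \<le> \<rho>\<^sup>2" using V by (auto intro: power_mono)
    moreover have "V ^ 3 = V * V\<^sup>2" by (simp add: eval_nat_numeral)
    ultimately have "V * V\<^sup>2 \<le> \<rho> ^ 4" "V\<^sup>2 \<le> \<rho> ^ 4" using p34 by linarith+
    then show ?thesis using k l by (intro mult_left_mono add_mono) auto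
  qed
  finally have u2: "pole_slope \<rho> V * b \<le> 6 * comb_l / comb_k * (D * \<rho> ^ 4)
      + comb_l / 5 * (3 / comb_k\<^sup>2 * \<rho> ^ 4 + 1 / comb_k ^ 3 * \<rho> ^ 4) + 6 / 5 * \<rho> ^ 5 / V\<^sup>2" by simp
  have combine: "w1 + w2 \<le> (12 / 5 * d + c1 * D + c2 * (c3 + c4)) * r"
    if "w1 \<le> 6 / 5 * d * r" "w2 \<le> c1 * (D * r) + c2 * (c3 * r + c4 * r) + w1"
    for w1 w2 d c1 c2 c3 c4 r :: real
    using that by (simp add: algebra_simps)
  show ?thesis by (rule combine[OF u1 u2])
qed

lemma comb_potential_exists:
  assumes D: "0 < D"
  shows "\<exists>C K. 0 < C \<and> 0 < K \<and> (\<forall>\<rho> a b. 0 \<le> a \<longrightarrow> 1 \<le> \<rho> - real_of_int a / comb_k \<longrightarrow>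
    \<rho> \<le> D * (\<rho> - real_of_int a / comb_k) \<longrightarrow>
    1 \<le> b \<longrightarrow> real b \<le> comb_l * (\<rho> - real_of_int a / comb_k)\<^sup>2 \<longrightarrow>
    (\<exists>h. pole_potential (a, int b) (K * \<rho> ^ 4) (\<rho> ^ 6 + C * \<rho> ^ 5) h \<and> h origin = \<rho> ^ 3))"
proof -
  note k = comb_k_pos and l = comb_l_pos
  define C where "C = comb_k / 4 + 6 / 5 * comb_k * D\<^sup>2 + 6 / 5 * (comb_l + 1) + 3 / 10 * comb_k
        + 6 / 5 * comb_l + comb_l\<^sup>2 / 10 * (3 / comb_k\<^sup>2 + 1 / comb_k ^ 3) + 3 / 5 * comb_l"
  define K where "K = 12 / 5 * D\<^sup>2 + 6 * comb_l / comb_k * D + comb_l / 5 * (3 / comb_k\<^sup>2 + 1 / comb_k ^ 3)"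
  have "0 < C" unfolding C_def using k l by (intro add_pos_pos add_pos_nonneg mult_nonneg_nonneg) auto
  moreover have "0 < K" unfolding K_def using k l D by (intro add_pos_pos mult_pos_pos divide_pos_pos) auto
  moreover have "\<exists>h. pole_potential (a, int b) (K * \<rho> ^ 4) (\<rho> ^ 6 + C * \<rho> ^ 5) h \<and> h origin = \<rho> ^ 3"
    if a: "0 \<le> a" and V1: "1 \<le> \<rho> - real_of_int a / comb_k"
      and DV: "\<rho> \<le> D * (\<rho> - real_of_int a / comb_k)"
      and b: "1 \<le> b" "real b \<le> comb_l * (\<rho> - real_of_int a / comb_k)\<^sup>2" for \<rho> a b
  proof -
    have "1 / comb_k \<le> 1" using comb_k_ge_1 by simp
    then have margin: "1 / comb_k \<le> \<rho> - real_of_int a / comb_k" using V1 by simp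
    let ?V = "radius \<rho> a" and ?g = "axis_profile \<rho> a" and ?s = "pole_slope \<rho> (radius \<rho> a)"
    let ?h = "pole_profile ?g (tooth_height \<rho>) a b ?s"
    have Veq: "?V = \<rho> - real_of_int a / comb_k" using a by (intro radius_pos_between[OF a margin]) auto
    have V: "1 \<le> ?V" "?V \<le> \<rho>" "0 < ?V" using V1 radius_pole[OF a margin] Veq by auto
    have s: "0 \<le> ?s" using V by (intro pole_slope_nonneg) auto
    note g = axis_profile_nonneg[OF a margin] and gle = axis_profile_le[OF a margin]
    have "finite {w. ?h w \<noteq> 0}"
      by (rule pole_profile_finite_support[OF axis_profile_support[OF a margin] height_ge_1])
    moreover have "0 \<le> ?h w" for w by (rule pole_profile_nonneg[OF g s])
    moreover have "?h w \<le> K * \<rho> ^ 4" for w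
      using pole_profile_le[where g = ?g, OF g gle s, where H = "tooth_height \<rho>" and a = a and b = b and w = w]
        pole_height_le[of ?V \<rho> D "real b"] V(1,2) D DV b
      unfolding Veq[symmetric] K_def by (meson less_imp_le of_nat_0_le_iff order_trans)
    moreover have "?h origin = \<rho> ^ 3"
      by (simp add: pole_profile_def origin_def axis_profile_origin[OF a margin])
    moreover have "?h w \<le> nbr_mean ?h w" if "w \<noteq> (a, int b)" for w
      by (rule pole_profile_subharmonic[OF g s height_ge_1 b(1) axis_profile_convex[OF a margin]
            axis_profile_kink[OF a margin] that])
    moreover have "sum ?h F \<le> \<rho> ^ 6 + C * \<rho> ^ 5" if "finite F" "(a, int b) \<notin> F" for F
    proof -
      have "sum ?h F \<le> (\<rho> ^ 6 / 8 + comb_k * \<rho> ^ 4 / 4)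
          + (9 / 10 * \<rho> ^ 5 * (\<rho> - ?V) - (\<rho> ^ 6 - ?V ^ 6) / 40 + 6 / 5 * comb_k * \<rho> ^ 6 / ?V\<^sup>2)
          + 6 / 5 * \<rho> ^ 5 / ?V\<^sup>2 * (comb_l * ?V\<^sup>2 + 1)
          + rise \<rho> ?V / ?V ^ 3 * (?V ^ 6 / 8 + comb_k * ?V ^ 4 / 4)
          + ?g a * real b + ?s * (real b)\<^sup>2 / 2"
        by (rule pole_profile_sum_le[OF g s height_ge_1 axis_profile_sum_le[OF a margin] that])
      also have "\<dots> \<le> \<rho> ^ 6 + C * \<rho> ^ 5"
        unfolding C_def
        by (rule pole_profile_total_le) (use V D DV b g gle Veq in auto)
      finally show ?thesis .
    qed
    ultimately show ?thesis by (intro exI[of _ ?h] conjI pole_potentialI)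
  qed
  ultimately show ?thesis by blast
qed

section \<open>Symmetry and the filling of teeth\<close>

text \<open>
  The symmetries of the comb, for signs \<open>s\<close> and \<open>t\<close>; they carry poles in one quadrant to the others.
\<close>

definition reflect :: "int \<Rightarrow> int \<Rightarrow> vertex \<Rightarrow> vertex" where
  "reflect s t w = (s * fst w, t * snd w)"

lemma reflect_involution:
  "\<bar>s\<bar> = 1 \<Longrightarrow> \<bar>t\<bar> = 1 \<Longrightarrow> reflect s t (reflect s t w) = w"
  by (cases w) (auto simp: reflect_def abs_if split: if_splits)

lemma nbr_mean_reflect:
  assumes "\<bar>s\<bar> = 1" "\<bar>t\<bar> = 1"
  shows "nbr_mean (\<lambda>w. h (reflect s t w)) w = nbr_mean h (reflect s t w)"
proof -
  obtain x y where w: "w = (x, y)" by (cases w)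
  have "s = 1 \<or> s = - 1" "t = 1 \<or> t = - 1" using assms by auto
  then show ?thesis
    by (cases "y = 0")
       (auto simp: w reflect_def nbr_mean_axis nbr_mean_off_axis algebra_simps intro!: arg_cong[of _ _ h])
qed

definition tooth_closed :: "vertex set \<Rightarrow> bool" where
  "tooth_closed A \<longleftrightarrow> (\<forall>x y. (0 < y \<longrightarrow> (x, y) \<in> A \<longrightarrow> (x, y - 1) \<in> A) \<and>
     (y < 0 \<longrightarrow> (x, y) \<in> A \<longrightarrow> (x, y + 1) \<in> A))"

text \<open>
  The walk enters a new site of a tooth from one of its two neighbours there. Were it the outer one, that neighbour
  would already be occupied, and then so would be the new site.
\<close>

lemma tooth_closed_step:
  assumes A: "tooth_closed A" "p 0 \<in> A" and adj: "\<And>t. comb_adj (p t) (p (Suc t))"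
  shows "tooth_closed (cluster_step A p)"
proof (cases "\<exists>t. p t \<notin> A")
  case False
  then show ?thesis using A by (simp add: cluster_step_def)
next
  case True
  then obtain T where T: "exit_site A p = p T" "p T \<notin> A" "\<And>s. s < T \<Longrightarrow> p s \<in> A"
    by (rule exit_site_first) blast
  then obtain m where m: "T = Suc m" using A(2) by (cases T) auto
  obtain x y where xy: "p T = (x, y)" by (cases "p T")
  obtain x' y' where xy': "p m = (x', y')" by (cases "p m")
  have mA: "(x', y') \<in> A" using T(3)[of m] m xy' by simp
  have nA: "(x, y) \<notin> A" using T(2) xy by simp
  have adj': "comb_adj (x', y') (x, y)" using adj[of m] m xy xy' by simp
  have "(x, y - 1) \<in> A" if "0 < y"
  proof -
    have "x = x'" "y' = y - 1 \<or> y' = y + 1" using adj' that by auto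
    moreover have "(x, y + 1) \<notin> A"
    proof -
      have "0 < y + 1 \<longrightarrow> (x, y + 1) \<in> A \<longrightarrow> (x, y + 1 - 1) \<in> A"
        using A(1) unfolding tooth_closed_def by blast
      then show ?thesis using nA that by auto
    qed
    ultimately show ?thesis using mA by auto
  qed
  moreover have "(x, y + 1) \<in> A" if "y < 0"
  proof -
    have "x = x'" "y' = y - 1 \<or> y' = y + 1" using adj' that by auto
    moreover have "(x, y - 1) \<notin> A"
    proof -
      have "y - 1 < 0 \<longrightarrow> (x, y - 1) \<in> A \<longrightarrow> (x, y - 1 + 1) \<in> A"
        using A(1) unfolding tooth_closed_def by blast
      then show ?thesis using nA that by auto
    qed
    ultimately show ?thesis using mA by auto
  qed
  moreover have "cluster_step A p = insert (x, y) A" using True T xy by (simp add: cluster_step_def)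
  ultimately show ?thesis using A(1) by (auto simp: tooth_closed_def)
qed

lemma idla_cluster_tooth_closed:
  assumes "\<And>i. i \<ge> 1 \<Longrightarrow> p i 0 = origin" "\<And>i t. i \<ge> 1 \<Longrightarrow> comb_adj (p i t) (p i (Suc t))"
  shows "tooth_closed (idla_cluster p n)"
proof -
  have "tooth_closed (idla_cluster p (Suc n)) \<and> origin \<in> idla_cluster p (Suc n)" for n
  proof (induction n)
    case 0
    show ?case by (simp add: tooth_closed_def origin_def)
  next
    case (Suc n)
    then have "tooth_closed (cluster_step (idla_cluster p (Suc n)) (p (Suc (Suc n))))"
      using assms by (intro tooth_closed_step) auto
    then show ?case using Suc
      by (simp add: idla_cluster_Suc_Suc cluster_step_def del: idla_cluster.simps(3))
  qed
  then show ?thesis by (cases n) (simp_all add: tooth_closed_def del: idla_cluster.simps(3))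
qed

lemma tooth_closed_below_tip:
  assumes A: "tooth_closed A" and up: "(x, int b) \<in> A" and down: "(x, - int b) \<in> A"
    and y: "\<bar>y\<bar> \<le> int b"
  shows "(x, y) \<in> A"
proof -
  have "(x, int b - int j) \<in> A" if "j \<le> b" for j
    using that
  proof (induction j)
    case (Suc j)
    then have "(x, int b - int j) \<in> A" "0 < int b - int j" by auto
    then have "(x, int b - int j - 1) \<in> A" using A unfolding tooth_closed_def by blast
    then show ?case by (simp add: algebra_simps)
  qed (use up in simp)
  from this[of "nat (int b - y)"] have pos: "(x, y) \<in> A" if "0 \<le> y" using y that by simp
  have "(x, - int b + int j) \<in> A" if "j \<le> b" for j
    using that
  proof (induction j)
    case (Suc j)
    then have "(x, - int b + int j) \<in> A" "- int b + int j < 0" by auto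
    then have "(x, - int b + int j + 1) \<in> A" using A unfolding tooth_closed_def by blast
    then show ?case by (simp add: algebra_simps)
  qed (use down in simp)
  from this[of "nat (int b + y)"] have "(x, y) \<in> A" if "y < 0" using y that by simp
  then show ?thesis using pos by (cases "0 \<le> y") auto
qed

context prob_space
begin

text \<open>
  A forbidden step has probability zero after each history. Finite histories are coded as lists so that
  there are countably many of them.
\<close>

lemma srw_adjacent:
  assumes srw: "simple_random_walk comb_adj v M X"
  shows "AE \<omega> in M. \<forall>t. comb_adj (X t \<omega>) (X (Suc t) \<omega>)"
proof -
  note [measurable] = srw_measurable[OF srw]
  have null: "AE \<omega> in M. \<not> ((\<forall>s\<le>t. X s \<omega> = xs ! s) \<and> X (Suc t) \<omega> = w)"
    if "\<not> comb_adj (xs ! t) w" for xs t w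
  proof -
    let ?R = "{\<omega>\<in>space M. (\<forall>s\<le>t. X s \<omega> = xs ! s) \<and> X (Suc t) \<omega> = w}"
    have "pmf (pmf_of_set (neighbours comb_adj (xs ! t))) w = 0"
      using that by (simp add: neighbours_comb_finite_nonempty) (simp add: neighbours_def)
    then have "prob ?R = 0" using srw_prob_step[OF srw, of t "\<lambda>s. xs ! s" w] by simp
    then show ?thesis by (subst (asm) prob_eq_0) (auto elim!: eventually_mono)
  qed
  then have "AE \<omega> in M. \<forall>xs t w. \<not> comb_adj (xs ! t) w \<longrightarrow> \<not> ((\<forall>s\<le>t. X s \<omega> = xs ! s) \<and> X (Suc t) \<omega> = w)"
    unfolding AE_all_countable by auto
  then show ?thesis
  proof eventually_elim
    case (elim \<omega>)
    show ?case
    proof (intro allI, rule ccontr)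
      fix t assume "\<not> comb_adj (X t \<omega>) (X (Suc t) \<omega>)"
      moreover have "\<forall>s\<le>t. X s \<omega> = map (\<lambda>s. X s \<omega>) [0..<Suc t] ! s" by (auto simp del: upt_Suc)
      ultimately show False using elim by (metis order_refl)
    qed
  qed
qed

lemma idla_tooth_closed_AE:
  assumes walks: "\<And>i. i \<ge> 1 \<Longrightarrow> simple_random_walk comb_adj origin M (X i)"
  shows "AE \<omega> in M. \<forall>n. tooth_closed (idla_cluster (\<lambda>i t. X i t \<omega>) n)"
proof -
  have "AE \<omega> in M. \<forall>i. i \<ge> 1 \<longrightarrow> X i 0 \<omega> = origin \<and> (\<forall>t. comb_adj (X i t \<omega>) (X i (Suc t) \<omega>))"
    unfolding AE_all_countable
  proof
    fix i
    show "AE \<omega> in M. i \<ge> 1 \<longrightarrow> X i 0 \<omega> = origin \<and> (\<forall>t. comb_adj (X i t \<omega>) (X i (Suc t) \<omega>))"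
    proof (cases "i \<ge> 1")
      case True
      then have "AE \<omega> in M. X i 0 \<omega> = origin" using walks by (simp add: simple_random_walk_def)
      then show ?thesis using srw_adjacent[OF walks[OF True]] by eventually_elim auto
    qed simp
  qed
  then show ?thesis
  proof eventually_elim
    case (elim \<omega>)
    show ?case by (intro allI idla_cluster_tooth_closed) (use elim in auto)
  qed
qed

end

section \<open>The ends of all teeth\<close>

lemma one_minus_exp_ge:
  fixes \<theta> :: real assumes "0 \<le> \<theta>"
  shows "\<theta> * (1 - \<theta>) \<le> 1 - exp (- \<theta>)"
proof -
  have "exp (- \<theta>) * (1 + \<theta>) \<le> exp (- \<theta>) * exp \<theta>"
    by (intro mult_left_mono exp_ge_add_one_self) auto
  also have "\<dots> = 1" by (simp flip: exp_add)
  also have "1 \<le> (1 - \<theta> + \<theta>\<^sup>2) * (1 + \<theta>)"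
  proof -
    have "(1 - \<theta> + \<theta>\<^sup>2) * (1 + \<theta>) = 1 + \<theta> ^ 3" by algebra
    then show ?thesis using assms by simp
  qed
  finally have "exp (- \<theta>) \<le> 1 - \<theta> + \<theta>\<^sup>2" using assms by (simp add: mult_le_cancel_right)
  then show ?thesis by (simp add: algebra_simps power2_eq_square)
qed

text \<open>
  The exponent of \<open>prob_site_avoided\<close> for the potential divided by its bound \<open>K * \<rho> ^ 4\<close>, with \<open>c\<close> standing for the
  cube root of \<open>n\<close>. The parameter \<open>\<epsilon> / 4\<close> is small enough that \<open>1 - exp (- \<epsilon> / 4)\<close> falls short of
  \<open>\<epsilon> / 4\<close> by a smaller fraction than the fraction \<open>\<epsilon> / 2\<close> by which \<open>\<rho> ^ 3\<close> falls short of \<open>n\<close>.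
\<close>

lemma exponent_le:
  fixes c r C K \<epsilon> :: real
  assumes \<epsilon>: "0 < \<epsilon>" "\<epsilon> < 1" and C: "0 < C" and K: "0 < K"
    and r: "0 < r" "r \<le> 1" "r ^ 3 = 1 - \<epsilon> / 2" and c: "1 \<le> c" "8 * (C + 1) / \<epsilon> \<le> c"
    and \<rho>: "\<rho> = r * c"
  shows "\<epsilon> / 4 * ((\<rho> ^ 6 + C * \<rho> ^ 5) / (K * \<rho> ^ 4)) - (1 - exp (- (\<epsilon> / 4))) * (\<rho> ^ 3 / (K * \<rho> ^ 4)) * (c ^ 3 - 1)
    \<le> - (\<epsilon>\<^sup>2 / (32 * K) * c\<^sup>2)"
proof -
  let ?\<theta> = "\<epsilon> / 4"
  have \<rho>0: "0 < \<rho>" "\<rho> \<le> c" using r c \<rho> by (auto simp: mult_le_cancel_right1)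
  have c3: "0 \<le> c ^ 3 - 1" using c by simp
  have cube: "\<rho> ^ 3 = (1 - \<epsilon> / 2) * c ^ 3" using \<rho> r by (simp add: power_mult_distrib)
  have big: "(C + 1) * c\<^sup>2 \<le> \<epsilon> / 8 * c ^ 3"
  proof -
    have "C + 1 \<le> \<epsilon> / 8 * c" using c \<epsilon> by (simp add: field_simps)
    then have "(C + 1) * c\<^sup>2 \<le> \<epsilon> / 8 * c * c\<^sup>2" by (intro mult_right_mono) auto
    then show ?thesis by (simp add: power2_eq_square power3_eq_cube)
  qed
  have "?\<theta> * (1 - ?\<theta>) * (c ^ 3 - 1) \<le> (1 - exp (- ?\<theta>)) * (c ^ 3 - 1)"
    using \<epsilon> c3 by (intro mult_right_mono one_minus_exp_ge) auto
  moreover have "?\<theta> * (1 - ?\<theta>) * (c ^ 3 - 1) = ?\<theta> * (c ^ 3 - ?\<theta> * c ^ 3 - 1 + ?\<theta>)"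
  proof -
    have "q * (1 - q) * (m - 1) = q * (m - q * m - 1 + q)" for q m :: real by (simp add: algebra_simps)
    then show ?thesis .
  qed
  ultimately have "?\<theta> * (\<rho> ^ 3 + C * \<rho>\<^sup>2) - (1 - exp (- ?\<theta>)) * (c ^ 3 - 1)
      \<le> ?\<theta> * ((\<rho> ^ 3 + C * \<rho>\<^sup>2) - (c ^ 3 - ?\<theta> * c ^ 3 - 1 + ?\<theta>))"
    unfolding right_diff_distrib[of ?\<theta> "\<rho> ^ 3 + C * \<rho>\<^sup>2"] by linarith
  also have "\<dots> \<le> ?\<theta> * (- (\<epsilon> / 8 * c ^ 3))"
  proof (rule mult_left_mono)
    have "C * \<rho>\<^sup>2 \<le> C * c\<^sup>2" using \<rho>0 C by (intro mult_left_mono power_mono) auto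
    moreover have "1 \<le> c\<^sup>2" using c by simp
    ultimately have "C * \<rho>\<^sup>2 + 1 \<le> \<epsilon> / 8 * c ^ 3" using big by (simp add: algebra_simps)
    then show "(\<rho> ^ 3 + C * \<rho>\<^sup>2) - (c ^ 3 - ?\<theta> * c ^ 3 - 1 + ?\<theta>) \<le> - (\<epsilon> / 8 * c ^ 3)"
      unfolding cube using \<epsilon> by (simp add: algebra_simps)
  qed (use \<epsilon> in simp)
  finally have num: "?\<theta> * (\<rho> ^ 3 + C * \<rho>\<^sup>2) - (1 - exp (- ?\<theta>)) * (c ^ 3 - 1) \<le> - (\<epsilon>\<^sup>2 / 32 * c ^ 3)"
    by (simp add: power2_eq_square)
  have "?\<theta> * ((\<rho> ^ 6 + C * \<rho> ^ 5) / (K * \<rho> ^ 4)) - (1 - exp (- ?\<theta>)) * (\<rho> ^ 3 / (K * \<rho> ^ 4)) * (c ^ 3 - 1)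
      = (?\<theta> * (\<rho> ^ 3 + C * \<rho>\<^sup>2) - (1 - exp (- ?\<theta>)) * (c ^ 3 - 1)) / (K * \<rho>)"
  proof -
    have "(\<rho> ^ 6 + C * \<rho> ^ 5) / (K * \<rho> ^ 4) = (\<rho> ^ 3 + C * \<rho>\<^sup>2) / (K * \<rho>)"
      using \<rho>0 K by (simp add: field_simps eval_nat_numeral)
    moreover have "\<rho> ^ 3 / (K * \<rho> ^ 4) = 1 / (K * \<rho>)"
      using \<rho>0 K by (simp add: field_simps eval_nat_numeral)
    moreover have "p * (u / d) - q * (1 / d) * m = (p * u - q * m) / d" for p u d q m :: real
      by (simp add: diff_divide_distrib)
    ultimately show ?thesis by (simp only:)
  qed
  also have "\<dots> \<le> - (\<epsilon>\<^sup>2 / 32 * c ^ 3) / (K * \<rho>)"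
    using \<rho>0 K by (intro divide_right_mono num) auto
  also have "\<dots> \<le> - (\<epsilon>\<^sup>2 / 32 * c ^ 3 / (K * c))"
  proof -
    have "\<epsilon>\<^sup>2 / 32 * c ^ 3 / (K * c) \<le> \<epsilon>\<^sup>2 / 32 * c ^ 3 / (K * \<rho>)"
      using \<rho>0 K c by (intro divide_left_mono mult_left_mono mult_pos_pos) auto
    then show ?thesis by simp
  qed
  also have "\<epsilon>\<^sup>2 / 32 * c ^ 3 / (K * c) = \<epsilon>\<^sup>2 / (32 * K) * c\<^sup>2"
    using c K by (simp add: field_simps eval_nat_numeral)
  finally show ?thesis .
qed

lemma eventually_root_ge: "\<forall>\<^sub>F n in sequentially. B \<le> root 3 (real n)"
  using eventually_ge_at_top[of "nat \<lceil>B ^ 3\<rceil>"]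
proof eventually_elim
  case (elim n)
  then have "B ^ 3 \<le> real n" by linarith
  then have "root 3 (B ^ 3) \<le> root 3 (real n)" by (intro real_root_le_mono) auto
  then show ?case by (simp add: odd_real_root_power_cancel)
qed

text \<open>
  The last site inside the ball with parameter \<open>n * (1 - \<epsilon> / 2)\<close>, which lies strictly between the ball to be covered and the
  ball with parameter \<open>n\<close>. The first gap makes every tooth of the smaller ball long, the second one leaves
  the surplus of particles that the moment bound needs.
\<close>

definition tip :: "real \<Rightarrow> nat \<Rightarrow> int \<Rightarrow> nat" where
  "tip \<epsilon> n x = nat \<lfloor>comb_l * (root 3 (real n * (1 - \<epsilon> / 2)) - \<bar>real_of_int x\<bar> / comb_k)\<^sup>2\<rfloor>"

lemma tip_covers_ball:
  assumes "(x, y) \<in> comb_ball (real n * (1 - \<epsilon>))" "0 \<le> \<epsilon>"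
  shows "\<bar>real_of_int x\<bar> \<le> comb_k * root 3 (real n * (1 - \<epsilon>))" "\<bar>y\<bar> \<le> int (tip \<epsilon> n x)"
proof -
  let ?r = "root 3 (real n * (1 - \<epsilon>))" and ?\<rho> = "root 3 (real n * (1 - \<epsilon> / 2))"
  let ?d = "\<bar>real_of_int x\<bar> / comb_k"
  have ball: "?d + sqrt (\<bar>real_of_int y\<bar> / comb_l) \<le> ?r" using assms by (simp add: comb_ball_def)
  have sq: "0 \<le> sqrt (\<bar>real_of_int y\<bar> / comb_l)" using comb_l_pos by simp
  have "?d \<le> ?r" using ball sq by linarith
  then show "\<bar>real_of_int x\<bar> \<le> comb_k * ?r" using comb_k_pos by (simp add: field_simps)
  have "real n * (1 - \<epsilon>) \<le> real n * (1 - \<epsilon> / 2)" using assms by (intro mult_left_mono) auto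
  then have "?r \<le> ?\<rho>" by (intro real_root_le_mono) auto
  then have "sqrt (\<bar>real_of_int y\<bar> / comb_l) \<le> ?\<rho> - ?d" using ball by linarith
  then have "(sqrt (\<bar>real_of_int y\<bar> / comb_l))\<^sup>2 \<le> (?\<rho> - ?d)\<^sup>2" using sq by (intro power_mono) auto
  then have "\<bar>real_of_int y\<bar> / comb_l \<le> (?\<rho> - ?d)\<^sup>2" using comb_l_pos by simp
  then have "\<bar>real_of_int y\<bar> \<le> comb_l * (?\<rho> - ?d)\<^sup>2" using comb_l_pos by (simp add: field_simps)
  then have "\<bar>y\<bar> \<le> \<lfloor>comb_l * (?\<rho> - ?d)\<^sup>2\<rfloor>" by (simp add: le_floor_iff)
  moreover from this have "0 \<le> \<lfloor>comb_l * (?\<rho> - ?d)\<^sup>2\<rfloor>" by (rule order_trans[OF abs_ge_zero])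
  ultimately show "\<bar>y\<bar> \<le> int (tip \<epsilon> n x)" unfolding tip_def by (simp only: nat_0_le)
qed

context prob_space
begin

text \<open>
  The bound for a reflected site, from the potential transported by the symmetry and divided by \<open>B\<close>.
\<close>

lemma prob_site_missing_le_potential:
  assumes walks: "\<And>i. i \<ge> 1 \<Longrightarrow> simple_random_walk comb_adj origin M (X i)"
    and indep: "independent_walks M {1..} X" and "\<theta> \<ge> 0" and "n \<ge> 1" and st: "\<bar>s\<bar> = 1" "\<bar>t\<bar> = 1"
    and pot: "pole_potential z B S h" and B: "0 < B"
  shows "prob {\<omega>\<in>space M. reflect s t z \<notin> idla_cluster (\<lambda>i t. X i t \<omega>) n}
      \<le> exp (\<theta> * (S / B) - (1 - exp (- \<theta>)) * (h origin / B) * (real n - 1))"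
proof -
  let ?h = "\<lambda>w. h (reflect s t w) / B"
  note fin = pole_potentialD(1)[OF pot] and h = pole_potentialD(2,3)[OF pot]
    and sub = pole_potentialD(4)[OF pot] and S = pole_potentialD(5)[OF pot]
  have inv: "reflect s t (reflect s t w) = w" for w by (rule reflect_involution[OF st])
  have inj: "inj_on (reflect s t) F" for F by (rule inj_on_inverseI[of _ "reflect s t"]) (rule inv)
  have "finite {w. ?h w \<noteq> 0}"
    by (rule finite_subset[OF _ finite_imageI[OF fin, of "reflect s t"]])
       (use inv in \<open>force intro: rev_image_eqI[of "reflect s t _"]\<close>)
  moreover have "0 \<le> ?h w" "?h w \<le> 1" for w using h[of "reflect s t w"] B by auto
  moreover have "?h w \<le> nbr_mean ?h w" if "w \<noteq> reflect s t z" for w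
  proof -
    have "nbr_mean ?h w = nbr_mean (\<lambda>w. h (reflect s t w)) w / B"
      by (simp add: nbr_mean_def flip: sum_divide_distrib)
    also have "\<dots> = nbr_mean h (reflect s t w) / B" by (simp only: nbr_mean_reflect[OF st])
    finally show ?thesis using sub[of "reflect s t w"] inv that B by (metis divide_right_mono less_imp_le)
  qed
  moreover have "sum ?h F \<le> S / B" if "finite F" "reflect s t z \<notin> F" for F
  proof -
    have "sum ?h F = sum h (reflect s t ` F) / B"
      by (simp add: sum.reindex[OF inj] flip: sum_divide_distrib)
    moreover have "z \<notin> reflect s t ` F" using that inv by (metis imageE)
    ultimately show ?thesis using S[of "reflect s t ` F"] that B by (simp add: divide_right_mono)
  qed
  ultimately have "pole_potential (reflect s t z) 1 (S / B) ?h" by (intro pole_potentialI)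
  then have "prob {\<omega>\<in>space M. reflect s t z \<notin> idla_cluster (\<lambda>i t. X i t \<omega>) n}
      \<le> exp (\<theta> * (S / B) - (1 - exp (- \<theta>)) * ?h origin * (real n - 1))"
    by (intro prob_site_avoided[OF walks indep \<open>\<theta> \<ge> 0\<close> \<open>n \<ge> 1\<close>])
  then show ?thesis by (simp add: reflect_def origin_def)
qed

text \<open>
  The constant \<open>D\<close> bounds \<open>\<rho> / V\<close> since, for a tooth of the smaller ball, \<open>V\<close> is at least the difference of
  the cube roots of the two parameters, a fixed fraction of \<open>\<rho>\<close>.
\<close>

lemma prob_tip_missing_le:
  assumes walks: "\<And>i. i \<ge> 1 \<Longrightarrow> simple_random_walk comb_adj origin M (X i)"
    and indep: "independent_walks M {1..} X" and \<epsilon>: "0 < \<epsilon>" "\<epsilon> < 1"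
  shows "\<exists>\<gamma>>0. \<forall>\<^sub>F n in sequentially. \<forall>x t. \<bar>real_of_int x\<bar> \<le> comb_k * root 3 (real n * (1 - \<epsilon>)) \<longrightarrow> \<bar>t\<bar> = 1 \<longrightarrow>
    prob {\<omega>\<in>space M. (x, t * int (tip \<epsilon> n x)) \<notin> idla_cluster (\<lambda>i t. X i t \<omega>) n} \<le> exp (- (\<gamma> * (root 3 (real n))\<^sup>2))"
proof -
  define r1 where "r1 = root 3 (1 - \<epsilon>)"
  define r2 where "r2 = root 3 (1 - \<epsilon> / 2)"
  have r: "r1 < r2" "0 < r2" "r2 \<le> 1" "r2 ^ 3 = 1 - \<epsilon> / 2"
    using \<epsilon> real_root_le_mono[of 3 "1 - \<epsilon> / 2" 1] by (auto simp: r1_def r2_def)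
  define D where "D = r2 / (r2 - r1)"
  have D: "0 < D" using r by (simp add: D_def)
  obtain C K where CK: "0 < C" "0 < K" and pot: "\<And>\<rho> a b. 0 \<le> a \<Longrightarrow> 1 \<le> \<rho> - real_of_int a / comb_k \<Longrightarrow>
    \<rho> \<le> D * (\<rho> - real_of_int a / comb_k) \<Longrightarrow>
    1 \<le> b \<Longrightarrow> real b \<le> comb_l * (\<rho> - real_of_int a / comb_k)\<^sup>2 \<Longrightarrow>
    (\<exists>h. pole_potential (a, int b) (K * \<rho> ^ 4) (\<rho> ^ 6 + C * \<rho> ^ 5) h \<and> h origin = \<rho> ^ 3)"
    using comb_potential_exists[OF D] by blast
  let ?\<gamma> = "\<epsilon>\<^sup>2 / (32 * K)"
  show ?thesis
  proof (intro exI[of _ ?\<gamma>] conjI)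
    show "0 < ?\<gamma>" using \<epsilon> CK by simp
    \<comment> \<open>The second bound makes \<open>\<epsilon> * n / 8\<close> exceed the lower order terms; the third makes the tooth at least one site long.\<close>
    let ?B = "max (max 1 (8 * (C + 1) / \<epsilon>)) ((1 / comb_l + 1) / (r2 - r1))"
    show "\<forall>\<^sub>F n in sequentially. \<forall>x t. \<bar>real_of_int x\<bar> \<le> comb_k * root 3 (real n * (1 - \<epsilon>)) \<longrightarrow> \<bar>t\<bar> = 1 \<longrightarrow>
      prob {\<omega>\<in>space M. (x, t * int (tip \<epsilon> n x)) \<notin> idla_cluster (\<lambda>i t. X i t \<omega>) n} \<le> exp (- (?\<gamma> * (root 3 (real n))\<^sup>2))"
      using eventually_root_ge[of ?B]
    proof eventually_elim
      case (elim n)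
      define c where "c = root 3 (real n)"
      define \<rho> where "\<rho> = r2 * c"
      have c: "1 \<le> c" "8 * (C + 1) / \<epsilon> \<le> c" "(1 / comb_l + 1) / (r2 - r1) \<le> c" using elim by (auto simp: c_def)
      have c3: "c ^ 3 = real n" by (simp add: c_def)
      have n: "1 \<le> n" using c(1) by (cases n) (auto simp: c_def)
      have gap: "1 / comb_l + 1 \<le> (r2 - r1) * c" using c(3) r by (simp add: field_simps)
      have r1c: "root 3 (real n * (1 - \<epsilon>)) = r1 * c" and \<rho>n: "root 3 (real n * (1 - \<epsilon> / 2)) = \<rho>"
        by (simp_all add: r1_def r2_def c_def \<rho>_def real_root_mult)
      show ?case
      proof (intro allI impI)
        fix x t :: int assume x: "\<bar>real_of_int x\<bar> \<le> comb_k * root 3 (real n * (1 - \<epsilon>))" and t: "\<bar>t\<bar> = 1"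
        let ?V = "\<rho> - real_of_int \<bar>x\<bar> / comb_k"
        let ?b = "tip \<epsilon> n x"
        have "real_of_int \<bar>x\<bar> / comb_k \<le> r1 * c"
          using x comb_k_pos unfolding r1c by (simp add: field_simps)
        then have V: "(r2 - r1) * c \<le> ?V" by (simp add: \<rho>_def algebra_simps)
        have V1: "1 \<le> ?V" "1 / comb_l \<le> ?V" using V gap comb_l_pos by (smt (verit) divide_pos_pos)+
        have DV: "\<rho> \<le> D * ?V"
        proof -
          have "\<rho> = D * ((r2 - r1) * c)" using r by (simp add: D_def \<rho>_def)
          also have "\<dots> \<le> D * ?V" using D V by (intro mult_left_mono) auto
          finally show ?thesis .
        qed
        have one: "1 \<le> comb_l * ?V\<^sup>2"
        proof -
          have "1 \<le> comb_l * ?V" using V1 comb_l_pos by (simp add: field_simps)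
          also have "\<dots> \<le> comb_l * ?V * ?V"
            using mult_left_mono[of 1 ?V "comb_l * ?V"] V1 comb_l_pos by simp
          finally show ?thesis by (simp add: power2_eq_square mult.assoc)
        qed
        have tip: "?b = nat \<lfloor>comb_l * ?V\<^sup>2\<rfloor>" by (simp add: tip_def \<rho>n)
        have b: "1 \<le> ?b" "real ?b \<le> comb_l * ?V\<^sup>2" unfolding tip using one by linarith+
        obtain h where h: "pole_potential (\<bar>x\<bar>, int ?b) (K * \<rho> ^ 4) (\<rho> ^ 6 + C * \<rho> ^ 5) h" "h origin = \<rho> ^ 3"
          using pot[OF abs_ge_zero V1(1) DV b] by blast
        define s :: int where "s = (if x < 0 then - 1 else 1)"
        have s: "\<bar>s\<bar> = 1" "s * \<bar>x\<bar> = x" by (auto simp: s_def)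
        have \<rho>0: "0 < \<rho>" using r c by (simp add: \<rho>_def)
        have "prob {\<omega>\<in>space M. reflect s t (\<bar>x\<bar>, int ?b) \<notin> idla_cluster (\<lambda>i t. X i t \<omega>) n}
          \<le> exp (\<epsilon> / 4 * ((\<rho> ^ 6 + C * \<rho> ^ 5) / (K * \<rho> ^ 4))
              - (1 - exp (- (\<epsilon> / 4))) * (h origin / (K * \<rho> ^ 4)) * (real n - 1))"
          by (rule prob_site_missing_le_potential[OF walks indep _ n s(1) t h(1)])
             (use \<epsilon> CK \<rho>0 in auto)
        also have "reflect s t (\<bar>x\<bar>, int ?b) = (x, t * int ?b)" by (simp add: reflect_def s)
        also have "exp (\<epsilon> / 4 * ((\<rho> ^ 6 + C * \<rho> ^ 5) / (K * \<rho> ^ 4))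
              - (1 - exp (- (\<epsilon> / 4))) * (h origin / (K * \<rho> ^ 4)) * (real n - 1)) \<le> exp (- (?\<gamma> * c\<^sup>2))"
          unfolding h(2) c3[symmetric] exp_le_cancel_iff
          by (rule exponent_le[OF \<epsilon> CK r(2,3,4) c(1,2) \<rho>_def])
        finally show "prob {\<omega>\<in>space M. (x, t * int ?b) \<notin> idla_cluster (\<lambda>i t. X i t \<omega>) n}
            \<le> exp (- (?\<gamma> * (root 3 (real n))\<^sup>2))" by (simp add: c_def)
      qed
    qed
  qed
qed

end

lemma summable_exp_root:
  assumes "0 < \<gamma>"
  shows "summable (\<lambda>n. (4 * comb_k * root 3 (real n) + 2) * exp (- (\<gamma> * (root 3 (real n))\<^sup>2)))"
proof (rule summable_comparison_test_ev)
  let ?C = "(4 * comb_k + 2) * (6 / \<gamma>) ^ 6"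
  show "summable (\<lambda>n. ?C * (1 / real n ^ 2))"
    unfolding inverse_eq_divide[symmetric] by (rule summable_mult, rule inverse_power_summable) simp
  show "\<forall>\<^sub>F n in sequentially. norm ((4 * comb_k * root 3 (real n) + 2) * exp (- (\<gamma> * (root 3 (real n))\<^sup>2)))
      \<le> ?C * (1 / real n ^ 2)"
    using eventually_gt_at_top[of 0]
  proof eventually_elim
    case (elim n)
    define c where "c = root 3 (real n)"
    have c: "1 \<le> c" using elim by (simp add: c_def)
    have c3: "c ^ 3 = real n" by (simp add: c_def)
    \<comment> \<open>The sixth power leaves enough decay to absorb the linear factor and still be summable.\<close>
    have "(\<gamma> * c\<^sup>2 / 6) ^ 6 \<le> exp (\<gamma> * c\<^sup>2 / 6) ^ 6"
    proof (rule power_mono)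
      have "u \<le> exp u" for u :: real using exp_ge_add_one_self[of u] by linarith
      then show "\<gamma> * c\<^sup>2 / 6 \<le> exp (\<gamma> * c\<^sup>2 / 6)" .
    qed (use assms in simp)
    also have "\<dots> = exp (\<gamma> * c\<^sup>2)" by (simp flip: exp_of_nat_mult)
    finally have "exp (- (\<gamma> * c\<^sup>2)) \<le> 1 / (\<gamma> * c\<^sup>2 / 6) ^ 6"
      unfolding exp_minus inverse_eq_divide using assms c by (intro divide_left_mono mult_pos_pos) auto
    also have "\<dots> = (6 / \<gamma>) ^ 6 / (c\<^sup>2) ^ 6"
      using assms by (simp add: power_divide power_mult_distrib)
    finally have e: "exp (- (\<gamma> * c\<^sup>2)) \<le> (6 / \<gamma>) ^ 6 / (c\<^sup>2) ^ 6" .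
    have "(4 * comb_k * c + 2) * exp (- (\<gamma> * c\<^sup>2)) \<le> ((4 * comb_k + 2) * c) * ((6 / \<gamma>) ^ 6 / (c\<^sup>2) ^ 6)"
      using c comb_k_pos by (intro mult_mono e) (auto simp: algebra_simps)
    also have "\<dots> = ?C * (c / (c\<^sup>2) ^ 6)" by simp
    finally have le: "(4 * comb_k * c + 2) * exp (- (\<gamma> * c\<^sup>2)) \<le> ?C * (c / (c\<^sup>2) ^ 6)" .
    have "c / (c\<^sup>2) ^ 6 \<le> 1 / c ^ 6"
    proof -
      have "c * c ^ 6 = c ^ 7" by (simp flip: power_Suc)
      also have "\<dots> \<le> c ^ 12" using c by (intro power_increasing) auto
      finally show ?thesis using c by (simp add: field_simps flip: power_mult)
    qed
    then have "?C * (c / (c\<^sup>2) ^ 6) \<le> ?C * (1 / c ^ 6)"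
      using comb_k_pos assms by (intro mult_left_mono) auto
    moreover have "c ^ 6 = real n ^ 2" by (simp flip: c3 power_mult)
    ultimately have "(4 * comb_k * c + 2) * exp (- (\<gamma> * c\<^sup>2)) \<le> ?C * (1 / real n ^ 2)" using le by simp
    moreover have "0 \<le> (4 * comb_k * c + 2) * exp (- (\<gamma> * c\<^sup>2))" using c comb_k_pos by simp
    ultimately show ?case by (simp add: c_def)
  qed
qed

lemma comb_ball_mono: "r \<le> r' \<Longrightarrow> comb_ball r \<subseteq> comb_ball r'"
  unfolding comb_ball_def by (auto intro: order_trans[OF _ real_root_le_mono])

context prob_space
begin

text \<open>
  Borel-Cantelli, with a union bound over the \<open>O(root 3 n)\<close> ends of teeth at time \<open>n\<close>.
\<close>

lemma idla_tips_eventually_occupied: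
  assumes walks: "\<And>i. i \<ge> 1 \<Longrightarrow> simple_random_walk comb_adj origin M (X i)"
    and indep: "independent_walks M {1..} X" and \<epsilon>: "0 < \<epsilon>" "\<epsilon> < 1"
  shows "AE \<omega> in M. \<forall>\<^sub>F n in sequentially. \<forall>x t. \<bar>real_of_int x\<bar> \<le> comb_k * root 3 (real n * (1 - \<epsilon>)) \<longrightarrow> \<bar>t\<bar> = 1 \<longrightarrow>
    (x, t * int (tip \<epsilon> n x)) \<in> idla_cluster (\<lambda>i t. X i t \<omega>) n"
proof -
  let ?R = "\<lambda>n. comb_k * root 3 (real n * (1 - \<epsilon>))"
  let ?miss = "\<lambda>n x t. {\<omega>\<in>space M. (x, t * int (tip \<epsilon> n x)) \<notin> idla_cluster (\<lambda>i t. X i t \<omega>) n}"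
  let ?I = "\<lambda>n. {- \<lfloor>?R n\<rfloor>..\<lfloor>?R n\<rfloor>} \<times> {- 1, 1 :: int}"
  let ?Bad = "\<lambda>n. \<Union>(x, t)\<in>?I n. ?miss n x t"
  have R: "0 \<le> ?R n" for n using comb_k_pos \<epsilon> by simp
  have I: "(x, t) \<in> ?I n \<longleftrightarrow> \<bar>real_of_int x\<bar> \<le> ?R n \<and> \<bar>t\<bar> = 1" for n x t
  proof -
    have "x \<in> {- \<lfloor>?R n\<rfloor>..\<lfloor>?R n\<rfloor>} \<longleftrightarrow> \<bar>x\<bar> \<le> \<lfloor>?R n\<rfloor>" by auto
    also have "\<dots> \<longleftrightarrow> \<bar>real_of_int x\<bar> \<le> ?R n" by (simp add: le_floor_iff)
    finally show ?thesis by (auto simp: abs_if split: if_splits)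
  qed
  have miss: "?miss n x t \<in> events" for n x t by (rule site_missing_event[OF walks])
  then have Bad: "?Bad n \<in> events" for n by (intro sets.finite_UN) auto
  obtain \<gamma> where \<gamma>: "0 < \<gamma>" and bound: "\<forall>\<^sub>F n in sequentially. \<forall>x t. \<bar>real_of_int x\<bar> \<le> ?R n \<longrightarrow> \<bar>t\<bar> = 1 \<longrightarrow>
      prob (?miss n x t) \<le> exp (- (\<gamma> * (root 3 (real n))\<^sup>2))"
    using prob_tip_missing_le[OF walks indep \<epsilon>] by blast
  have "\<forall>\<^sub>F n in sequentially. norm (prob (?Bad n)) \<le>
      (4 * comb_k * root 3 (real n) + 2) * exp (- (\<gamma> * (root 3 (real n))\<^sup>2))"
    using bound
  proof eventually_elim
    case (elim n)
    let ?e = "exp (- (\<gamma> * (root 3 (real n))\<^sup>2))"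
    have "prob (?Bad n) \<le> (\<Sum>(x, t)\<in>?I n. prob (?miss n x t))"
      using measure_UNION_le[of "?I n" "\<lambda>(x, t). ?miss n x t" M] miss by (auto simp: case_prod_unfold)
    also have "\<dots> \<le> (\<Sum>_\<in>?I n. ?e)"
    proof (rule sum_mono)
      fix p assume "p \<in> ?I n"
      then show "(case p of (x, t) \<Rightarrow> prob (?miss n x t)) \<le> ?e"
        using elim I[of "fst p" "snd p" n] by (cases p) auto
    qed
    also have "\<dots> = real (card (?I n)) * ?e" by simp
    also have "real (card (?I n)) \<le> 4 * comb_k * root 3 (real n) + 2"
    proof -
      have f: "0 \<le> \<lfloor>?R n\<rfloor>" using R by simp
      then have "real (card (?I n)) = (2 * real_of_int \<lfloor>?R n\<rfloor> + 1) * 2"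
        by (simp add: card_cartesian_product)
      also have "\<dots> \<le> 4 * ?R n + 2" using of_int_floor_le[of "?R n"] by argo
      also have "?R n \<le> comb_k * root 3 (real n)"
      proof -
        have "real n * (1 - \<epsilon>) \<le> real n" using \<epsilon> by (simp add: mult_le_cancel_left2)
        then show ?thesis using comb_k_pos by (intro mult_left_mono real_root_le_mono) auto
      qed
      finally show ?thesis by simp
    qed
    finally show ?case by (simp add: mult_right_mono)
  qed
  then have "summable (\<lambda>n. prob (?Bad n))"
    by (rule summable_comparison_test_ev[OF _ summable_exp_root[OF \<gamma>]])
  then have "AE \<omega> in M. \<forall>\<^sub>F n in sequentially. \<omega> \<in> space M - ?Bad n"
    by (intro borel_cantelli_AE1 Bad) (auto simp: emeasure_eq_measure)
  then show ?thesis
  proof eventually_elim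
    case (elim \<omega>)
    then show ?case
    proof eventually_elim
      case (elim n)
      show ?case
      proof (intro allI impI)
        fix x t :: int assume "\<bar>real_of_int x\<bar> \<le> ?R n" "\<bar>t\<bar> = 1"
        then have "(x, t) \<in> ?I n" using I by blast
        then show "(x, t * int (tip \<epsilon> n x)) \<in> idla_cluster (\<lambda>i t. X i t \<omega>) n" using elim by blast
      qed
    qed
  qed
qed

end

theorem theorem4p2:
  fixes M :: "'a measure"
    and X :: "nat \<Rightarrow> nat \<Rightarrow> 'a \<Rightarrow> vertex"
    and \<epsilon> :: real
  assumes "prob_space M"
    and "\<And>i. i \<ge> 1 \<Longrightarrow> simple_random_walk comb_adj origin M (X i)"
    and "independent_walks M {1..} X"
    and "\<epsilon> > 0"
  shows "AE \<omega> in M. \<forall>\<^sub>F n in sequentially.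
           comb_ball (real n * (1 - \<epsilon>)) \<subseteq> idla_cluster (\<lambda>i t. X i t \<omega>) n"
proof -
  interpret prob_space M by (rule assms(1))
  let ?A = "\<lambda>\<omega> n. idla_cluster (\<lambda>i t. X i t \<omega>) n"
  \<comment> \<open>Balls grow as \<open>\<epsilon>\<close> decreases, so a value below one can be substituted for a larger one.\<close>
  define \<delta> where "\<delta> = min \<epsilon> (1 / 2)"
  have \<delta>: "0 < \<delta>" "\<delta> < 1" "\<delta> \<le> \<epsilon>" using assms(4) by (auto simp: \<delta>_def)
  have "AE \<omega> in M. \<forall>\<^sub>F n in sequentially. \<forall>x t. \<bar>real_of_int x\<bar> \<le> comb_k * root 3 (real n * (1 - \<delta>)) \<longrightarrow> \<bar>t\<bar> = 1 \<longrightarrow>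
      (x, t * int (tip \<delta> n x)) \<in> ?A \<omega> n"
    using idla_tips_eventually_occupied[OF assms(2,3) \<delta>(1,2)] .
  moreover have "AE \<omega> in M. \<forall>n. tooth_closed (?A \<omega> n)"
    by (rule idla_tooth_closed_AE[OF assms(2)])
  ultimately show ?thesis
  proof eventually_elim
    case (elim \<omega>)
    from elim(1) show ?case
    proof eventually_elim
      case tips: (elim n)
      have "comb_ball (real n * (1 - \<epsilon>)) \<subseteq> comb_ball (real n * (1 - \<delta>))"
        using \<delta> by (intro comb_ball_mono mult_left_mono) auto
      also have "\<dots> \<subseteq> ?A \<omega> n"
      proof (rule subrelI)
        fix x y assume xy: "(x, y) \<in> comb_ball (real n * (1 - \<delta>))"
        note cover = tip_covers_ball[OF xy less_imp_le[OF \<delta>(1)]]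
        have "(x, int (tip \<delta> n x)) \<in> ?A \<omega> n" "(x, - int (tip \<delta> n x)) \<in> ?A \<omega> n"
          using tips[rule_format, OF cover(1), of 1] tips[rule_format, OF cover(1), of "- 1"] by simp_all
        then show "(x, y) \<in> ?A \<omega> n"
          using tooth_closed_below_tip[OF _ _ _ cover(2)] elim(2) by simp
      qed
      finally show ?case .
    qed
  qed
qed

end
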